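(* Let $T>0$. The energy functionals on the group $\operatorname{Diff}_{\mathcal S}(\mathbb R)$ and on the Virasoro-Bott group $\mathbb R\times_c\operatorname{Diff}_{\mathcal S}(\mathbb R)$, even when restricted to paths with fixed distinct endpoints, have no local minima. That is, let $G$ be either of these groups and let $g_0\neq g_1$ be elements of $G$; then no path $[0,T]\to G$ from $g_0$ to $g_1$ is a local minimum of the energy functional $E$ restricted to the space of paths in $G$ from $g_0$ to $g_1$. Consequently, all stationary points of this restricted functional are saddle points.
   Context: $\mathcal S(\mathbb R)$ is the space of rapidly decreasing smooth functions on $\mathbb R$, topologized by the seminorms $\sum_{i\le m}\|(1+|x|^2)^k\partial_x^i f\|_\infty$, $k,m\in\mathbb N$ (with $0\in\mathbb N$). $\operatorname{Diff}_{\mathcal S}(\mathbb R)$ is the group, under composition, of diffeomorphisms of $\mathbb R$ of the form $\operatorname{Id}+f$ with $f\in\mathcal S(\mathbb R)$; all its elements have positive derivative. The Bott cocycle is $c(\varphi,\psi)=\frac12\int_{\mathbb R}\log((\varphi\circ\psi)')\,d\log\psi'$. The Virasoro-Bott group $\mathbb R\times_c\operatorname{Diff}_{\mathcal S}(\mathbb R)$ is the set of pairs $(\varphi,\alpha)$ with $\varphi\in\operatorname{Diff}_{\mathcal S}(\mathbb R)$, $\alpha\in\mathbb R$, with multiplication $(\varphi,\alpha)(\psi,\beta)=(\varphi\circ\psi,\ \alpha+\beta+c(\varphi,\psi))$. A path in $\operatorname{Diff}_{\mathcal S}(\mathbb R)$ is a smooth map $\varphi:[0,T]\times\mathbb R\to\mathbb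 R$ with $\varphi(t,\cdot)\in\operatorname{Diff}_{\mathcal S}(\mathbb R)$ for every $t$ and $\varphi(t,x)-x\in\mathcal S([0,T]\times\mathbb R)$; a path in the Virasoro-Bott group is a pair $(\varphi,\alpha)$ with $\varphi$ such a path and $\alpha\in C^\infty([0,T])$ real-valued. The topology of $\mathcal S([0,T]\times\mathbb R)$ is given by the seminorms $$\|h\|_{\mathcal S^{k,m,n}}=\sum_{i\le m,\ j\le n}\|(1+|x|^2)^k\partial_x^i\partial_t^j h\|_\infty,\qquad k,m,n\in\mathbb N,$$ and that of $C^\infty([0,T])$ by the $C^n$-norms; the spaces of paths carry the induced topologies (via $\varphi\mapsto\varphi-x$), and "local" refers to these topologies. The energies, with respect to the right-invariant $L^2$-metrics, are $$E(\varphi)=\int_0^T\int_{\mathbb R}\varphi_t^2\,\varphi_x\,dx\,dt$$ on $\operatorname{Diff}_{\mathcal S}(\mathbb R)$ and $$E(\varphi,\alpha)=\int_0^T\int_{\mathbb R}\varphi_t^2\varphi_x\,dx\,dt+\int_0^T\Big(\alpha_t-\int_{\mathbb R}\frac{\varphi_{tx}\varphi_{xx}}{\varphi_x^2}\,dx\Big)^2dt$$ on the Virasoro-Bott group. A stationary point is a critical point of the energy restricted to paths with fixed endpoints; a saddle point is a stationary point that is not a local extremum. *)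

theory Defs
  imports "HOL-Analysis.Analysis" "HOL-Algebra.Group"
begin

section \<open>The groups\<close>

definition smooth_line :: "(real \<Rightarrow> real) \<Rightarrow> bool" where
  "smooth_line f \<longleftrightarrow> (\<forall>n. (deriv ^^ n) f differentiable_on UNIV)"

definition schwartz_line :: "(real \<Rightarrow> real) set" where
  "schwartz_line =
     {f. smooth_line f \<and>
         (\<forall>k i. bounded (range (\<lambda>x. (1 + \<bar>x\<bar>\<^sup>2) ^ k * (deriv ^^ i) f x)))}"

definition diffeomorphism_line :: "(real \<Rightarrow> real) \<Rightarrow> bool" where
  "diffeomorphism_line \<phi> \<longleftrightarrow> bij \<phi> \<and> smooth_line \<phi> \<and> smooth_line (inv_into UNIV \<phi>)"

definition Diff_S :: "(real \<Rightarrow> real) monoid" where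
  "Diff_S = \<lparr>carrier = {\<phi>. diffeomorphism_line \<phi> \<and> (\<lambda>x. \<phi> x - x) \<in> schwartz_line},
             mult = (\<circ>), one = id\<rparr>"

definition bott_cocycle :: "(real \<Rightarrow> real) \<Rightarrow> (real \<Rightarrow> real) \<Rightarrow> real" where
  "bott_cocycle \<phi> \<psi> =
     1 / 2 * (LINT x|lborel. ln (deriv (\<phi> \<circ> \<psi>) x) * deriv (\<lambda>y. ln (deriv \<psi> y)) x)"

definition Virasoro_Bott :: "((real \<Rightarrow> real) \<times> real) monoid" where
  "Virasoro_Bott = \<lparr>carrier = carrier Diff_S \<times> UNIV,
     mult = (\<lambda>(\<phi>, a) (\<psi>, b). (\<phi> \<otimes>\<^bsub>Diff_S\<^esub> \<psi>, a + b + bott_cocycle \<phi> \<psi>)),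
     one = (id, 0)\<rparr>"


section \<open>Functions on the strip and on the interval\<close>

text \<open>
  A function on \<open>[0,T] \<times> \<real>\<close> is represented by \<open>h :: real \<Rightarrow> real \<Rightarrow> real\<close>, with the time
  variable first. The values \<open>h t\<close> for \<open>t\<close> outside \<open>[0,T]\<close> play no role: no notion below depends
  on them, so functions agreeing on \<open>[0,T]\<close> stand for the same object (and lie in the same open
  sets). The same convention is used for functions on \<open>[0,T]\<close>. Time derivatives are taken
  within \<open>[0,T]\<close>, hence are one-sided at the end points.
\<close>

definition deriv_I :: "real \<Rightarrow> (real \<Rightarrow> real) \<Rightarrow> real \<Rightarrow> real" where
  "deriv_I T a t = vector_derivative a (at t within {0..T})"

definition D_t :: "real \<Rightarrow> (real \<Rightarrow> real \<Rightarrow> real) \<Rightarrow> real \<Rightarrow> real \<Rightarrow> real" where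
  "D_t T h t x = deriv_I T (\<lambda>s. h s x) t"

definition D_x :: "(real \<Rightarrow> real \<Rightarrow> real) \<Rightarrow> real \<Rightarrow> real \<Rightarrow> real" where
  "D_x h t x = deriv (h t) x"

primrec Ck_strip :: "nat \<Rightarrow> real \<Rightarrow> (real \<Rightarrow> real \<Rightarrow> real) \<Rightarrow> bool" where
  "Ck_strip 0 T h \<longleftrightarrow> continuous_on ({0..T} \<times> UNIV) (\<lambda>(t, x). h t x)"
| "Ck_strip (Suc k) T h \<longleftrightarrow>
     continuous_on ({0..T} \<times> UNIV) (\<lambda>(t, x). h t x) \<and>
     (\<forall>x. (\<lambda>t. h t x) differentiable_on {0..T}) \<and>
     (\<forall>t\<in>{0..T}. h t differentiable_on UNIV) \<and>
     Ck_strip k T (D_t T h) \<and> Ck_strip k T (D_x h)"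

definition smooth_strip :: "real \<Rightarrow> (real \<Rightarrow> real \<Rightarrow> real) \<Rightarrow> bool" where
  "smooth_strip T h \<longleftrightarrow> (\<forall>k. Ck_strip k T h)"

definition weighted_sup :: "real \<Rightarrow> nat \<Rightarrow> nat \<Rightarrow> nat \<Rightarrow> (real \<Rightarrow> real \<Rightarrow> real) \<Rightarrow> real" where
  "weighted_sup T k i j h =
     (SUP (t, x)\<in>{0..T} \<times> UNIV. \<bar>(1 + \<bar>x\<bar>\<^sup>2) ^ k * (D_x ^^ i) ((D_t T ^^ j) h) t x\<bar>)"

definition schwartz_strip :: "real \<Rightarrow> (real \<Rightarrow> real \<Rightarrow> real) set" where
  "schwartz_strip T =
     {h. smooth_strip T h \<and>
         (\<forall>k i j. bounded ((\<lambda>(t, x). (1 + \<bar>x\<bar>\<^sup>2) ^ k * (D_x ^^ i) ((D_t T ^^ j) h) t x)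
                            ` ({0..T} \<times> UNIV)))}"

definition schwartz_seminorm :: "real \<Rightarrow> nat \<Rightarrow> nat \<Rightarrow> nat \<Rightarrow> (real \<Rightarrow> real \<Rightarrow> real) \<Rightarrow> real" where
  "schwartz_seminorm T k m n h = (\<Sum>i\<le>m. \<Sum>j\<le>n. weighted_sup T k i j h)"

definition schwartz_topology :: "real \<Rightarrow> (real \<Rightarrow> real \<Rightarrow> real) topology" where
  "schwartz_topology T = topology_generated_by
     {{h \<in> schwartz_strip T. schwartz_seminorm T k m n (\<lambda>t x. h t x - f t x) < \<epsilon>}
       | f k m n \<epsilon>. f \<in> schwartz_strip T \<and> \<epsilon> > 0}"

definition smooth_I :: "real \<Rightarrow> (real \<Rightarrow> real) set" where
  "smooth_I T = {a. \<forall>n. (deriv_I T ^^ n) a differentiable_on {0..T}}"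

definition Cn_norm :: "real \<Rightarrow> nat \<Rightarrow> (real \<Rightarrow> real) \<Rightarrow> real" where
  "Cn_norm T n a = (\<Sum>j\<le>n. SUP t\<in>{0..T}. \<bar>(deriv_I T ^^ j) a t\<bar>)"

definition smooth_I_topology :: "real \<Rightarrow> (real \<Rightarrow> real) topology" where
  "smooth_I_topology T = topology_generated_by
     {{a \<in> smooth_I T. Cn_norm T n (\<lambda>t. a t - b t) < \<epsilon>} | b n \<epsilon>. b \<in> smooth_I T \<and> \<epsilon> > 0}"


section \<open>Spaces of paths\<close>

definition diff_paths :: "real \<Rightarrow> (real \<Rightarrow> real \<Rightarrow> real) set" where
  "diff_paths T =
     {\<phi>. smooth_strip T \<phi> \<and> (\<forall>t\<in>{0..T}. \<phi> t \<in> carrier Diff_S) \<and>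
         (\<lambda>t x. \<phi> t x - x) \<in> schwartz_strip T}"

definition vb_paths :: "real \<Rightarrow> ((real \<Rightarrow> real \<Rightarrow> real) \<times> (real \<Rightarrow> real)) set" where
  "vb_paths T = diff_paths T \<times> smooth_I T"

definition diff_path_topology :: "real \<Rightarrow> (real \<Rightarrow> real \<Rightarrow> real) topology" where
  "diff_path_topology T =
     pullback_topology (diff_paths T) (\<lambda>\<phi> t x. \<phi> t x - x) (schwartz_topology T)"

definition vb_path_topology ::
    "real \<Rightarrow> ((real \<Rightarrow> real \<Rightarrow> real) \<times> (real \<Rightarrow> real)) topology" where
  "vb_path_topology T = prod_topology (diff_path_topology T) (smooth_I_topology T)"

definition diff_paths_between ::
    "real \<Rightarrow> (real \<Rightarrow> real) \<Rightarrow> (real \<Rightarrow> real) \<Rightarrow> (real \<Rightarrow> real \<Rightarrow> real) set" where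
  "diff_paths_between T g0 g1 = {\<phi> \<in> diff_paths T. \<phi> 0 = g0 \<and> \<phi> T = g1}"

definition vb_paths_between ::
    "real \<Rightarrow> (real \<Rightarrow> real) \<times> real \<Rightarrow> (real \<Rightarrow> real) \<times> real
      \<Rightarrow> ((real \<Rightarrow> real \<Rightarrow> real) \<times> (real \<Rightarrow> real)) set" where
  "vb_paths_between T g0 g1 =
     {(\<phi>, \<alpha>) \<in> vb_paths T. (\<phi> 0, \<alpha> 0) = g0 \<and> (\<phi> T, \<alpha> T) = g1}"


section \<open>Energies\<close>

definition diff_energy :: "real \<Rightarrow> (real \<Rightarrow> real \<Rightarrow> real) \<Rightarrow> real" where
  "diff_energy T \<phi> =
     (LINT t:{0..T}|lborel. LINT x|lborel. (D_t T \<phi> t x)\<^sup>2 * D_x \<phi> t x)"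

definition vb_energy :: "real \<Rightarrow> (real \<Rightarrow> real \<Rightarrow> real) \<times> (real \<Rightarrow> real) \<Rightarrow> real" where
  "vb_energy T = (\<lambda>(\<phi>, \<alpha>).
     (LINT t:{0..T}|lborel. LINT x|lborel. (D_t T \<phi> t x)\<^sup>2 * D_x \<phi> t x) +
     (LINT t:{0..T}|lborel.
        (deriv_I T \<alpha> t -
         (LINT x|lborel. D_x (D_t T \<phi>) t x * D_x (D_x \<phi>) t x / (D_x \<phi> t x)\<^sup>2))\<^sup>2))"


section \<open>Local extrema, stationary points, saddle points\<close>

definition local_minimum_on :: "'p topology \<Rightarrow> ('p \<Rightarrow> real) \<Rightarrow> 'p \<Rightarrow> bool" where
  "local_minimum_on X F p \<longleftrightarrow> (\<exists>U. openin X U \<and> p \<in> U \<and> (\<forall>q\<in>U. F p \<le> F q))"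

definition local_maximum_on :: "'p topology \<Rightarrow> ('p \<Rightarrow> real) \<Rightarrow> 'p \<Rightarrow> bool" where
  "local_maximum_on X F p \<longleftrightarrow> (\<exists>U. openin X U \<and> p \<in> U \<and> (\<forall>q\<in>U. F q \<le> F p))"

definition local_extremum_on :: "'p topology \<Rightarrow> ('p \<Rightarrow> real) \<Rightarrow> 'p \<Rightarrow> bool" where
  "local_extremum_on X F p \<longleftrightarrow> local_minimum_on X F p \<or> local_maximum_on X F p"

definition diff_fixed_ends ::
    "real \<Rightarrow> (real \<Rightarrow> real) \<Rightarrow> (real \<Rightarrow> real) \<Rightarrow> (real \<Rightarrow> real \<Rightarrow> real) topology" where
  "diff_fixed_ends T g0 g1 = subtopology (diff_path_topology T) (diff_paths_between T g0 g1)"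

definition vb_fixed_ends ::
    "real \<Rightarrow> (real \<Rightarrow> real) \<times> real \<Rightarrow> (real \<Rightarrow> real) \<times> real
      \<Rightarrow> ((real \<Rightarrow> real \<Rightarrow> real) \<times> (real \<Rightarrow> real)) topology" where
  "vb_fixed_ends T g0 g1 = subtopology (vb_path_topology T) (vb_paths_between T g0 g1)"

text \<open>
  The paths with given end points form an open subset of an affine space modelled on the
  functions vanishing at \<open>t = 0\<close> and \<open>t = T\<close>. A critical point is one where the derivative of
  the energy in each of these directions exists and is zero.
\<close>

definition diff_variations :: "real \<Rightarrow> (real \<Rightarrow> real \<Rightarrow> real) set" where
  "diff_variations T = {h \<in> schwartz_strip T. \<forall>x. h 0 x = 0 \<and> h T x = 0}"

definition I_variations :: "real \<Rightarrow> (real \<Rightarrow> real) set" where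
  "I_variations T = {b \<in> smooth_I T. b 0 = 0 \<and> b T = 0}"

definition diff_stationary ::
    "real \<Rightarrow> (real \<Rightarrow> real) \<Rightarrow> (real \<Rightarrow> real) \<Rightarrow> (real \<Rightarrow> real \<Rightarrow> real) \<Rightarrow> bool" where
  "diff_stationary T g0 g1 \<phi> \<longleftrightarrow>
     \<phi> \<in> diff_paths_between T g0 g1 \<and>
     (\<forall>h\<in>diff_variations T.
        ((\<lambda>\<epsilon>. diff_energy T (\<lambda>t x. \<phi> t x + \<epsilon> * h t x)) has_real_derivative 0) (at 0))"

definition vb_stationary ::
    "real \<Rightarrow> (real \<Rightarrow> real) \<times> real \<Rightarrow> (real \<Rightarrow> real) \<times> real
      \<Rightarrow> (real \<Rightarrow> real \<Rightarrow> real) \<times> (real \<Rightarrow> real) \<Rightarrow> bool" where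
  "vb_stationary T g0 g1 = (\<lambda>(\<phi>, \<alpha>).
     (\<phi>, \<alpha>) \<in> vb_paths_between T g0 g1 \<and>
     (\<forall>h\<in>diff_variations T. \<forall>b\<in>I_variations T.
        ((\<lambda>\<epsilon>. vb_energy T (\<lambda>t x. \<phi> t x + \<epsilon> * h t x, \<lambda>t. \<alpha> t + \<epsilon> * b t))
           has_real_derivative 0) (at 0)))"

definition diff_saddle ::
    "real \<Rightarrow> (real \<Rightarrow> real) \<Rightarrow> (real \<Rightarrow> real) \<Rightarrow> (real \<Rightarrow> real \<Rightarrow> real) \<Rightarrow> bool" where
  "diff_saddle T g0 g1 \<phi> \<longleftrightarrow>
     diff_stationary T g0 g1 \<phi> \<and>
     \<not> local_extremum_on (diff_fixed_ends T g0 g1) (diff_energy T) \<phi>"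

definition vb_saddle ::
    "real \<Rightarrow> (real \<Rightarrow> real) \<times> real \<Rightarrow> (real \<Rightarrow> real) \<times> real
      \<Rightarrow> (real \<Rightarrow> real \<Rightarrow> real) \<times> (real \<Rightarrow> real) \<Rightarrow> bool" where
  "vb_saddle T g0 g1 p \<longleftrightarrow>
     vb_stationary T g0 g1 p \<and>
     \<not> local_extremum_on (vb_fixed_ends T g0 g1) (vb_energy T) p"

end

theory Submission
  imports Defs "HOL-Probability.Sinc_Integral" "HOL-Computational_Algebra.Polynomial"
begin

text \<open>
  Fix a non-constant path. Leaving \<open>\<alpha>\<close> unchanged and replacing \<open>\<phi>\<close> by \<open>\<phi> + \<epsilon> h\<close>, the energy is
  \<open>E + \<epsilon> A(h) + \<epsilon>\<^sup>2 Q(h) + O(\<epsilon>\<^sup>3)\<close>, and the sign of \<open>\<epsilon>\<close> is free; so it suffices that the quadratic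
  form \<open>Q\<close> takes both signs, whether or not the path is stationary.

  The term \<open>\<integral>\<integral> \<phi>_t\<^sup>2 \<phi>_x\<close> contributes \<open>\<integral>\<integral> \<phi>_x h_t\<^sup>2 + 2 \<phi>_t h_t h_x\<close>, whose integrand is an indefinite
  quadratic form in \<open>(h_t, h_x)\<close> wherever \<open>\<phi>_t \<noteq> 0\<close>. Variations \<open>h\<close> concentrating at a point at
  scale \<open>\<delta>\<close>, of height \<open>\<delta>\<close>, freeze the coefficients there, and this contribution has size \<open>\<delta>\<^sup>2\<close>.

  The term \<open>\<integral> \<beta>\<^sup>2\<close> with \<open>\<beta> = \<alpha>_t - \<integral> \<phi>_tx \<phi>_xx / \<phi>_x\<^sup>2 dx\<close> contributes \<open>\<integral> D1\<^sup>2 - 2 \<beta> D2\<close>, where \<open>D1\<close> and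
  \<open>D2\<close> are the first two coefficients of the inner integral. One integration by parts in \<open>x\<close> gives
  \<open>D1 = O(\<delta>)\<close> on an interval of length \<open>2 \<delta>\<close>, hence \<open>\<integral> D1\<^sup>2 = O(\<delta>\<^sup>3)\<close>, while \<open>\<integral> \<beta> D2\<close> has size one and
  leading term \<open>\<beta> / \<phi>_x\<^sup>2\<close> times \<open>\<integral>\<integral> h_tx h_xx\<close>, which is odd under reflection of the direction of
  concentration. So if \<open>\<beta>\<close> does not vanish, this term decides and has both signs; if \<open>\<beta>\<close> vanishes
  identically, then \<open>\<phi>_t \<noteq> 0\<close> somewhere, as otherwise the end points would agree, and the first
  contribution decides.
\<close>

section \<open>Smooth functions on the line\<close>

text \<open>The obstacle is the term \<integral> D1^2. It is never negative, so when \<beta>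
  vanishes it works against the negative sign. Its integrand contains h_tx and h_xx, both of size 1
  / \<delta>, and a direct estimate only makes the term O(\<delta>), which could swamp the kinetic
  contribution of size \<delta>^2. The integration by parts brings it below that size, because it
  moves a derivative onto coefficients that depend on \<phi> alone.

  Two parameters shape the variations. They are bumps carried along the line of velocity \<kappa>
  through the point. In the case \<beta> \<noteq> 0 the sign of \<kappa> decides the sign of
  \<integral>\<integral> h_tx h_xx; in the other case \<kappa> directs (h_t, h_x) towards the
  negative cone. With compact support h_t = - \<kappa> h_x cannot hold exactly: the cutoff along the
  line leaves an extra positive multiple of \<phi>_x. The parameter \<mu> narrows the bump across
  the line until this excess is outweighed. Since each bump is a product of a function of time and a
  function of the moving space variable, the limiting integrals factor, and the unwanted mixed terms
  carry the vanishing factor \<integral> \<open>bump\<close> \<open>bump'\<close>.\<close>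

primrec Ck_line :: "nat \<Rightarrow> (real \<Rightarrow> real) \<Rightarrow> bool" where
  "Ck_line 0 f \<longleftrightarrow> True"
| "Ck_line (Suc k) f \<longleftrightarrow> f differentiable_on UNIV \<and> Ck_line k (deriv f)"

lemma Ck_line_iff: "Ck_line k f \<longleftrightarrow> (\<forall>n<k. (deriv ^^ n) f differentiable_on UNIV)"
proof (induction k arbitrary: f)
  case (Suc k)
  have "(\<forall>n<Suc k. (deriv ^^ n) f differentiable_on UNIV) \<longleftrightarrow>
      f differentiable_on UNIV \<and> (\<forall>n<k. (deriv ^^ n) (deriv f) differentiable_on UNIV)"
    by (auto simp: less_Suc_eq_0_disj funpow_swap1)
  with Suc show ?case by simp
qed simp

text \<open>Closure of smoothness under an operation cannot be proved in one step, since the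
  derivative of the result is built by the same operation. At a fixed order this is an induction, as
  the derivative needs one order less; this equivalence transfers the outcome.\<close>

lemma smooth_line_iff_Ck: "smooth_line f \<longleftrightarrow> (\<forall>k. Ck_line k f)"
  by (auto simp: smooth_line_def Ck_line_iff)

lemma Ck_line_SucI:
  assumes "\<And>x. (f has_real_derivative f' x) (at x)" "Ck_line k f'"
  shows "Ck_line (Suc k) f"
proof -
  have "deriv f = f'" using assms(1) by (auto intro: DERIV_imp_deriv)
  moreover have "f differentiable_on UNIV"
    using assms(1) by (auto simp: differentiable_on_def real_differentiable_def)
  ultimately show ?thesis using assms(2) by simp
qed

lemma Ck_line_SucD:
  assumes "Ck_line (Suc k) f"
  shows "(f has_real_derivative deriv f x) (at x)" "Ck_line k (deriv f)"
proof -
  have "f differentiable (at x)" using assms by (simp add: differentiable_on_def)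
  then show "(f has_real_derivative deriv f x) (at x)"
    using DERIV_deriv_iff_real_differentiable by blast
  show "Ck_line k (deriv f)" using assms by simp
qed

lemma Ck_line_mono: "Ck_line (Suc k) f \<Longrightarrow> Ck_line k f"
  by (induction k arbitrary: f) auto

lemma Ck_line_add: "Ck_line k f \<Longrightarrow> Ck_line k g \<Longrightarrow> Ck_line k (\<lambda>x. f x + g x)"
proof (induction k arbitrary: f g)
  case (Suc k)
  show ?case
    by (rule Ck_line_SucI[where f'="\<lambda>x. deriv f x + deriv g x"])
      (use Suc Ck_line_SucD[OF Suc.prems(1)] Ck_line_SucD[OF Suc.prems(2)] in
        \<open>auto intro!: derivative_eq_intros\<close>)
qed simp

lemma Ck_line_mult: "Ck_line k f \<Longrightarrow> Ck_line k g \<Longrightarrow> Ck_line k (\<lambda>x. f x * g x)"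
proof (induction k arbitrary: f g)
  case (Suc k)
  show ?case
  proof (rule Ck_line_SucI[where f'="\<lambda>x. deriv f x * g x + deriv g x * f x"])
    show "((\<lambda>x. f x * g x) has_real_derivative deriv f x * g x + deriv g x * f x) (at x)" for x
      using Ck_line_SucD[OF Suc.prems(1)] Ck_line_SucD[OF Suc.prems(2)] by (intro DERIV_mult)
    show "Ck_line k (\<lambda>x. deriv f x * g x + deriv g x * f x)"
      using Suc Ck_line_mono by (intro Ck_line_add Suc.IH) (auto simp del: Ck_line.simps(2) dest: Ck_line_SucD)
  qed
qed simp

lemma Ck_line_const: "Ck_line k (\<lambda>x. c)"
proof (induction k arbitrary: c)
  case (Suc k)
  show ?case by (rule Ck_line_SucI[where f'="\<lambda>x. 0"]) (use Suc in auto)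
qed simp

lemma Ck_line_affine: "Ck_line k (\<lambda>x. a * x + c)"
proof (cases k)
  case (Suc n)
  show ?thesis unfolding Suc
    by (rule Ck_line_SucI[where f'="\<lambda>x. a"]) (auto intro!: derivative_eq_intros Ck_line_const)
qed simp

lemma Ck_line_compose: "Ck_line k f \<Longrightarrow> Ck_line k g \<Longrightarrow> Ck_line k (\<lambda>x. f (g x))"
proof (induction k arbitrary: f g)
  case (Suc k)
  show ?case
  proof (rule Ck_line_SucI[where f'="\<lambda>x. deriv f (g x) * deriv g x"])
    show "((\<lambda>x. f (g x)) has_real_derivative deriv f (g x) * deriv g x) (at x)" for x
      using Ck_line_SucD[OF Suc.prems(1)] Ck_line_SucD[OF Suc.prems(2)] by (intro DERIV_chain2)
    show "Ck_line k (\<lambda>x. deriv f (g x) * deriv g x)"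
      by (rule Ck_line_mult[OF Suc.IH[OF Ck_line_SucD(2) Ck_line_mono] Ck_line_SucD(2)]) (fact Suc.prems)+
  qed
qed simp

lemma Ck_line_inverse:
  "Ck_line k f \<Longrightarrow> (\<And>x. f x \<noteq> 0) \<Longrightarrow> Ck_line k (\<lambda>x. inverse (f x))"
proof (induction k)
  case (Suc k)
  show ?case
  proof (rule Ck_line_SucI[where f'="\<lambda>x. (- 1) * (inverse (f x) * deriv f x * inverse (f x))"])
    show "((\<lambda>x. inverse (f x)) has_real_derivative (- 1) * (inverse (f x) * deriv f x * inverse (f x))) (at x)" for x
      using DERIV_inverse'[OF Ck_line_SucD(1)[OF Suc.prems(1)] Suc.prems(2)] by simp
    have "Ck_line k (\<lambda>x. inverse (f x))" using Suc Ck_line_mono by auto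
    then show "Ck_line k (\<lambda>x. (- 1) * (inverse (f x) * deriv f x * inverse (f x)))"
      using Ck_line_SucD(2)[OF Suc.prems(1)] by (intro Ck_line_mult Ck_line_const)
  qed
qed simp

lemma smooth_line_deriv: "smooth_line f \<Longrightarrow> smooth_line (deriv f)"
  by (metis Ck_line.simps(2) smooth_line_iff_Ck)

lemma smooth_line_DERIV: "smooth_line f \<Longrightarrow> (f has_real_derivative deriv f x) (at x)"
  by (meson Ck_line_SucD(1) smooth_line_iff_Ck)

lemma smooth_line_isCont: "smooth_line f \<Longrightarrow> isCont f x"
  using smooth_line_DERIV DERIV_isCont by blast

lemma smooth_line_mult: "smooth_line f \<Longrightarrow> smooth_line g \<Longrightarrow> smooth_line (\<lambda>x. f x * g x)"
  by (simp add: smooth_line_iff_Ck Ck_line_mult)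

lemma smooth_line_compose: "smooth_line f \<Longrightarrow> smooth_line g \<Longrightarrow> smooth_line (\<lambda>x. f (g x))"
  by (simp add: smooth_line_iff_Ck Ck_line_compose)

lemma smooth_line_affine: "smooth_line (\<lambda>x. a * x + c)"
  by (simp add: smooth_line_iff_Ck Ck_line_affine)

text \<open>The derivative of the inverse \<open>g\<close> is the reciprocal of
  \<open>deriv f\<close> composed with \<open>g\<close>, so \<open>k\<close> orders of
  differentiability of \<open>g\<close> yield the next one.\<close>

lemma smooth_line_inv_into:
  fixes f :: "real \<Rightarrow> real"
  assumes smooth: "smooth_line f" and bij: "bij f" and nz: "\<And>x. deriv f x \<noteq> 0"
  shows "smooth_line (inv_into UNIV f)"
proof -
  let ?g = "inv_into UNIV f"
  have fg: "f (?g y) = y" and gf: "?g (f x) = x" for x y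
    using bij by (auto simp: bij_def surj_f_inv_f)
  have "isCont ?g (f (?g y))" for y
    by (rule isCont_inverse_function[where d=1 and f=f and g="?g" and x="?g y"])
      (simp_all only: gf smooth_line_isCont[OF smooth] zero_less_one)
  then have cont: "isCont ?g y" for y by (simp only: fg)
  have der: "(?g has_real_derivative inverse (deriv f (?g y))) (at y)" for y
    by (rule DERIV_inverse_function[OF smooth_line_DERIV[OF smooth] nz, of "y - 1" _ "y + 1"])
      (auto simp: fg cont)
  have "Ck_line k ?g" for k
  proof (induction k)
    case (Suc k)
    have "Ck_line k (deriv f)" using smooth smooth_line_deriv smooth_line_iff_Ck by blast
    then show ?case
      by (intro Ck_line_SucI[OF der] Ck_line_inverse[OF Ck_line_compose[OF _ Suc]] nz)
  qed simp
  then show ?thesis by (simp add: smooth_line_iff_Ck)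
qed

section \<open>A smooth bump function\<close>

definition flat_poly :: "real poly \<Rightarrow> real \<Rightarrow> real" where
  "flat_poly r x = (if x > 0 then poly r (1 / x) * exp (- (1 / x)) else 0)"

lemma poly_times_exp_tendsto_0: "((\<lambda>y. poly r y * exp (- y)) \<longlongrightarrow> 0) (at_top :: real filter)"
proof -
  have mono: "((\<lambda>y::real. y ^ i * exp (- y)) \<longlongrightarrow> 0) at_top" for i
    using tendsto_power_div_exp_0[of i] by (simp add: exp_minus divide_inverse)
  have "((\<lambda>y. \<Sum>i\<le>degree r. coeff r i * (y ^ i * exp (- y))) \<longlongrightarrow> (\<Sum>i\<le>degree r. coeff r i * 0)) at_top"
    by (intro tendsto_sum tendsto_mult tendsto_const mono)
  then show ?thesis by (simp add: poly_altdef sum_distrib_right mult.assoc)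
qed

lemma flat_poly_tendsto_0: "((\<lambda>x. flat_poly r x) \<longlongrightarrow> 0) (at 0)"
proof -
  have "((\<lambda>x. poly r (1 / x) * exp (- (1 / x))) \<longlongrightarrow> 0) (at_right 0)"
    using filterlim_compose[OF poly_times_exp_tendsto_0 filterlim_inverse_at_top_right]
    by (simp add: inverse_eq_divide)
  then have "((\<lambda>x. flat_poly r x) \<longlongrightarrow> 0) (at_right 0)"
    by (rule Lim_transform_eventually)
      (auto simp: eventually_at_filter flat_poly_def)
  moreover have "((\<lambda>x. flat_poly r x) \<longlongrightarrow> 0) (at_left 0)"
    by (rule Lim_transform_eventually[OF tendsto_const]) (auto simp: eventually_at_filter flat_poly_def)
  ultimately show ?thesis by (simp add: filterlim_split_at)
qed

text \<open>The polynomial factor makes the family closed under differentiation: with y = 1 / x, the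
  x-derivative of r(y) exp(-y) is y^2 (r(y) - r'(y)) exp(-y). Smoothness of every member then
  follows by one induction over all \<open>r\<close>.\<close>

lemma flat_poly_DERIV:
  "(flat_poly r has_real_derivative flat_poly (monom 1 2 * (r - pderiv r)) x) (at x)"
proof -
  consider "x < 0" | "x = 0" | "x > 0" by linarith
  then show ?thesis
  proof cases
    case 1
    have "((\<lambda>x. 0) has_real_derivative 0) (at x)" by simp
    then have "(flat_poly r has_real_derivative 0) (at x)"
      by (rule has_field_derivative_transform_within_open[where S="{..<0}"]) (use 1 in \<open>auto simp: flat_poly_def\<close>)
    then show ?thesis using 1 by (simp add: flat_poly_def)
  next
    case 2
    \<comment> \<open>At 0 the difference quotient is again a flat function: dividing by
      \<open>h\<close> multiplies the polynomial by its variable.\<close>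
    have "((\<lambda>h. flat_poly (pCons 0 r) h) \<longlongrightarrow> 0) (at 0)" by (rule flat_poly_tendsto_0)
    then have "((\<lambda>h. (flat_poly r (0 + h) - flat_poly r 0) / h) \<longlongrightarrow> 0) (at 0)"
      by (rule Lim_transform_eventually) (auto simp: flat_poly_def eventually_at_filter)
    then show ?thesis using 2 by (simp add: DERIV_def flat_poly_def)
  next
    case 3
    have inv: "((\<lambda>x. 1 / x) has_real_derivative - (1 / x)\<^sup>2) (at x)"
      using 3 by (auto intro!: derivative_eq_intros simp: power2_eq_square)
    have "((\<lambda>x. poly r (1 / x) * exp (- (1 / x))) has_real_derivative
        (poly (pderiv r) (1 / x) * - (1 / x)\<^sup>2) * exp (- (1 / x)) + (exp (- (1 / x)) * - (- (1 / x)\<^sup>2)) * poly r (1 / x)) (at x)"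
      by (intro DERIV_mult DERIV_chain2[OF poly_DERIV inv] DERIV_chain2[OF DERIV_exp DERIV_minus[OF inv]])
    also have "(poly (pderiv r) (1 / x) * - (1 / x)\<^sup>2) * exp (- (1 / x)) + (exp (- (1 / x)) * - (- (1 / x)\<^sup>2)) * poly r (1 / x)
        = flat_poly (monom 1 2 * (r - pderiv r)) x"
      using 3 by (simp add: flat_poly_def poly_monom algebra_simps)
    finally have "((\<lambda>x. poly r (1 / x) * exp (- (1 / x))) has_real_derivative
        flat_poly (monom 1 2 * (r - pderiv r)) x) (at x)" .
    then show ?thesis
      by (rule has_field_derivative_transform_within_open[where S="{0<..}"]) (use 3 in \<open>auto simp: flat_poly_def\<close>)
  qed
qed

lemma smooth_line_flat_poly: "smooth_line (flat_poly r)"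
proof -
  have "Ck_line k (flat_poly r)" for k
    by (induction k arbitrary: r) (auto intro!: Ck_line_SucI[OF flat_poly_DERIV] simp del: Ck_line.simps(2)) 
  then show ?thesis by (simp add: smooth_line_iff_Ck)
qed

text \<open>The support stays away from \<plusminus>1, so that \<open>bump\<close> and all its
  derivatives vanish where the absolute value is at least 1, as \<open>profile\<close>
  requires.\<close>

definition bump :: "real \<Rightarrow> real" where
  "bump x = flat_poly 1 (2 * x + 1) * flat_poly 1 (- 2 * x + 1)"

lemma smooth_line_bump: "smooth_line bump"
  unfolding bump_def[abs_def]
  by (intro smooth_line_mult smooth_line_compose[OF smooth_line_flat_poly] smooth_line_affine)

lemma bump_eq_0: "1 / 2 < \<bar>x\<bar> \<Longrightarrow> bump x = 0"
  by (auto simp: bump_def flat_poly_def)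

lemma bump_0_pos: "bump 0 > 0"
  by (simp add: bump_def flat_poly_def)

section \<open>Calculus on the strip\<close>

lemma deriv_I_cong:
  assumes "t \<in> {0..T}" "\<And>s. s \<in> {0..T} \<Longrightarrow> a s = b s"
  shows "deriv_I T a t = deriv_I T b t"
proof -
  have "(a has_vector_derivative d) (at t within {0..T}) \<longleftrightarrow> (b has_vector_derivative d) (at t within {0..T})" for d
    using has_vector_derivative_transform[of t "{0..T}" b a d] has_vector_derivative_transform[of t "{0..T}" a b d] assms
    by auto
  then show ?thesis by (simp add: deriv_I_def vector_derivative_def)
qed

lemma D_t_cong: "(\<And>s. s \<in> {0..T} \<Longrightarrow> h s = h' s) \<Longrightarrow> t \<in> {0..T} \<Longrightarrow> D_t T h t = D_t T h' t"
  by (auto simp: D_t_def fun_eq_iff intro!: deriv_I_cong)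

lemma D_x_cong: "h t = h' t \<Longrightarrow> D_x h t = D_x h' t"
  by (simp add: D_x_def[abs_def])

lemma differentiable_on_cong_eq:
  assumes "\<And>t. t \<in> S \<Longrightarrow> f t = g t"
  shows "f differentiable_on S \<longleftrightarrow> g differentiable_on S"
proof -
  have "v differentiable_on S" if "u differentiable_on S" "\<And>t. t \<in> S \<Longrightarrow> u t = v t" for u v :: "'a \<Rightarrow> 'b"
    using that by (metis differentiable_def differentiable_on_def has_derivative_transform)
  with assms show ?thesis by metis
qed

text \<open>Formulas for \<open>D_t T h\<close> are only available at times in [0,T]; this allows
  them to be substituted inside \<open>Ck_strip\<close>, as \<open>Ck_strip_SucI\<close>
  does.\<close>

lemma Ck_strip_cong:
  "(\<And>t. t \<in> {0..T} \<Longrightarrow> h t = h' t) \<Longrightarrow> Ck_strip k T h \<longleftrightarrow> Ck_strip k T h'"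
proof (induction k arbitrary: h h')
  case 0
  then show ?case by (auto intro!: continuous_on_cong)
next
  case (Suc k)
  have "continuous_on ({0..T} \<times> UNIV) (\<lambda>(t, x). h t x) \<longleftrightarrow> continuous_on ({0..T} \<times> UNIV) (\<lambda>(t, x). h' t x)"
    using Suc.prems by (auto intro!: continuous_on_cong)
  moreover have "(\<lambda>t. h t x) differentiable_on {0..T} \<longleftrightarrow> (\<lambda>t. h' t x) differentiable_on {0..T}" for x
    using Suc.prems by (intro differentiable_on_cong_eq) auto
  moreover have "Ck_strip k T (D_t T h) \<longleftrightarrow> Ck_strip k T (D_t T h')"
    using Suc.prems by (intro Suc.IH D_t_cong)
  moreover have "Ck_strip k T (D_x h) \<longleftrightarrow> Ck_strip k T (D_x h')"
    using Suc.prems by (intro Suc.IH D_x_cong)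
  ultimately show ?case using Suc.prems by auto
qed

lemma Ck_strip_SucD:
  assumes "Ck_strip (Suc k) T h"
  shows "t \<in> {0..T} \<Longrightarrow> ((\<lambda>s. h s x) has_real_derivative D_t T h t x) (at t within {0..T})"
    "t \<in> {0..T} \<Longrightarrow> (h t has_real_derivative D_x h t x) (at x)"
    "Ck_strip k T (D_t T h)" "Ck_strip k T (D_x h)"
proof -
  assume t: "t \<in> {0..T}"
  then have "(\<lambda>s. h s x) differentiable (at t within {0..T})"
    using assms by (auto simp: differentiable_on_def)
  then show "((\<lambda>s. h s x) has_real_derivative D_t T h t x) (at t within {0..T})"
    by (simp add: D_t_def deriv_I_def has_real_derivative_iff_has_vector_derivative vector_derivative_works)
  have "h t differentiable (at x)" using assms t by (auto simp: differentiable_on_def)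
  then show "(h t has_real_derivative D_x h t x) (at x)"
    by (simp add: D_x_def DERIV_deriv_iff_real_differentiable)
qed (use assms in auto)

lemma Ck_strip_continuous: "Ck_strip k T h \<Longrightarrow> continuous_on ({0..T} \<times> UNIV) (\<lambda>(t, x). h t x)"
  by (cases k) auto

lemma Ck_strip_mono: "Ck_strip (Suc k) T h \<Longrightarrow> Ck_strip k T h"
proof (induction k arbitrary: h)
  case 0
  then show ?case by simp
next
  case (Suc k)
  have "Ck_strip k T (D_t T h)" "Ck_strip k T (D_x h)"
    by (rule Suc.IH, rule Ck_strip_SucD, fact Suc.prems)+
  with Suc.prems show ?case
    unfolding Ck_strip.simps(2)[of "Suc k"] Ck_strip.simps(2)[of k T h] by blast
qed

locale time_interval =
  fixes T :: real
  assumes T_pos: "0 < T"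
begin

lemma deriv_I_eq:
  assumes "t \<in> {0..T}" "(a has_real_derivative d) (at t within {0..T})"
  shows "deriv_I T a t = d"
  unfolding deriv_I_def
  by (rule vector_derivative_within_closed_interval)
    (use assms T_pos in \<open>auto simp: has_real_derivative_iff_has_vector_derivative\<close>)

lemma Ck_strip_SucI:
  assumes cont: "continuous_on ({0..T} \<times> UNIV) (\<lambda>(t, x). h t x)"
    and t: "\<And>t x. t \<in> {0..T} \<Longrightarrow> ((\<lambda>s. h s x) has_real_derivative ht t x) (at t within {0..T})"
    and x: "\<And>t x. t \<in> {0..T} \<Longrightarrow> (h t has_real_derivative hx t x) (at x)"
    and Ck: "Ck_strip k T ht" "Ck_strip k T hx"
  shows "Ck_strip (Suc k) T h"
proof -
  have "D_t T h s = ht s" if "s \<in> {0..T}" for s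
    unfolding D_t_def by (rule ext, rule deriv_I_eq[OF that t[OF that]])
  with Ck(1) have "Ck_strip k T (D_t T h)" by (subst Ck_strip_cong)
  moreover have "D_x h s = hx s" if "s \<in> {0..T}" for s
    unfolding D_x_def by (rule ext, rule DERIV_imp_deriv[OF x[OF that]])
  with Ck(2) have "Ck_strip k T (D_x h)" by (subst Ck_strip_cong)
  moreover have "(\<lambda>t. h t x) differentiable_on {0..T}" for x
    using t unfolding differentiable_on_def real_differentiable_def by blast
  moreover have "h t differentiable_on UNIV" if "t \<in> {0..T}" for t
    using x[OF that] unfolding differentiable_on_def real_differentiable_def by simp blast
  ultimately show ?thesis using cont by simp
qed

lemma Ck_strip_const: "Ck_strip k T (\<lambda>t x. c)"
proof (induction k arbitrary: c)
  case 0
  show ?case by simp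
next
  case (Suc k)
  show ?case by (rule Ck_strip_SucI[where ht="\<lambda>t x. 0" and hx="\<lambda>t x. 0"]) (use Suc in simp_all)
qed

lemma Ck_strip_add: "Ck_strip k T f \<Longrightarrow> Ck_strip k T g \<Longrightarrow> Ck_strip k T (\<lambda>t x. f t x + g t x)"
proof (induction k arbitrary: f g)
  case 0
  then show ?case by (simp add: split_beta continuous_on_add)
next
  case (Suc k)
  note f = Ck_strip_SucD[OF Suc.prems(1)] and g = Ck_strip_SucD[OF Suc.prems(2)]
  show ?case
  proof (rule Ck_strip_SucI)
    show "continuous_on ({0..T} \<times> UNIV) (\<lambda>(t, x). f t x + g t x)"
      using Suc.prems[THEN Ck_strip_continuous] by (simp add: split_beta continuous_on_add)
    show "((\<lambda>s. f s x + g s x) has_real_derivative D_t T f t x + D_t T g t x) (at t within {0..T})"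
      if "t \<in> {0..T}" for t x using f(1) g(1) that by (intro DERIV_add)
    show "((\<lambda>x. f t x + g t x) has_real_derivative D_x f t x + D_x g t x) (at x)"
      if "t \<in> {0..T}" for t x using f(2) g(2) that by (intro DERIV_add)
  qed (intro Suc.IH f(3,4) g(3,4))+
qed

lemma Ck_strip_mult: "Ck_strip k T f \<Longrightarrow> Ck_strip k T g \<Longrightarrow> Ck_strip k T (\<lambda>t x. f t x * g t x)"
proof (induction k arbitrary: f g)
  case 0
  then show ?case by (simp add: split_beta continuous_on_mult)
next
  case (Suc k)
  note f = Ck_strip_SucD[OF Suc.prems(1)] and g = Ck_strip_SucD[OF Suc.prems(2)]
  note mono = Suc.prems[THEN Ck_strip_mono]
  show ?case
  proof (rule Ck_strip_SucI)
    show "continuous_on ({0..T} \<times> UNIV) (\<lambda>(t, x). f t x * g t x)"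
      using Suc.prems[THEN Ck_strip_continuous] by (simp add: split_beta continuous_on_mult)
    show "((\<lambda>s. f s x * g s x) has_real_derivative D_t T f t x * g t x + D_t T g t x * f t x) (at t within {0..T})"
      if "t \<in> {0..T}" for t x using f(1) g(1) that by (intro DERIV_mult)
    show "((\<lambda>x. f t x * g t x) has_real_derivative D_x f t x * g t x + D_x g t x * f t x) (at x)"
      if "t \<in> {0..T}" for t x using f(2) g(2) that by (intro DERIV_mult)
  qed (intro Ck_strip_add Suc.IH f(3,4) g(3,4) mono)+
qed

lemma Ck_strip_affine: "smooth_line f \<Longrightarrow> Ck_strip k T (\<lambda>t x. f (a * t + b * x + c))"
proof (induction k arbitrary: f)
  case 0
  have "continuous_on UNIV f"
    using 0 by (simp add: continuous_at_imp_continuous_on smooth_line_isCont)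
  then show ?case
    unfolding Ck_strip.simps split_beta
    by (rule continuous_on_compose2) (auto intro!: continuous_intros)
next
  case (Suc k)
  note der = DERIV_chain2[OF smooth_line_DERIV[OF Suc.prems]]
  show ?case
  proof (rule Ck_strip_SucI)
    have "continuous_on UNIV f"
      using Suc by (simp add: continuous_at_imp_continuous_on smooth_line_isCont)
    then show "continuous_on ({0..T} \<times> UNIV) (\<lambda>(t, x). f (a * t + b * x + c))"
      unfolding split_beta by (rule continuous_on_compose2) (auto intro!: continuous_intros)
    show "((\<lambda>s. f (a * s + b * x + c)) has_real_derivative deriv f (a * t + b * x + c) * a) (at t within {0..T})" for t x
      by (rule der) (auto intro!: derivative_eq_intros)
    show "((\<lambda>x. f (a * t + b * x + c)) has_real_derivative deriv f (a * t + b * x + c) * b) (at x)" for t x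
      by (rule der) (auto intro!: derivative_eq_intros)
  qed (rule Ck_strip_mult[OF Suc.IH[OF smooth_line_deriv[OF Suc.prems]] Ck_strip_const])+
qed

lemma smooth_strip_D_t: "smooth_strip T h \<Longrightarrow> smooth_strip T (D_t T h)"
  and smooth_strip_D_x: "smooth_strip T h \<Longrightarrow> smooth_strip T (D_x h)"
  by (metis Ck_strip.simps(2) smooth_strip_def)+

lemma smooth_strip_funpow: "smooth_strip T h \<Longrightarrow> smooth_strip T ((D_x ^^ i) ((D_t T ^^ j) h))"
proof -
  assume h: "smooth_strip T h"
  have "smooth_strip T ((D_t T ^^ j) h)" by (induction j) (auto simp: h smooth_strip_D_t)
  then show ?thesis by (induction i) (auto simp: smooth_strip_D_x)
qed

lemma smooth_strip_DERIV_t: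
  "smooth_strip T h \<Longrightarrow> t \<in> {0..T} \<Longrightarrow> ((\<lambda>s. h s x) has_real_derivative D_t T h t x) (at t within {0..T})"
  using Ck_strip_SucD(1) smooth_strip_def by blast

lemma smooth_strip_DERIV_x:
  "smooth_strip T h \<Longrightarrow> t \<in> {0..T} \<Longrightarrow> (h t has_real_derivative D_x h t x) (at x)"
  using Ck_strip_SucD(2) smooth_strip_def by blast

lemma smooth_strip_continuous: "smooth_strip T h \<Longrightarrow> continuous_on ({0..T} \<times> UNIV) (\<lambda>(t, x). h t x)"
  using Ck_strip_continuous smooth_strip_def by blast

lemma smooth_strip_lin:
  "smooth_strip T h \<Longrightarrow> smooth_strip T g \<Longrightarrow> smooth_strip T (\<lambda>t x. h t x + \<epsilon> * g t x)"
  unfolding smooth_strip_def by (intro allI Ck_strip_add Ck_strip_mult Ck_strip_const) auto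

lemma D_t_lin:
  assumes "smooth_strip T h" "smooth_strip T g" "t \<in> {0..T}"
  shows "D_t T (\<lambda>t x. h t x + \<epsilon> * g t x) t = (\<lambda>x. D_t T h t x + \<epsilon> * D_t T g t x)"
  unfolding D_t_def[of T "\<lambda>t x. h t x + \<epsilon> * g t x"]
  by (rule ext, rule deriv_I_eq)
    (use assms in \<open>auto intro!: derivative_eq_intros smooth_strip_DERIV_t\<close>)

lemma D_x_lin:
  assumes "smooth_strip T h" "smooth_strip T g" "t \<in> {0..T}"
  shows "D_x (\<lambda>t x. h t x + \<epsilon> * g t x) t = (\<lambda>x. D_x h t x + \<epsilon> * D_x g t x)"
  unfolding D_x_def[of "\<lambda>t x. h t x + \<epsilon> * g t x"]
  by (rule ext, rule DERIV_imp_deriv)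
    (use assms in \<open>auto intro!: derivative_eq_intros smooth_strip_DERIV_x\<close>)

lemma funpow_D_lin:
  assumes h: "smooth_strip T h" and g: "smooth_strip T g" and t: "t \<in> {0..T}"
  shows "(D_x ^^ i) ((D_t T ^^ j) (\<lambda>t x. h t x + \<epsilon> * g t x)) t =
    (\<lambda>x. (D_x ^^ i) ((D_t T ^^ j) h) t x + \<epsilon> * (D_x ^^ i) ((D_t T ^^ j) g) t x)"
proof -
  \<comment> \<open>The time derivatives are the inner ones, and taking one more needs the formula
    on the whole interval. So this is shown for every \<open>s\<close> before specializing to
    \<open>t\<close>.\<close>
  have j: "(D_t T ^^ j) (\<lambda>t x. h t x + \<epsilon> * g t x) s =
      (\<lambda>x. (D_t T ^^ j) h s x + \<epsilon> * (D_t T ^^ j) g s x)" if "s \<in> {0..T}" for s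
    using that
  proof (induction j arbitrary: s)
    case (Suc j)
    have "(D_t T ^^ Suc j) (\<lambda>t x. h t x + \<epsilon> * g t x) s =
        D_t T (\<lambda>t x. (D_t T ^^ j) h t x + \<epsilon> * (D_t T ^^ j) g t x) s"
      using Suc by (auto intro!: D_t_cong)
    also have "\<dots> = (\<lambda>x. (D_t T ^^ Suc j) h s x + \<epsilon> * (D_t T ^^ Suc j) g s x)"
      using D_t_lin[OF smooth_strip_funpow[OF h, of 0] smooth_strip_funpow[OF g, of 0] Suc.prems] by simp
    finally show ?case .
  qed simp
  show ?thesis
  proof (induction i)
    case (Suc i)
    have "(D_x ^^ Suc i) ((D_t T ^^ j) (\<lambda>t x. h t x + \<epsilon> * g t x)) t =
        D_x (\<lambda>t x. (D_x ^^ i) ((D_t T ^^ j) h) t x + \<epsilon> * (D_x ^^ i) ((D_t T ^^ j) g) t x) t"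
      using Suc by (auto intro!: D_x_cong)
    also have "\<dots> = (\<lambda>x. (D_x ^^ Suc i) ((D_t T ^^ j) h) t x + \<epsilon> * (D_x ^^ Suc i) ((D_t T ^^ j) g) t x)"
      using D_x_lin[OF smooth_strip_funpow[OF h] smooth_strip_funpow[OF g] t] by simp
    finally show ?case .
  qed (use j t in simp)
qed

lemma smooth_I_derivative:
  assumes "\<alpha> \<in> smooth_I T"
  shows "continuous_on {0..T} (deriv_I T \<alpha>)"
    "t \<in> {0..T} \<Longrightarrow> (\<alpha> has_real_derivative deriv_I T \<alpha> t) (at t within {0..T})"
proof -
  have d: "(deriv_I T ^^ n) \<alpha> differentiable_on {0..T}" for n using assms by (simp add: smooth_I_def)
  from d[of 1] show "continuous_on {0..T} (deriv_I T \<alpha>)" by (simp add: differentiable_imp_continuous_on)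
  assume "t \<in> {0..T}"
  then have "\<alpha> differentiable (at t within {0..T})" using d[of 0] by (simp add: differentiable_on_def)
  then show "(\<alpha> has_real_derivative deriv_I T \<alpha> t) (at t within {0..T})"
    by (simp add: deriv_I_def has_real_derivative_iff_has_vector_derivative vector_derivative_works)
qed

lemma constant_of_zero_derivative:
  fixes f :: "real \<Rightarrow> real"
  assumes der: "\<And>t. t \<in> {0..T} \<Longrightarrow> (f has_real_derivative f' t) (at t within {0..T})"
    and zero: "\<And>t. 0 < t \<Longrightarrow> t < T \<Longrightarrow> f' t = 0"
  shows "f T = f 0"
proof (rule DERIV_isconst_end[OF T_pos])
  show "continuous_on {0..T} f" using der by (intro DERIV_continuous_on)
  show "(f has_real_derivative 0) (at t)" if "0 < t" "t < T" for t
    using der[of t] zero[OF that] that by (simp add: at_within_Icc_at)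
qed

section \<open>Rapidly decreasing functions on the strip and affine curves of them\<close>

lemma schwartz_strip_smooth: "h \<in> schwartz_strip T \<Longrightarrow> smooth_strip T h"
  by (simp add: schwartz_strip_def)

lemma schwartz_strip_bound:
  assumes "h \<in> schwartz_strip T"
  obtains C where "C \<ge> 0"
    "\<And>t x. t \<in> {0..T} \<Longrightarrow> \<bar>(1 + \<bar>x\<bar>\<^sup>2) ^ k * (D_x ^^ i) ((D_t T ^^ j) h) t x\<bar> \<le> C"
proof -
  have "bounded ((\<lambda>(t, x). (1 + \<bar>x\<bar>\<^sup>2) ^ k * (D_x ^^ i) ((D_t T ^^ j) h) t x) ` ({0..T} \<times> UNIV))"
    using assms by (simp add: schwartz_strip_def)
  then obtain C where "0 < C" "\<forall>y \<in> (\<lambda>(t, x). (1 + \<bar>x\<bar>\<^sup>2) ^ k * (D_x ^^ i) ((D_t T ^^ j) h) t x) ` ({0..T} \<times> UNIV). norm y \<le> C"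
    by (auto simp: bounded_pos)
  then show ?thesis by (intro that[of C]) force+
qed

lemma schwartz_strip_lin:
  assumes h: "h \<in> schwartz_strip T" and g: "g \<in> schwartz_strip T"
  shows "(\<lambda>t x. h t x + \<epsilon> * g t x) \<in> schwartz_strip T"
proof -
  have "bounded ((\<lambda>(t, x). (1 + \<bar>x\<bar>\<^sup>2) ^ k * (D_x ^^ i) ((D_t T ^^ j) (\<lambda>t x. h t x + \<epsilon> * g t x)) t x) ` ({0..T} \<times> UNIV))"
    for k i j
  proof -
    let ?w = "\<lambda>x::real. (1 + \<bar>x\<bar>\<^sup>2) ^ k"
    obtain C where C: "\<And>t x. t \<in> {0..T} \<Longrightarrow> \<bar>?w x * (D_x ^^ i) ((D_t T ^^ j) h) t x\<bar> \<le> C"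
      using schwartz_strip_bound[OF h] by metis
    obtain D where D: "\<And>t x. t \<in> {0..T} \<Longrightarrow> \<bar>?w x * (D_x ^^ i) ((D_t T ^^ j) g) t x\<bar> \<le> D"
      using schwartz_strip_bound[OF g] by metis
    have "\<bar>?w x * (D_x ^^ i) ((D_t T ^^ j) (\<lambda>t x. h t x + \<epsilon> * g t x)) t x\<bar> \<le> C + \<bar>\<epsilon>\<bar> * D" if "t \<in> {0..T}" for t x
    proof -
      have "?w x * (D_x ^^ i) ((D_t T ^^ j) (\<lambda>t x. h t x + \<epsilon> * g t x)) t x =
          ?w x * (D_x ^^ i) ((D_t T ^^ j) h) t x + \<epsilon> * (?w x * (D_x ^^ i) ((D_t T ^^ j) g) t x)"
        using funpow_D_lin[OF assms[THEN schwartz_strip_smooth] that] by (simp add: algebra_simps)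
      moreover have "\<bar>\<epsilon> * (?w x * (D_x ^^ i) ((D_t T ^^ j) g) t x)\<bar> \<le> \<bar>\<epsilon>\<bar> * D"
        unfolding abs_mult[of \<epsilon>] by (intro mult_left_mono D that) simp
      ultimately show ?thesis using C[OF that, of x] by linarith
    qed
    then show ?thesis by (auto simp: bounded_iff intro!: exI[of _ "C + \<bar>\<epsilon>\<bar> * D"])
  qed
  then show ?thesis
    using smooth_strip_lin[OF assms[THEN schwartz_strip_smooth]] by (simp add: schwartz_strip_def)
qed

lemma schwartz_strip_diff:
  "h \<in> schwartz_strip T \<Longrightarrow> g \<in> schwartz_strip T \<Longrightarrow> (\<lambda>t x. h t x - g t x) \<in> schwartz_strip T"
  using schwartz_strip_lin[of h g "- 1"] by simp

text \<open>The condition R < |x| is open and does not involve time, so all derivatives vanish there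
  too; on the remaining compact box they are bounded by continuity.\<close>

lemma compact_support_schwartz_strip:
  assumes smooth: "smooth_strip T h" and supp: "\<And>t x. t \<in> {0..T} \<Longrightarrow> R < \<bar>x\<bar> \<Longrightarrow> h t x = 0"
  shows "h \<in> schwartz_strip T"
proof -
  have "bounded ((\<lambda>(t, x). (1 + \<bar>x\<bar>\<^sup>2) ^ k * (D_x ^^ i) ((D_t T ^^ j) h) t x) ` ({0..T} \<times> UNIV))" for k i j
  proof -
    have j: "(D_t T ^^ j) h t x = 0" if "t \<in> {0..T}" "R < \<bar>x\<bar>" for t x
      using that
    proof (induction j arbitrary: t)
      case (Suc j)
      have "D_t T ((D_t T ^^ j) h) t x = deriv_I T (\<lambda>_. 0) t"
        unfolding D_t_def[of T "(D_t T ^^ j) h"] using Suc by (intro deriv_I_cong) auto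
      also have "\<dots> = 0" using Suc.prems by (intro deriv_I_eq) auto
      finally show ?case by simp
    qed (use supp in auto)
    have i: "(D_x ^^ i) ((D_t T ^^ j) h) t x = 0" if "t \<in> {0..T}" "R < \<bar>x\<bar>" for t x
      using that
    proof (induction i arbitrary: x)
      case (Suc i)
      have "((\<lambda>_. 0) has_real_derivative 0) (at x)" by simp
      then have "((D_x ^^ i) ((D_t T ^^ j) h) t has_real_derivative 0) (at x)"
        by (rule has_field_derivative_transform_within_open[where S="{x. R < \<bar>x\<bar>}"])
          (use Suc in \<open>auto intro!: open_Collect_less continuous_intros\<close>)
      then show ?case unfolding funpow.simps o_def D_x_def[of "(D_x ^^ i) ((D_t T ^^ j) h)"] by (rule DERIV_imp_deriv)
    qed (use j in auto)
    let ?f = "\<lambda>(t, x). (1 + \<bar>x\<bar>\<^sup>2) ^ k * (D_x ^^ i) ((D_t T ^^ j) h) t x"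
    have "continuous_on ({0..T} \<times> UNIV) ?f"
      using smooth_strip_continuous[OF smooth_strip_funpow[OF smooth]]
      by (auto simp: split_beta intro!: continuous_intros)
    then have "continuous_on ({0..T} \<times> {-\<bar>R\<bar>..\<bar>R\<bar>}) ?f"
      by (rule continuous_on_subset) auto
    then have "bounded (?f ` ({0..T} \<times> {-\<bar>R\<bar>..\<bar>R\<bar>}))"
      by (intro compact_imp_bounded compact_continuous_image compact_Times) auto
    then have "bounded (insert 0 (?f ` ({0..T} \<times> {-\<bar>R\<bar>..\<bar>R\<bar>})))" by simp
    then show ?thesis
    proof (rule bounded_subset, safe)
      fix t x assume t: "t \<in> {0..T}" and n: "(1 + \<bar>x\<bar>\<^sup>2) ^ k * (D_x ^^ i) ((D_t T ^^ j) h) t x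
          \<notin> (\<lambda>(t, x). (1 + \<bar>x\<bar>\<^sup>2) ^ k * (D_x ^^ i) ((D_t T ^^ j) h) t x) ` ({0..T} \<times> {- \<bar>R\<bar>..\<bar>R\<bar>})"
      then have "x \<notin> {-\<bar>R\<bar>..\<bar>R\<bar>}" by force
      then have "R < \<bar>x\<bar>" by auto
      with i t show "(1 + \<bar>x\<bar>\<^sup>2) ^ k * (D_x ^^ i) ((D_t T ^^ j) h) t x = 0" by simp
    qed
  qed
  then show ?thesis using smooth by (simp add: schwartz_strip_def)
qed

lemma abs_le_add_mult: "X = Y + c * Z \<Longrightarrow> \<bar>X\<bar> \<le> \<bar>Y\<bar> + \<bar>c\<bar> * \<bar>Z\<bar>" for X :: real
  using abs_triangle_ineq[of Y "c * Z"] by (simp add: abs_mult)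

text \<open>Differentiation is linear, so this is the triangle inequality under the supremum.
  Applied in both directions it makes each seminorm Lipschitz in the parameter, hence continuous
  along affine curves.\<close>

lemma weighted_sup_affine_Lipschitz:
  assumes u: "u \<in> schwartz_strip T" and w: "w \<in> schwartz_strip T"
  shows "weighted_sup T k i j (\<lambda>t x. u t x + a * w t x)
    \<le> weighted_sup T k i j (\<lambda>t x. u t x + b * w t x) + \<bar>a - b\<bar> * weighted_sup T k i j w"
proof -
  let ?V = "\<lambda>h t x. \<bar>(1 + \<bar>x\<bar>\<^sup>2) ^ k * (D_x ^^ i) ((D_t T ^^ j) h) t x\<bar>"
  have upper: "?V h t x \<le> weighted_sup T k i j h" if h: "h \<in> schwartz_strip T" and t: "t \<in> {0..T}" for h t x
  proof -
    obtain C where C: "\<And>t x. t \<in> {0..T} \<Longrightarrow> ?V h t x \<le> C" using schwartz_strip_bound[OF h] by metis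
    then have "bdd_above ((\<lambda>(t, x). ?V h t x) ` ({0..T} \<times> UNIV))"
      by (auto simp: bdd_above_def intro!: exI[of _ C])
    from cSUP_upper[OF _ this, of "(t, x)"] t show ?thesis by (simp add: weighted_sup_def)
  qed
  show ?thesis unfolding weighted_sup_def[of T k i j "\<lambda>t x. u t x + a * w t x"]
  proof (rule cSUP_least)
    show "{0..T} \<times> (UNIV :: real set) \<noteq> {}" using T_pos by auto
    fix z assume "z \<in> {0..T} \<times> (UNIV :: real set)"
    then obtain t x where z: "z = (t, x)" and t: "t \<in> {0..T}" by auto
    let ?D = "\<lambda>h. (1 + \<bar>x\<bar>\<^sup>2) ^ k * (D_x ^^ i) ((D_t T ^^ j) h) t x"
    have "?D (\<lambda>t x. u t x + a * w t x) = ?D (\<lambda>t x. u t x + b * w t x) + (a - b) * ?D w"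
      using funpow_D_lin[OF assms[THEN schwartz_strip_smooth] t] by (simp add: algebra_simps)
    then have "?V (\<lambda>t x. u t x + a * w t x) t x \<le> ?V (\<lambda>t x. u t x + b * w t x) t x + \<bar>a - b\<bar> * ?V w t x"
      by (rule abs_le_add_mult)
    also have "\<dots> \<le> weighted_sup T k i j (\<lambda>t x. u t x + b * w t x) + \<bar>a - b\<bar> * weighted_sup T k i j w"
      by (intro add_mono upper mult_left_mono w schwartz_strip_lin[OF u w] t) simp
    finally show "(case z of (t, x) \<Rightarrow> ?V (\<lambda>t x. u t x + a * w t x) t x)
        \<le> weighted_sup T k i j (\<lambda>t x. u t x + b * w t x) + \<bar>a - b\<bar> * weighted_sup T k i j w"
      by (simp add: z)
  qed
qed

lemma continuous_schwartz_seminorm_affine: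
  assumes "u \<in> schwartz_strip T" and "w \<in> schwartz_strip T"
  shows "continuous_on UNIV (\<lambda>a. schwartz_seminorm T k m n (\<lambda>t x. u t x + a * w t x))"
proof -
  have "continuous_on UNIV (\<lambda>a. weighted_sup T k i j (\<lambda>t x. u t x + a * w t x))" for i j
  proof -
    let ?f = "\<lambda>a. weighted_sup T k i j (\<lambda>t x. u t x + a * w t x)"
    let ?L = "\<bar>weighted_sup T k i j w\<bar>"
    have "?f a - ?f b \<le> ?L * \<bar>a - b\<bar>" for a b
    proof -
      have "\<bar>a - b\<bar> * weighted_sup T k i j w \<le> \<bar>a - b\<bar> * ?L" by (intro mult_left_mono) auto
      with weighted_sup_affine_Lipschitz[OF assms, of k i j a b] show ?thesis by (simp add: mult.commute)
    qed
    note le = this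
    have "?L-lipschitz_on UNIV ?f"
    proof (rule lipschitz_onI)
      show "dist (?f a) (?f b) \<le> ?L * dist a b" for a b
        using le[of a b] le[of b a] by (simp add: dist_real_def abs_minus_commute abs_le_iff)
    qed simp
    then show ?thesis by (rule lipschitz_on_continuous_on)
  qed
  then show ?thesis unfolding schwartz_seminorm_def by (intro continuous_on_sum)
qed

lemma open_affine_seminorm_ball:
  assumes u: "u \<in> schwartz_strip T" and w: "w \<in> schwartz_strip T" and f: "f \<in> schwartz_strip T"
  shows "open ((\<lambda>a t x. u t x + a * w t x) -`
    {h \<in> schwartz_strip T. schwartz_seminorm T k m n (\<lambda>t x. h t x - f t x) < \<epsilon>})"
proof -
  have "(\<lambda>a t x. u t x + a * w t x) -`
      {h \<in> schwartz_strip T. schwartz_seminorm T k m n (\<lambda>t x. h t x - f t x) < \<epsilon>} =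
      {a. schwartz_seminorm T k m n (\<lambda>t x. (u t x - f t x) + a * w t x) < \<epsilon>}"
    (is "?L = ?R")
  proof -
    have "(\<lambda>t x. u t x + a * w t x - f t x) = (\<lambda>t x. u t x - f t x + a * w t x)" for a
      by (intro ext) simp
    then show ?thesis unfolding vimage_def using schwartz_strip_lin[OF u w] by simp
  qed
  moreover have "open ?R"
    by (rule open_Collect_less[OF continuous_schwartz_seminorm_affine[OF schwartz_strip_diff[OF u f] w] continuous_on_const])
  ultimately show ?thesis by simp
qed

text \<open>A map into a generated topology must have its values in the union of the generating
  sets. This shows that the balls cover \<open>schwartz_strip T\<close>.\<close>

lemma mem_seminorm_ball: "h \<in> schwartz_strip T \<Longrightarrow>
  h \<in> {g \<in> schwartz_strip T. schwartz_seminorm T 0 0 0 (\<lambda>t x. g t x - h t x) < 1}"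
  using T_pos by (simp add: schwartz_seminorm_def weighted_sup_def split_beta)

lemma continuous_map_affine_schwartz_topology:
  assumes u: "u \<in> schwartz_strip T" and w: "w \<in> schwartz_strip T"
  shows "continuous_map euclideanreal (schwartz_topology T) (\<lambda>a t x. u t x + a * w t x)"
proof -
  define B where "B f k m n \<epsilon> =
    {h \<in> schwartz_strip T. schwartz_seminorm T k m n (\<lambda>t x. h t x - f t x) < \<epsilon>}" for f k m n \<epsilon>
  define \<B> where "\<B> = {B f k m n \<epsilon> | f k m n \<epsilon>. f \<in> schwartz_strip T \<and> \<epsilon> > 0}"
  have top: "schwartz_topology T = topology_generated_by \<B>"
    by (simp only: schwartz_topology_def \<B>_def B_def)
  have "open ((\<lambda>a t x. u t x + a * w t x) -` U)" if "U \<in> \<B>" for U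
    using that open_affine_seminorm_ball[OF u w, folded B_def] unfolding \<B>_def by blast
  moreover have "\<exists>U\<in>\<B>. (\<lambda>t x. u t x + a * w t x) \<in> U" for a
    using mem_seminorm_ball[OF schwartz_strip_lin[OF u w, of a], folded B_def]
      schwartz_strip_lin[OF u w, of a] zero_less_one unfolding \<B>_def by blast
  ultimately show ?thesis
    unfolding top continuous_on_generated_topo_iff by auto
qed

section \<open>Integrals over the strip\<close>

definition cont_strip :: "(real \<Rightarrow> real \<Rightarrow> real) \<Rightarrow> bool" where
  "cont_strip F \<longleftrightarrow> continuous_on ({0..T} \<times> UNIV) (\<lambda>z. F (fst z) (snd z))"

named_theorems cont_intros

lemma smooth_strip_cont: "smooth_strip T F \<Longrightarrow> cont_strip F"
  using smooth_strip_continuous by (simp add: cont_strip_def split_beta)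

lemma cont_strip_cong: "(\<And>t x. t \<in> {0..T} \<Longrightarrow> F t x = G t x) \<Longrightarrow> cont_strip F \<longleftrightarrow> cont_strip G"
  unfolding cont_strip_def by (rule continuous_on_cong) auto

lemma cont_strip_const [cont_intros]: "cont_strip (\<lambda>t x. c)"
  by (simp add: cont_strip_def)

lemma cont_strip_add [cont_intros]: "cont_strip F \<Longrightarrow> cont_strip G \<Longrightarrow> cont_strip (\<lambda>t x. F t x + G t x)"
  by (simp add: cont_strip_def continuous_on_add)

lemma cont_strip_diff [cont_intros]: "cont_strip F \<Longrightarrow> cont_strip G \<Longrightarrow> cont_strip (\<lambda>t x. F t x - G t x)"
  by (simp add: cont_strip_def continuous_on_diff)

lemma cont_strip_mult [cont_intros]: "cont_strip F \<Longrightarrow> cont_strip G \<Longrightarrow> cont_strip (\<lambda>t x. F t x * G t x)"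
  by (simp add: cont_strip_def continuous_on_mult)

lemma cont_strip_power [cont_intros]: "cont_strip F \<Longrightarrow> cont_strip (\<lambda>t x. F t x ^ n)"
  by (simp add: cont_strip_def continuous_on_power)

lemma cont_strip_divide [cont_intros]:
  "cont_strip F \<Longrightarrow> cont_strip G \<Longrightarrow> (\<And>t x. t \<in> {0..T} \<Longrightarrow> G t x \<noteq> 0) \<Longrightarrow> cont_strip (\<lambda>t x. F t x / G t x)"
  unfolding cont_strip_def by (rule continuous_on_divide) auto

lemma cont_strip_abs [cont_intros]: "cont_strip F \<Longrightarrow> cont_strip (\<lambda>t x. \<bar>F t x\<bar>)"
  unfolding cont_strip_def by (rule continuous_on_rabs)

lemma cont_strip_time: "continuous_on {0..T} a \<Longrightarrow> cont_strip (\<lambda>t x. a t)"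
  unfolding cont_strip_def by (rule continuous_on_compose2[where g=a]) (auto intro: continuous_intros)

lemma cont_strip_compose:
  "continuous_on UNIV f \<Longrightarrow> cont_strip F \<Longrightarrow> cont_strip (\<lambda>t x. f (F t x))"
  unfolding cont_strip_def by (rule continuous_on_compose2[where g=f]) auto

lemma cont_strip_slice:
  assumes "cont_strip F" "t \<in> {0..T}"
  shows "continuous_on UNIV (F t)"
proof -
  have "continuous_on UNIV (\<lambda>x. F (fst (t, x)) (snd (t, x)))"
    by (rule continuous_on_compose2[where f="\<lambda>x. (t, x)"])
      (use assms in \<open>auto simp: cont_strip_def intro!: continuous_intros\<close>)
  then show ?thesis by simp
qed

lemma cont_strip_bounded_box:
  assumes "cont_strip F"
  obtains K where "K > 0" "\<And>t x. t \<in> {0..T} \<Longrightarrow> \<bar>x\<bar> \<le> R \<Longrightarrow> \<bar>F t x\<bar> \<le> K"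
proof -
  have "continuous_on ({0..T} \<times> {-R..R}) (\<lambda>z. F (fst z) (snd z))"
    using assms unfolding cont_strip_def by (rule continuous_on_subset) auto
  then have "bounded ((\<lambda>z. F (fst z) (snd z)) ` ({0..T} \<times> {-R..R}))"
    by (intro compact_imp_bounded compact_continuous_image compact_Times) auto
  then obtain K where K: "K > 0" "\<And>z. z \<in> {0..T} \<times> {-R..R} \<Longrightarrow> \<bar>F (fst z) (snd z)\<bar> \<le> K"
    unfolding bounded_pos by auto
  have "\<bar>F t x\<bar> \<le> K" if "t \<in> {0..T}" "\<bar>x\<bar> \<le> R" for t x
  proof -
    have "(t, x) \<in> {0..T} \<times> {-R..R}" using that unfolding mem_Times_iff by simp linarith
    from K(2)[OF this] show ?thesis by simp
  qed
  with K(1) show ?thesis by (rule that)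
qed

text \<open>Domination by an integrable function of \<open>x\<close>, uniform in time, is what
  integrating out \<open>x\<close> requires: each slice is integrable, and by dominated convergence
  the integral is continuous in time, hence integrable over [0,T].\<close>

definition decays :: "(real \<Rightarrow> real \<Rightarrow> real) \<Rightarrow> bool" where
  "decays F \<longleftrightarrow> cont_strip F \<and> (\<exists>C. \<forall>t\<in>{0..T}. \<forall>x. \<bar>F t x\<bar> \<le> C * inverse (1 + x\<^sup>2))"

lemma decays_cont: "decays F \<Longrightarrow> cont_strip F"
  by (simp add: decays_def)

lemma decaysE:
  assumes "decays F"
  obtains C where "\<And>t x. t \<in> {0..T} \<Longrightarrow> \<bar>F t x\<bar> \<le> C * inverse (1 + x\<^sup>2)"
  using assms unfolding decays_def by blast

lemma decaysI:
  "cont_strip F \<Longrightarrow> (\<And>t x. t \<in> {0..T} \<Longrightarrow> \<bar>F t x\<bar> \<le> C * inverse (1 + x\<^sup>2)) \<Longrightarrow> decays F"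
  unfolding decays_def by blast

lemma decays_cong:
  "(\<And>t x. t \<in> {0..T} \<Longrightarrow> F t x = G t x) \<Longrightarrow> decays F \<longleftrightarrow> decays G"
  unfolding decays_def using cont_strip_cong[of F G] by auto

lemma integrable_inverse_1_plus_square_UNIV: "integrable lborel (\<lambda>x::real. C * inverse (1 + x\<^sup>2))"
  using integrable_inverse_1_plus_square by (simp add: set_integrable_def einterval_def)

lemma decays_integrable:
  assumes "decays F" "t \<in> {0..T}"
  shows "integrable lborel (F t)"
proof -
  obtain C where C: "\<And>t x. t \<in> {0..T} \<Longrightarrow> \<bar>F t x\<bar> \<le> C * inverse (1 + x\<^sup>2)"
    using assms(1) decaysE by metis
  have "F t \<in> borel_measurable borel"
    using cont_strip_slice[OF decays_cont] assms by (intro borel_measurable_continuous_onI)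
  moreover have "norm (F t x) \<le> norm (C * inverse (1 + x\<^sup>2))" for x
    unfolding real_norm_def by (rule order_trans[OF C[OF assms(2)] abs_ge_self])
  ultimately show ?thesis
    by (intro Bochner_Integration.integrable_bound[OF integrable_inverse_1_plus_square_UNIV[of C]]) simp_all
qed

lemma decays_continuous_integral:
  assumes "decays F"
  shows "continuous_on {0..T} (\<lambda>t. LINT x|lborel. F t x)"
  unfolding continuous_on_sequentially
proof (intro allI ballI impI, elim conjE)
  fix s t assume t: "t \<in> {0..T}" and s: "\<forall>n. s n \<in> {0..T}" and lim: "s \<longlonglongrightarrow> t"
  obtain C where C: "\<And>t x. t \<in> {0..T} \<Longrightarrow> \<bar>F t x\<bar> \<le> C * inverse (1 + x\<^sup>2)"
    using assms decaysE by metis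
  have pw: "(\<lambda>n. F (s n) x) \<longlonglongrightarrow> F t x" for x
  proof -
    have "(\<lambda>n. (s n, x)) \<longlonglongrightarrow> (t, x)" by (intro tendsto_intros lim)
    then show ?thesis
      using continuous_on_tendsto_compose[OF decays_cont[OF assms, unfolded cont_strip_def], of "\<lambda>n. (s n, x)" "(t, x)"] s t
      by simp
  qed
  have "(\<lambda>n. LINT x|lborel. F (s n) x) \<longlonglongrightarrow> (LINT x|lborel. F t x)"
  proof (rule integral_dominated_convergence[where w="\<lambda>x. C * inverse (1 + x\<^sup>2)"])
    show "F t \<in> borel_measurable lborel" "F (s n) \<in> borel_measurable lborel" for n
      using s t decays_integrable[OF assms] by (auto intro!: borel_measurable_integrable)
    show "AE x in lborel. norm (F (s n) x) \<le> C * inverse (1 + x\<^sup>2)" for n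
      unfolding real_norm_def by (intro AE_I2 C s[rule_format])
  qed (use pw integrable_inverse_1_plus_square_UNIV in auto)
  then show "((\<lambda>t. LINT x|lborel. F t x) \<circ> s) \<longlonglongrightarrow> (LINT x|lborel. F t x)"
    by (simp add: o_def)
qed

lemma decays_add [cont_intros]:
  assumes "decays F" "decays G" shows "decays (\<lambda>t x. F t x + G t x)"
proof -
  obtain C where C: "\<And>t x. t \<in> {0..T} \<Longrightarrow> \<bar>F t x\<bar> \<le> C * inverse (1 + x\<^sup>2)"
    using assms(1) decaysE by metis
  obtain D where D: "\<And>t x. t \<in> {0..T} \<Longrightarrow> \<bar>G t x\<bar> \<le> D * inverse (1 + x\<^sup>2)"
    using assms(2) decaysE by metis
  have "\<bar>F t x + G t x\<bar> \<le> (C + D) * inverse (1 + x\<^sup>2)" if "t \<in> {0..T}" for t x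
    using abs_triangle_ineq[of "F t x" "G t x"] C[OF that, of x] D[OF that, of x]
    unfolding distrib_right by linarith
  with cont_strip_add[OF assms[THEN decays_cont]] show ?thesis by (rule decaysI)
qed

lemma decays_mult_bounded:
  assumes F: "decays F" and G: "cont_strip G" and K: "\<And>t x. t \<in> {0..T} \<Longrightarrow> \<bar>G t x\<bar> \<le> K"
  shows "decays (\<lambda>t x. F t x * G t x)"
proof -
  obtain C where C: "\<And>t x. t \<in> {0..T} \<Longrightarrow> \<bar>F t x\<bar> \<le> C * inverse (1 + x\<^sup>2)"
    using F decaysE by metis
  have "\<bar>F t x * G t x\<bar> \<le> (C * K) * inverse (1 + x\<^sup>2)" if "t \<in> {0..T}" for t x
  proof -
    have "\<bar>F t x\<bar> * \<bar>G t x\<bar> \<le> (C * inverse (1 + x\<^sup>2)) * K"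
      by (rule mult_mono) (use C[OF that, of x] K[OF that, of x] in auto)
    then show ?thesis by (simp add: abs_mult ac_simps)
  qed
  with cont_strip_mult[OF decays_cont[OF F] G] show ?thesis by (rule decaysI)
qed

lemma decays_cmult [cont_intros]: "decays F \<Longrightarrow> decays (\<lambda>t x. c * F t x)"
  using decays_mult_bounded[of F "\<lambda>_ _. c" "\<bar>c\<bar>"] by (simp add: cont_strip_const mult.commute)

lemma decays_diff [cont_intros]: "decays F \<Longrightarrow> decays G \<Longrightarrow> decays (\<lambda>t x. F t x - G t x)"
  using decays_add[of F "\<lambda>t x. (- 1) * G t x"] decays_cmult[of G "- 1"] by simp

lemma decays_abs: "decays F \<Longrightarrow> decays (\<lambda>t x. \<bar>F t x\<bar>)"
  unfolding decays_def using cont_strip_abs by auto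

lemma decays_compact_support:
  assumes F: "cont_strip F" and R: "\<And>t x. t \<in> {0..T} \<Longrightarrow> R < \<bar>x\<bar> \<Longrightarrow> F t x = 0"
  shows "decays F"
proof -
  obtain K where K: "K > 0" "\<And>t x. t \<in> {0..T} \<Longrightarrow> \<bar>x\<bar> \<le> R \<Longrightarrow> \<bar>F t x\<bar> \<le> K"
    using cont_strip_bounded_box[OF F] by metis
  \<comment> \<open>The factor 1 + R^2 compensates for the smallest value that 1 / (1 + x^2) takes
    on the box.\<close>
  have "\<bar>F t x\<bar> \<le> (K * (1 + R\<^sup>2)) * inverse (1 + x\<^sup>2)" if t: "t \<in> {0..T}" for t x
  proof (cases "\<bar>x\<bar> \<le> R")
    case True
    then have "x\<^sup>2 \<le> R\<^sup>2" by (metis abs_le_square_iff abs_of_nonneg abs_ge_zero order_trans)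
    then have "K * (1 + x\<^sup>2) \<le> K * (1 + R\<^sup>2)" using K(1) by simp
    moreover have "0 < 1 + x\<^sup>2" by (simp add: add_pos_nonneg)
    ultimately have "K \<le> (K * (1 + R\<^sup>2)) * inverse (1 + x\<^sup>2)" by (simp add: field_simps)
    with K(2)[OF t True] show ?thesis by linarith
  next
    case False
    have "0 \<le> (K * (1 + R\<^sup>2)) * inverse (1 + x\<^sup>2)" using K(1) by simp
    with R[OF t, of x] False show ?thesis by simp
  qed
  with F show ?thesis by (rule decaysI)
qed

definition strip_integral :: "(real \<Rightarrow> real \<Rightarrow> real) \<Rightarrow> real" where
  "strip_integral F = (LINT t:{0..T}|lborel. LINT x|lborel. F t x)"

lemma decays_set_integrable: "decays F \<Longrightarrow> set_integrable lborel {0..T} (\<lambda>t. LINT x|lborel. F t x)"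
  by (intro borel_integrable_atLeastAtMost' decays_continuous_integral)

lemma strip_integral_cong:
  "(\<And>t x. t \<in> {0..T} \<Longrightarrow> F t x = G t x) \<Longrightarrow> strip_integral F = strip_integral G"
  unfolding strip_integral_def
  by (rule set_lebesgue_integral_cong) (auto intro!: Bochner_Integration.integral_cong)

lemma strip_integral_add:
  assumes "decays F" "decays G"
  shows "strip_integral (\<lambda>t x. F t x + G t x) = strip_integral F + strip_integral G"
proof -
  have "strip_integral (\<lambda>t x. F t x + G t x) =
      (LINT t:{0..T}|lborel. (LINT x|lborel. F t x) + (LINT x|lborel. G t x))"
    unfolding strip_integral_def using assms
    by (intro set_lebesgue_integral_cong) (auto intro!: Bochner_Integration.integral_add decays_integrable)
  then show ?thesis
    using assms by (simp add: strip_integral_def decays_set_integrable set_integral_add)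
qed

lemma strip_integral_cmult: "strip_integral (\<lambda>t x. c * F t x) = c * strip_integral F"
  by (simp add: strip_integral_def)

lemma strip_integral_diff:
  assumes "decays F" "decays G"
  shows "strip_integral (\<lambda>t x. F t x - G t x) = strip_integral F - strip_integral G"
  using strip_integral_add[OF assms(1) decays_cmult[OF assms(2), of "- 1"]]
    strip_integral_cmult[of "- 1" G] by simp

lemma strip_integral_mono:
  assumes "decays F" "decays G" "\<And>t x. t \<in> {0..T} \<Longrightarrow> F t x \<le> G t x"
  shows "strip_integral F \<le> strip_integral G"
  unfolding strip_integral_def using assms
  by (intro set_integral_mono decays_set_integrable) (auto intro!: integral_mono decays_integrable)

lemma abs_strip_integral_le:
  assumes "decays F" "decays G" "\<And>t x. t \<in> {0..T} \<Longrightarrow> \<bar>F t x\<bar> \<le> G t x"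
  shows "\<bar>strip_integral F\<bar> \<le> strip_integral G"
proof -
  have "strip_integral F \<le> strip_integral G"
    by (rule strip_integral_mono) (use assms in \<open>auto simp: abs_le_iff\<close>)
  moreover have "strip_integral (\<lambda>t x. (- 1) * F t x) \<le> strip_integral G"
    by (intro strip_integral_mono decays_cmult) (use assms in \<open>auto simp: abs_le_iff\<close>)
  ultimately show ?thesis by (simp only: strip_integral_cmult abs_le_iff) simp
qed

end

section \<open>Integrals of compactly supported functions on the line\<close>

lemma integral_by_parts_compact_support:
  fixes u v u' v' :: "real \<Rightarrow> real"
  assumes u: "\<And>x. (u has_real_derivative u' x) (at x)" and v: "\<And>x. (v has_real_derivative v' x) (at x)"
    and cont: "continuous_on UNIV u'" "continuous_on UNIV v'"
    and supp: "\<And>x. R < \<bar>x\<bar> \<Longrightarrow> v x = 0" "\<And>x. R < \<bar>x\<bar> \<Longrightarrow> v' x = 0"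
  shows "(LINT x|lborel. u x * v' x + u' x * v x) = 0"
proof -
  \<comment> \<open>The support condition is strict, and \<open>R\<close> may be negative; with the
    margin 1 the function \<open>v\<close> vanishes at both end points.\<close>
  let ?M = "\<bar>R\<bar> + 1" and ?w = "\<lambda>x. u x * v' x + u' x * v x"
  have uc: "continuous_on UNIV u" and vc: "continuous_on UNIV v"
    using u v by (auto intro!: continuous_at_imp_continuous_on DERIV_isCont)
  have "continuous_on {-?M..?M} ?w"
    by (rule continuous_on_subset[where s=UNIV]) (auto intro!: continuous_intros cont uc vc)
  moreover have "((\<lambda>x. u x * v x) has_vector_derivative ?w x) (at x within {-?M..?M})" for x
  proof -
    have "((\<lambda>x. u x * v x) has_real_derivative u' x * v x + v' x * u x) (at x)" by (intro DERIV_mult u v)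
    then show ?thesis
      by (simp add: has_real_derivative_iff_has_vector_derivative has_vector_derivative_at_within ac_simps)
  qed
  ultimately have "(LINT x|lborel. indicator {-?M..?M} x *\<^sub>R ?w x) = u ?M * v ?M - u (-?M) * v (-?M)"
    by (intro integral_FTC_atLeastAtMost) auto
  also have "\<dots> = 0" using supp(1) by simp
  also have "(\<lambda>x. indicator {-?M..?M} x *\<^sub>R ?w x) = ?w"
  proof
    fix x show "indicator {-?M..?M} x *\<^sub>R ?w x = ?w x"
      using supp[of x] by (cases "R < \<bar>x\<bar>") (auto simp: indicator_def)
  qed
  finally show ?thesis .
qed

lemma abs_integral_le_support:
  fixes w :: "real \<Rightarrow> real"
  assumes w: "integrable lborel w" and K: "\<And>x. \<bar>w x\<bar> \<le> K" and supp: "\<And>x. r < \<bar>x - c\<bar> \<Longrightarrow> w x = 0" and r: "r \<ge> 0"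
  shows "\<bar>LINT x|lborel. w x\<bar> \<le> K * (2 * r)"
proof -
  have "\<bar>LINT x|lborel. w x\<bar> \<le> (LINT x|lborel. \<bar>w x\<bar>)" by (rule integral_abs_bound)
  also have "\<dots> \<le> (LINT x|lborel. K * indicator {c - r..c + r} x)"
  proof (rule integral_mono)
    show "integrable lborel (\<lambda>x. \<bar>w x\<bar>)" using w by simp
    show "integrable lborel (\<lambda>x. K * indicator {c - r..c + r} x)"
      by (intro integrable_mult_right integrable_real_indicator) (auto simp: emeasure_lborel_Icc_eq)
    show "\<bar>w x\<bar> \<le> K * indicator {c - r..c + r} x" for x
      using K[of x] supp[of x] by (auto simp: indicator_def abs_le_iff)
  qed
  also have "\<dots> = K * (2 * r)" using r by simp
  finally show ?thesis .
qed

section \<open>Concentrated integrands\<close>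

definition profile :: "(real \<Rightarrow> real) \<Rightarrow> bool" where
  "profile f \<longleftrightarrow> continuous_on UNIV f \<and> (\<forall>y. \<bar>y\<bar> \<ge> 1 \<longrightarrow> f y = 0)"

lemma profile_mult: "profile f \<Longrightarrow> continuous_on UNIV g \<Longrightarrow> profile (\<lambda>y. f y * g y)"
  by (auto simp: profile_def intro!: continuous_intros)

lemma profile_abs: "profile f \<Longrightarrow> profile (\<lambda>y. \<bar>f y\<bar>)"
  by (auto simp: profile_def intro!: continuous_intros)

lemma profile_bounded:
  assumes "profile f"
  obtains K where "K > 0" "\<And>y. \<bar>f y\<bar> \<le> K"
proof -
  have "bounded (f ` {-1..1})"
    using assms unfolding profile_def
    by (intro compact_imp_bounded compact_continuous_image) (auto intro: continuous_on_subset)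
  then obtain K where K: "K > 0" "\<forall>y\<in>{-1..1}. \<bar>f y\<bar> \<le> K" unfolding bounded_pos by auto
  have "\<bar>f y\<bar> \<le> K" for y
  proof (cases "\<bar>y\<bar> \<ge> 1")
    case True
    then show ?thesis using assms K(1) by (simp add: profile_def)
  next
    case False
    then have "y \<in> {-1..1}" by auto
    then show ?thesis using K(2) by blast
  qed
  with K(1) show ?thesis by (rule that)
qed

lemma integral_rescale:
  fixes f :: "real \<Rightarrow> real"
  assumes "c > 0"
  shows "(LINT x|lborel. f (c * (x - a))) = (LINT y|lborel. f y) / c"
  using lborel_integral_real_affine[of "1 / c" "\<lambda>x. f (c * (x - a))" a] assms by simp

text \<open>The point of concentration is (t0, x0). In \<open>bubble\<close> below, \<kappa> is the
  velocity of the moving centre, and \<mu> is the ratio of the extent in time, \<delta>, to the half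
  width in space, \<delta> / \<mu>.\<close>

locale concentration = time_interval +
  fixes t0 x0 \<kappa> \<mu> :: real
  assumes t0: "0 < t0" "t0 < T" and \<mu>_pos: "0 < \<mu>"
begin

definition bubble :: "(real \<Rightarrow> real) \<Rightarrow> (real \<Rightarrow> real) \<Rightarrow> real \<Rightarrow> real \<Rightarrow> real \<Rightarrow> real" where
  "bubble f g \<delta> t x = f ((t - t0) / \<delta>) * g (\<mu> * (x - x0 - \<kappa> * (t - t0)) / \<delta>)"

lemma bubble_eq_0_time: "profile f \<Longrightarrow> \<delta> > 0 \<Longrightarrow> \<delta> \<le> \<bar>t - t0\<bar> \<Longrightarrow> bubble f g \<delta> t x = 0"
  by (simp add: bubble_def profile_def)

lemma bubble_eq_0_space:
  "profile g \<Longrightarrow> \<delta> > 0 \<Longrightarrow> \<delta> / \<mu> \<le> \<bar>x - x0 - \<kappa> * (t - t0)\<bar> \<Longrightarrow> bubble f g \<delta> t x = 0"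
  using \<mu>_pos by (simp add: bubble_def profile_def abs_mult pos_divide_le_eq mult.commute)

lemma bubble_eq_0_far:
  assumes "profile f" "profile g" "\<delta> > 0" "(1 + \<bar>\<kappa>\<bar> + 1 / \<mu>) * \<delta> \<le> max \<bar>t - t0\<bar> \<bar>x - x0\<bar>"
  shows "bubble f g \<delta> t x = 0"
proof (cases "\<delta> \<le> \<bar>t - t0\<bar>")
  case True
  then show ?thesis using bubble_eq_0_time assms by simp
next
  case False
  \<comment> \<open>While |t - t0| < \<delta>, the centre moves by at most |\<kappa>| \<delta> and
    the half width is \<delta> / \<mu>. The summand 1 in the constant lets the same bound cover the
    extent in time.\<close>
  have "\<delta> \<le> (1 + \<bar>\<kappa>\<bar> + 1 / \<mu>) * \<delta>" using assms(3) \<mu>_pos by (simp add: algebra_simps)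
  with False assms(4) have "(1 + \<bar>\<kappa>\<bar> + 1 / \<mu>) * \<delta> \<le> \<bar>x - x0\<bar>" by (simp add: max_def split: if_splits)
  moreover have "\<bar>\<kappa> * (t - t0)\<bar> \<le> \<bar>\<kappa>\<bar> * \<delta>"
    unfolding abs_mult using False by (intro mult_left_mono) auto
  moreover have "(1 + \<bar>\<kappa>\<bar> + 1 / \<mu>) * \<delta> = \<delta> + \<bar>\<kappa>\<bar> * \<delta> + \<delta> / \<mu>" by (simp add: algebra_simps)
  ultimately have "\<delta> / \<mu> \<le> \<bar>x - x0 - \<kappa> * (t - t0)\<bar>" using assms(3) by linarith
  then show ?thesis using bubble_eq_0_space assms by simp
qed

lemma cont_strip_bubble:
  assumes "profile f" "profile g"
  shows "cont_strip (bubble f g \<delta>)"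
proof -
  have "cont_strip (\<lambda>t x. (t - t0) / \<delta>)" "cont_strip (\<lambda>t x. \<mu> * (x - x0 - \<kappa> * (t - t0)) / \<delta>)"
    unfolding cont_strip_def divide_inverse by (intro continuous_intros)+
  then have "cont_strip (\<lambda>t x. f ((t - t0) / \<delta>))" "cont_strip (\<lambda>t x. g (\<mu> * (x - x0 - \<kappa> * (t - t0)) / \<delta>))"
    using assms cont_strip_compose[of f "\<lambda>t x. (t - t0) / \<delta>"]
      cont_strip_compose[of g "\<lambda>t x. \<mu> * (x - x0 - \<kappa> * (t - t0)) / \<delta>"] by (simp_all add: profile_def)
  then show ?thesis unfolding bubble_def[abs_def] by (rule cont_strip_mult)
qed

lemma decays_mult_bubble:
  assumes F: "cont_strip F" and fg: "profile f" "profile g" and \<delta>: "\<delta> > 0"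
  shows "decays (\<lambda>t x. F t x * bubble f g \<delta> t x)"
proof (rule decays_compact_support)
  show "cont_strip (\<lambda>t x. F t x * bubble f g \<delta> t x)"
    by (intro cont_strip_mult F cont_strip_bubble fg)
  fix t x assume "\<bar>x0\<bar> + (1 + \<bar>\<kappa>\<bar> + 1 / \<mu>) * \<delta> < \<bar>x\<bar>"
  then have "(1 + \<bar>\<kappa>\<bar> + 1 / \<mu>) * \<delta> \<le> max \<bar>t - t0\<bar> \<bar>x - x0\<bar>" by linarith
  then show "F t x * bubble f g \<delta> t x = 0" using bubble_eq_0_far[OF fg \<delta>] by simp
qed

lemma strip_integral_bubble:
  assumes fg: "profile f" "profile g" and \<delta>: "\<delta> > 0" "\<delta> \<le> t0" "\<delta> \<le> T - t0"
  shows "strip_integral (bubble f g \<delta>) = \<delta>\<^sup>2 / \<mu> * ((LINT y|lborel. f y) * (LINT y|lborel. g y))"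
proof -
  have g: "(LINT x|lborel. g (\<mu> * (x - x0 - \<kappa> * (t - t0)) / \<delta>)) = \<delta> / \<mu> * (LINT y|lborel. g y)" for t
  proof -
    have eq: "\<mu> * (x - x0 - \<kappa> * (t - t0)) / \<delta> = \<mu> / \<delta> * (x - (x0 + \<kappa> * (t - t0)))" for x
      by (simp add: diff_diff_eq)
    show ?thesis unfolding eq
      using integral_rescale[of "\<mu> / \<delta>" g "x0 + \<kappa> * (t - t0)"] \<mu>_pos \<delta>
      by (simp add: mult.commute)
  qed
  have ind: "indicator {0..T} t *\<^sub>R f ((t - t0) / \<delta>) = f ((1 / \<delta>) * (t - t0))" for t
  proof (cases "t \<in> {0..T}")
    case False
    then have "\<delta> \<le> \<bar>t - t0\<bar>" using \<delta> by auto
    then have "f ((t - t0) / \<delta>) = 0" using fg \<delta> by (simp add: profile_def)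
    then show ?thesis by simp
  qed simp
  have f: "(LINT t:{0..T}|lborel. f ((t - t0) / \<delta>)) = \<delta> * (LINT y|lborel. f y)"
    unfolding set_lebesgue_integral_def ind using integral_rescale[of "1 / \<delta>" f t0] \<delta> by (simp add: mult.commute)
  show ?thesis
    unfolding strip_integral_def bubble_def by (simp add: g f power2_eq_square)
qed

text \<open>Divided by \<delta>^2, a bubble is an approximate point mass at (t0, x0): a continuous
  coefficient is replaced by its value there. All the limits below reduce to this one.\<close>

lemma strip_integral_bubble_tendsto:
  assumes F: "cont_strip F" and fg: "profile f" "profile g"
  shows "((\<lambda>\<delta>. strip_integral (\<lambda>t x. F t x * bubble f g \<delta> t x) / \<delta>\<^sup>2) \<longlongrightarrow>
    F t0 x0 / \<mu> * ((LINT y|lborel. f y) * (LINT y|lborel. g y))) (at_right 0)"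
proof (rule tendstoI)
  fix e :: real assume e: "e > 0"
  let ?A = "(LINT y|lborel. \<bar>f y\<bar>) * (LINT y|lborel. \<bar>g y\<bar>) / \<mu>"
  let ?L = "F t0 x0 / \<mu> * ((LINT y|lborel. f y) * (LINT y|lborel. g y))"
  have A: "?A \<ge> 0" using \<mu>_pos by simp
  \<comment> \<open>The integral of the absolute value of the bubble is \<open>?A\<close> times
    \<delta>^2, so an oscillation of \<open>F\<close> below \<eta> costs at most \<eta>
    \<open>?A\<close> after division. The summand 1 makes this strictly less than \<open>e\<close>,
    also when \<open>?A\<close> is 0.\<close>
  define \<eta> where "\<eta> = e / (?A + 1)"
  have \<eta>: "\<eta> > 0" using e A by (simp add: \<eta>_def add_nonneg_pos)
  have "\<eta> * ?A < \<eta> * (?A + 1)" using \<eta> by (intro mult_strict_left_mono) auto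
  also have "\<dots> = e" using A by (simp add: \<eta>_def)
  finally have \<eta>A: "\<eta> * ?A < e" .
  have "(t0, x0) \<in> {0..T} \<times> UNIV" using t0 by simp
  then obtain d where d: "d > 0"
    "\<And>z. z \<in> {0..T} \<times> UNIV \<Longrightarrow> dist z (t0, x0) < d \<Longrightarrow> dist (F (fst z) (snd z)) (F t0 x0) < \<eta>"
    using F[unfolded cont_strip_def continuous_on_iff] \<eta> by (metis fst_conv snd_conv)
  have near: "\<bar>F t x - F t0 x0\<bar> \<le> \<eta>" if "t \<in> {0..T}" "\<bar>t - t0\<bar> < d / 2" "\<bar>x - x0\<bar> < d / 2" for t x
  proof -
    have "dist (t, x) (t0, x0) \<le> \<bar>t - t0\<bar> + \<bar>x - x0\<bar>"
      unfolding dist_Pair_Pair dist_real_def by (rule sqrt_sum_squares_le_sum) auto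
    with that have "dist (t, x) (t0, x0) < d" by linarith
    from d(2)[OF _ this] that(1) show ?thesis by (simp add: dist_real_def)
  qed
  let ?r = "1 + \<bar>\<kappa>\<bar> + 1 / \<mu>"
  have r: "?r > 0" using \<mu>_pos by (simp add: add_pos_pos add_pos_nonneg)
  \<comment> \<open>Small enough for the support in time to lie in [0,T] and for the whole support
    to lie in the box of half side d / 2 on which \<open>near\<close> applies.\<close>
  define \<delta>0 where "\<delta>0 = min (min t0 (T - t0)) (d / 2 / ?r)"
  have \<delta>0: "\<delta>0 > 0" using t0 d(1) r by (simp add: \<delta>0_def)
  have "dist (strip_integral (\<lambda>t x. F t x * bubble f g \<delta> t x) / \<delta>\<^sup>2) ?L < e" if \<delta>: "0 < \<delta>" "\<delta> < \<delta>0" for \<delta>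
  proof -
    have "\<delta> < d / 2 / ?r" using \<delta> by (simp add: \<delta>0_def)
    then have "\<delta> * ?r < d / 2" unfolding pos_less_divide_eq[OF r] .
    then have \<delta>': "\<delta> \<le> t0" "\<delta> \<le> T - t0" "?r * \<delta> \<le> d / 2"
      using \<delta> by (auto simp: \<delta>0_def mult.commute)
    let ?B = "bubble f g \<delta>"
    let ?B' = "bubble (\<lambda>y. \<bar>f y\<bar>) (\<lambda>y. \<bar>g y\<bar>) \<delta>"
    have dec: "decays (\<lambda>t x. F t x * ?B t x)" "decays (\<lambda>t x. F t0 x0 * ?B t x)" "decays (\<lambda>t x. \<eta> * ?B' t x)"
      using fg \<delta> by (intro decays_mult_bubble F cont_strip_const profile_abs; simp)+
    have diff: "strip_integral (\<lambda>t x. F t x * ?B t x) - F t0 x0 * strip_integral ?B =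
        strip_integral (\<lambda>t x. F t x * ?B t x - F t0 x0 * ?B t x)"
      using strip_integral_diff[OF dec(1,2)] strip_integral_cmult[of "F t0 x0" ?B] by simp
    have le: "\<bar>strip_integral (\<lambda>t x. F t x * ?B t x - F t0 x0 * ?B t x)\<bar> \<le> strip_integral (\<lambda>t x. \<eta> * ?B' t x)"
    proof (rule abs_strip_integral_le[OF decays_diff[OF dec(1,2)] dec(3)])
      fix t x assume t: "t \<in> {0..T}"
      have abs: "?B' t x = \<bar>?B t x\<bar>" by (simp add: bubble_def abs_mult)
      have "\<bar>F t x - F t0 x0\<bar> * \<bar>?B t x\<bar> \<le> \<eta> * \<bar>?B t x\<bar>"
      proof (cases "?B t x = 0")
        case False
        then have "max \<bar>t - t0\<bar> \<bar>x - x0\<bar> < ?r * \<delta>"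
          using bubble_eq_0_far[OF fg \<delta>(1), of t x] by linarith
        then have "\<bar>t - t0\<bar> < d / 2" "\<bar>x - x0\<bar> < d / 2"
          using \<delta>'(3) unfolding max_less_iff_conj by linarith+
        then have "\<bar>F t x - F t0 x0\<bar> \<le> \<eta>" by (rule near[OF t])
        then show ?thesis by (rule mult_right_mono) simp
      qed simp
      then show "\<bar>F t x * ?B t x - F t0 x0 * ?B t x\<bar> \<le> \<eta> * ?B' t x"
        by (simp add: abs left_diff_distrib[symmetric] abs_mult)
    qed
    have eq: "strip_integral (\<lambda>t x. \<eta> * ?B' t x) = \<eta> * ?A * \<delta>\<^sup>2"
      using strip_integral_bubble[OF profile_abs[OF fg(1)] profile_abs[OF fg(2)] \<delta>(1) \<delta>'(1,2)]
      by (simp add: strip_integral_cmult)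
    have "\<eta> * ?A * \<delta>\<^sup>2 < e * \<delta>\<^sup>2" using \<eta>A \<delta> by (intro mult_strict_right_mono) auto
    with le have main: "\<bar>strip_integral (\<lambda>t x. F t x * ?B t x) - F t0 x0 * strip_integral ?B\<bar> < e * \<delta>\<^sup>2"
      unfolding diff eq by linarith
    have L: "F t0 x0 * strip_integral ?B = ?L * \<delta>\<^sup>2"
      using strip_integral_bubble[OF fg \<delta>(1) \<delta>'(1,2)] by simp
    have "strip_integral (\<lambda>t x. F t x * ?B t x) / \<delta>\<^sup>2 - ?L =
        (strip_integral (\<lambda>t x. F t x * ?B t x) - F t0 x0 * strip_integral ?B) / \<delta>\<^sup>2"
      unfolding L using \<delta>(1) by (simp add: diff_divide_distrib)
    then have "\<bar>strip_integral (\<lambda>t x. F t x * ?B t x) / \<delta>\<^sup>2 - ?L\<bar> < e"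
      using main \<delta>(1) by (simp add: pos_divide_less_eq)
    then show ?thesis by (simp add: dist_real_def)
  qed
  then show "\<forall>\<^sub>F \<delta> in at_right 0. dist (strip_integral (\<lambda>t x. F t x * bubble f g \<delta> t x) / \<delta>\<^sup>2) ?L < e"
    unfolding eventually_at_right_field using \<delta>0 by blast
qed

end

context time_interval
begin

section \<open>Regularity and perturbation of paths\<close>

lemma smooth_strip_slice: "smooth_strip T F \<Longrightarrow> t \<in> {0..T} \<Longrightarrow> smooth_line (F t)"
proof -
  assume F: "smooth_strip T F" and t: "t \<in> {0..T}"
  have "Ck_line k (F t)" for k using F
  proof (induction k arbitrary: F)
    case (Suc k)
    show ?case
      by (rule Ck_line_SucI[where f'="D_x F t"])
        (use Suc smooth_strip_DERIV_x t smooth_strip_D_x in blast)+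
  qed simp
  then show ?thesis by (simp add: smooth_line_iff_Ck)
qed

lemma funpow_D_x: "(D_x ^^ i) F t = (deriv ^^ i) (F t)"
proof (induction i)
  case (Suc i)
  have "(D_x ^^ Suc i) F t = deriv ((D_x ^^ i) F t)"
    unfolding funpow.simps o_def D_x_def[of "(D_x ^^ i) F"] ..
  with Suc show ?case by simp
qed simp

lemma schwartz_strip_slice:
  assumes "F \<in> schwartz_strip T" "t \<in> {0..T}"
  shows "F t \<in> schwartz_line"
proof -
  have "bounded (range (\<lambda>x. (1 + \<bar>x\<bar>\<^sup>2) ^ k * (deriv ^^ i) (F t) x))" for k i
  proof -
    obtain C where C: "\<And>t x. t \<in> {0..T} \<Longrightarrow> \<bar>(1 + \<bar>x\<bar>\<^sup>2) ^ k * (D_x ^^ i) ((D_t T ^^ 0) F) t x\<bar> \<le> C"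
      using schwartz_strip_bound[OF assms(1), of k i 0] by metis
    have "\<bar>(1 + \<bar>x\<bar>\<^sup>2) ^ k * (deriv ^^ i) (F t) x\<bar> \<le> C" for x
      using C[OF assms(2), of x] unfolding funpow_0 funpow_D_x .
    then show ?thesis unfolding bounded_iff real_norm_def by blast
  qed
  with smooth_strip_slice[OF schwartz_strip_smooth] assms show ?thesis by (simp add: schwartz_line_def)
qed

lemma schwartz_strip_decays:
  assumes "F \<in> schwartz_strip T"
  shows "decays ((D_x ^^ i) ((D_t T ^^ j) F))"
proof -
  obtain C where C: "\<And>t x. t \<in> {0..T} \<Longrightarrow> \<bar>(1 + \<bar>x\<bar>\<^sup>2) ^ 1 * (D_x ^^ i) ((D_t T ^^ j) F) t x\<bar> \<le> C"
    using schwartz_strip_bound[OF assms, of 1 i j] by metis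
  have "\<bar>(D_x ^^ i) ((D_t T ^^ j) F) t x\<bar> \<le> C * inverse (1 + x\<^sup>2)" if "t \<in> {0..T}" for t x
  proof -
    have pos: "0 < 1 + x\<^sup>2" by (simp add: add_pos_nonneg)
    have "(1 + x\<^sup>2) * \<bar>(D_x ^^ i) ((D_t T ^^ j) F) t x\<bar> \<le> C"
      using C[OF that, of x] pos by (simp add: abs_mult)
    with pos show ?thesis by (simp add: pos_le_divide_eq divide_inverse[symmetric] mult.commute)
  qed
  with smooth_strip_cont[OF smooth_strip_funpow[OF schwartz_strip_smooth[OF assms]]] show ?thesis
    by (rule decaysI)
qed

lemma decays_bounded:
  assumes "decays F"
  obtains K where "K > 0" "\<And>t x. t \<in> {0..T} \<Longrightarrow> \<bar>F t x\<bar> \<le> K"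
proof -
  obtain C where C: "\<And>t x. t \<in> {0..T} \<Longrightarrow> \<bar>F t x\<bar> \<le> C * inverse (1 + x\<^sup>2)"
    using assms decaysE by metis
  have "\<bar>F t x\<bar> \<le> \<bar>C\<bar> + 1" if "t \<in> {0..T}" for t x
  proof -
    have "0 < 1 + x\<^sup>2" by (simp add: add_pos_nonneg)
    then have "inverse (1 + x\<^sup>2) \<le> 1" by (simp add: inverse_le_1_iff)
    moreover have "0 \<le> inverse (1 + x\<^sup>2)" by simp
    ultimately have "C * inverse (1 + x\<^sup>2) \<le> \<bar>C\<bar> * 1"
      by (intro mult_mono) auto
    with C[OF that, of x] show ?thesis by linarith
  qed
  then show ?thesis by (intro that[of "\<bar>C\<bar> + 1"]) auto
qed

end

section \<open>Paths of diffeomorphisms\<close>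

locale diff_path = time_interval +
  fixes \<phi> :: "real \<Rightarrow> real \<Rightarrow> real"
  assumes path: "\<phi> \<in> diff_paths T"
begin

abbreviation "\<phi>_t \<equiv> D_t T \<phi>"
abbreviation "\<phi>_x \<equiv> D_x \<phi>"
abbreviation "\<phi>_tx \<equiv> D_x (D_t T \<phi>)"
abbreviation "\<phi>_xx \<equiv> D_x (D_x \<phi>)"

lemma smooth_path: "smooth_strip T \<phi>"
  and schwartz_path: "(\<lambda>t x. \<phi> t x - x) \<in> schwartz_strip T"
  using path by (auto simp: diff_paths_def)

lemma cont_path [cont_intros]:
  "cont_strip \<phi>_t" "cont_strip \<phi>_x" "cont_strip \<phi>_tx" "cont_strip \<phi>_xx"
  "cont_strip (D_x \<phi>_tx)" "cont_strip (D_x \<phi>_xx)"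
  by (intro smooth_strip_cont smooth_strip_D_x smooth_strip_D_t smooth_path)+

lemma smooth_strip_space: "smooth_strip T (\<lambda>t x. x)"
  using Ck_strip_affine[OF smooth_line_affine[of 1 0], where a=0 and b=1 and c=0] by (simp add: smooth_strip_def)

lemma D_t_space: "t \<in> {0..T} \<Longrightarrow> D_t T (\<lambda>t x. x) t = (\<lambda>x. 0)"
  unfolding D_t_def by (rule ext, rule deriv_I_eq) auto

lemma D_x_space: "D_x (\<lambda>t x. x) t = (\<lambda>x. 1)"
  unfolding D_x_def by (rule ext, rule DERIV_imp_deriv) simp

text \<open>Only the displacement \<phi> - x is known to decrease rapidly. These formulas pass the
  decay on to the derivatives of \<phi>, with the constant 1 left over in \<phi>_x.\<close>

lemma
  assumes t: "t \<in> {0..T}"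
  shows D_t_displacement: "D_t T (\<lambda>t x. \<phi> t x - x) t = \<phi>_t t"
    and D_x_displacement: "D_x (\<lambda>t x. \<phi> t x - x) t = (\<lambda>x. \<phi>_x t x - 1)"
  using D_t_lin[OF smooth_path smooth_strip_space t, of "- 1"] D_x_lin[OF smooth_path smooth_strip_space t, of "- 1"] t
  by (simp_all add: D_t_space D_x_space)

lemma decays_\<phi>_t: "decays \<phi>_t"
  using schwartz_strip_decays[OF schwartz_path, of 0 1] decays_cong[of "D_t T (\<lambda>t x. \<phi> t x - x)" \<phi>_t]
  by (simp add: D_t_displacement)

lemma decays_\<phi>_x: "decays (\<lambda>t x. \<phi>_x t x - 1)"
  using schwartz_strip_decays[OF schwartz_path, of 1 0] decays_cong[of "D_x (\<lambda>t x. \<phi> t x - x)" "\<lambda>t x. \<phi>_x t x - 1"]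
  by (simp add: D_x_displacement)

lemma decays_\<phi>_tx: "decays \<phi>_tx"
proof -
  have "D_x (D_t T (\<lambda>t x. \<phi> t x - x)) t = \<phi>_tx t" if "t \<in> {0..T}" for t
    by (rule D_x_cong) (rule D_t_displacement[OF that])
  then show ?thesis
    using schwartz_strip_decays[OF schwartz_path, of 1 1] decays_cong[of "D_x (D_t T (\<lambda>t x. \<phi> t x - x))" \<phi>_tx]
    by simp
qed

lemma decays_\<phi>_xx: "decays \<phi>_xx"
proof -
  have "D_x (D_x (\<lambda>t x. \<phi> t x - x)) t x = \<phi>_xx t x" if "t \<in> {0..T}" for t x
  proof -
    have "D_x (D_x (\<lambda>t x. \<phi> t x - x)) t = D_x (\<lambda>t x. \<phi>_x t x - 1) t"
      by (rule D_x_cong) (rule D_x_displacement[OF that])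
    then have "D_x (D_x (\<lambda>t x. \<phi> t x - x)) t x = D_x (\<lambda>t x. \<phi>_x t x - 1) t x" by simp
    also have "\<dots> = \<phi>_xx t x - 0"
      unfolding D_x_def[of "\<lambda>t x. \<phi>_x t x - 1"]
      by (rule DERIV_imp_deriv) (intro DERIV_diff smooth_strip_DERIV_x smooth_strip_D_x smooth_path that DERIV_const)
    finally show ?thesis by simp
  qed
  then show ?thesis
    using schwartz_strip_decays[OF schwartz_path, of 2 0] decays_cong[of "D_x (D_x (\<lambda>t x. \<phi> t x - x))" \<phi>_xx]
    by (simp add: numeral_2_eq_2)
qed

lemma \<phi>_x_bounded: obtains K where "K > 0" "\<And>t x. t \<in> {0..T} \<Longrightarrow> \<bar>\<phi>_x t x\<bar> \<le> K"
proof -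
  obtain K where K: "K > 0" "\<And>t x. t \<in> {0..T} \<Longrightarrow> \<bar>\<phi>_x t x - 1\<bar> \<le> K"
    using decays_bounded[OF decays_\<phi>_x] by metis
  have "\<bar>\<phi>_x t x\<bar> \<le> K + 1" if "t \<in> {0..T}" for t x using K(2)[OF that, of x] by linarith
  with K(1) show ?thesis by (intro that[of "K + 1"]) auto
qed

lemma \<phi>_x_far:
  obtains R where "R \<ge> 0" "\<And>t x. t \<in> {0..T} \<Longrightarrow> R < \<bar>x\<bar> \<Longrightarrow> \<phi>_x t x \<ge> 1 / 2"
proof -
  obtain C where C: "\<And>t x. t \<in> {0..T} \<Longrightarrow> \<bar>\<phi>_x t x - 1\<bar> \<le> C * inverse (1 + x\<^sup>2)"
    using decays_\<phi>_x decaysE by metis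
  \<comment> \<open>For |x| > 1 one has |x| \<le> x^2, so |x| > 2 |C| already forces C / (1 + x^2)
    \<le> 1 / 2.\<close>
  have "\<phi>_x t x \<ge> 1 / 2" if t: "t \<in> {0..T}" and x: "2 * \<bar>C\<bar> + 1 < \<bar>x\<bar>" for t x
  proof -
    have "\<bar>x\<bar> * 1 \<le> \<bar>x\<bar> * \<bar>x\<bar>" using x by (intro mult_left_mono) auto
    then have "\<bar>x\<bar> \<le> x\<^sup>2" by (simp add: power2_eq_square abs_mult_self_eq)
    with x have "2 * C \<le> 1 + x\<^sup>2" by linarith
    moreover have "0 < 1 + x\<^sup>2" by (simp add: add_pos_nonneg)
    ultimately have "C * inverse (1 + x\<^sup>2) \<le> 1 / 2" by (simp add: field_simps)
    with C[OF t, of x] show ?thesis by linarith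
  qed
  then show ?thesis by (intro that[of "2 * \<bar>C\<bar> + 1"]) auto
qed

text \<open>A zero of the derivative would contradict the chain rule for the differentiable inverse.
  A continuous function without zeros has constant sign, and far out this derivative is close to
  1.\<close>

lemma \<phi>_x_pos:
  assumes t: "t \<in> {0..T}"
  shows "\<phi>_x t x > 0"
proof (rule ccontr)
  assume neg: "\<not> \<phi>_x t x > 0"
  have "diffeomorphism_line (\<phi> t)"
    using path t by (auto simp: diff_paths_def Diff_S_def)
  then have bij: "bij (\<phi> t)" and inv: "smooth_line (inv_into UNIV (\<phi> t))" by (auto simp: diffeomorphism_line_def)
  have nz: "\<phi>_x t y \<noteq> 0" for y
  proof
    assume "\<phi>_x t y = 0"
    then have "(\<phi> t has_real_derivative 0) (at y)"
      using smooth_strip_DERIV_x[OF smooth_path t, of y] by simp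
    from DERIV_chain2[OF smooth_line_DERIV[OF inv] this]
    have "((\<lambda>y. inv_into UNIV (\<phi> t) (\<phi> t y)) has_real_derivative 0) (at y)" by simp
    moreover have "(\<lambda>y. inv_into UNIV (\<phi> t) (\<phi> t y)) = (\<lambda>y. y)"
      using bij by (simp add: bij_def)
    ultimately have "((\<lambda>y. y) has_real_derivative 0) (at y)" by simp
    from DERIV_unique[OF this DERIV_ident] show False by simp
  qed
  obtain R where "R \<ge> 0" "\<And>t x. t \<in> {0..T} \<Longrightarrow> R < \<bar>x\<bar> \<Longrightarrow> \<phi>_x t x \<ge> 1 / 2" using \<phi>_x_far by metis
  then have far: "\<phi>_x t (R + 1) > 0" using t by (smt (verit) half_gt_zero_iff)
  have "connected (range (\<phi>_x t))"
    by (intro connected_continuous_image cont_strip_slice[OF cont_path(2) t]) simp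
  then have "0 \<in> range (\<phi>_x t)"
    by (rule connectedD_interval[of _ "\<phi>_x t x" "\<phi>_x t (R + 1)"]) (use neg far in auto)
  with nz show False by auto
qed

text \<open>Positivity at each point is not enough on an unbounded strip. A uniform bound comes from
  compactness for |x| \<le> R and from closeness to 1 elsewhere; it provides one range of \<epsilon>
  that serves all points.\<close>

lemma \<phi>_x_lower_bound: obtains m where "m > 0" "\<And>t x. t \<in> {0..T} \<Longrightarrow> m \<le> \<phi>_x t x"
proof -
  obtain R where R: "R \<ge> 0" "\<And>t x. t \<in> {0..T} \<Longrightarrow> R < \<bar>x\<bar> \<Longrightarrow> \<phi>_x t x \<ge> 1 / 2" using \<phi>_x_far by metis
  have "continuous_on ({0..T} \<times> {-R..R}) (\<lambda>z. \<phi>_x (fst z) (snd z))"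
    using cont_path(2) unfolding cont_strip_def by (rule continuous_on_subset) auto
  moreover have "{0..T} \<times> {-R..R} \<noteq> {}" using T_pos R(1) by auto
  ultimately obtain z where z: "z \<in> {0..T} \<times> {-R..R}"
    "\<And>w. w \<in> {0..T} \<times> {-R..R} \<Longrightarrow> \<phi>_x (fst z) (snd z) \<le> \<phi>_x (fst w) (snd w)"
    using continuous_attains_inf[OF compact_Times[OF compact_Icc compact_Icc], of 0 T "-R" R "\<lambda>z. \<phi>_x (fst z) (snd z)"]
    by blast
  let ?m = "min (1 / 2) (\<phi>_x (fst z) (snd z))"
  have "?m \<le> \<phi>_x t x" if "t \<in> {0..T}" for t x
  proof (cases "R < \<bar>x\<bar>")
    case True
    with R(2)[OF that True] show ?thesis by simp
  next
    case False
    then have "(t, x) \<in> {0..T} \<times> {-R..R}" using that by auto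
    from z(2)[OF this] show ?thesis by simp
  qed
  moreover have "?m > 0" using z(1) \<phi>_x_pos by auto
  ultimately show ?thesis by (intro that[of ?m])
qed

text \<open>A positive derivative gives injectivity and, by the inverse function rule, a smooth
  inverse. Surjectivity follows from the intermediate value theorem, because the displacement is
  bounded.\<close>

lemma perturbed_path:
  assumes h: "h \<in> schwartz_strip T"
  obtains e where "e > 0" "\<And>\<epsilon>. \<bar>\<epsilon>\<bar> < e \<Longrightarrow> (\<lambda>t x. \<phi> t x + \<epsilon> * h t x) \<in> diff_paths T"
proof -
  note sh = schwartz_strip_smooth[OF h]
  obtain m where m: "m > 0" "\<And>t x. t \<in> {0..T} \<Longrightarrow> m \<le> \<phi>_x t x" using \<phi>_x_lower_bound by metis
  obtain H where H: "H > 0" "\<And>t x. t \<in> {0..T} \<Longrightarrow> \<bar>D_x h t x\<bar> \<le> H"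
    using decays_bounded[OF schwartz_strip_decays[OF h, of 1 0, simplified]] by metis
  \<comment> \<open>The threshold m / H keeps \<epsilon> h_x strictly below the lower bound
    \<open>m\<close> of \<phi>_x in absolute value.\<close>
  have "(\<lambda>t x. \<phi> t x + \<epsilon> * h t x) \<in> diff_paths T" if \<epsilon>: "\<bar>\<epsilon>\<bar> < m / H" for \<epsilon>
  proof -
    let ?\<psi> = "\<lambda>t x. \<phi> t x + \<epsilon> * h t x"
    have smooth: "smooth_strip T ?\<psi>" by (rule smooth_strip_lin[OF smooth_path sh])
    have "(\<lambda>t x. (\<phi> t x - x) + \<epsilon> * h t x) \<in> schwartz_strip T" by (rule schwartz_strip_lin[OF schwartz_path h])
    moreover have "(\<lambda>t x. (\<phi> t x - x) + \<epsilon> * h t x) = (\<lambda>t x. ?\<psi> t x - x)" by (intro ext) simp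
    ultimately have schwartz: "(\<lambda>t x. ?\<psi> t x - x) \<in> schwartz_strip T" by simp
    have "?\<psi> t \<in> carrier Diff_S" if t: "t \<in> {0..T}" for t
    proof -
      have sl: "smooth_line (?\<psi> t)" by (rule smooth_strip_slice[OF smooth t])
      have pos: "deriv (?\<psi> t) x > 0" for x
      proof -
        have "deriv (?\<psi> t) x = \<phi>_x t x + \<epsilon> * D_x h t x"
          using D_x_lin[OF smooth_path sh t, of \<epsilon>] unfolding D_x_def[of ?\<psi>] by metis
        moreover have "\<bar>\<epsilon> * D_x h t x\<bar> < m"
        proof -
          have "\<bar>\<epsilon>\<bar> * \<bar>D_x h t x\<bar> \<le> \<bar>\<epsilon>\<bar> * H" using H(2)[OF t] by (rule mult_left_mono) simp
          also have "\<dots> < m" using \<epsilon> H(1) by (simp add: pos_less_divide_eq)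
          finally show ?thesis by (simp add: abs_mult)
        qed
        ultimately show ?thesis using m(2)[OF t, of x] by linarith
      qed
      have "strict_mono (?\<psi> t)"
        using DERIV_pos_imp_increasing[of _ _ "?\<psi> t"] smooth_line_DERIV[OF sl] pos
        by (intro strict_monoI) blast
      then have inj: "inj (?\<psi> t)" by (rule strict_mono_imp_inj_on)
      have sb: "(\<lambda>x. ?\<psi> t x - x) \<in> schwartz_line" by (rule schwartz_strip_slice[OF schwartz t])
      then have "bounded (range (\<lambda>x. (1 + \<bar>x\<bar>\<^sup>2) ^ 0 * (deriv ^^ 0) (\<lambda>x. ?\<psi> t x - x) x))"
        unfolding schwartz_line_def by blast
      then obtain B where B: "\<And>x. \<bar>?\<psi> t x - x\<bar> \<le> B" unfolding bounded_iff by auto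
      have cont: "continuous_on UNIV (?\<psi> t)"
        using smooth_line_isCont[OF sl] by (simp add: continuous_at_imp_continuous_on)
      have "surj (?\<psi> t)"
        unfolding surj_def
      proof
        fix y
        have "\<exists>x\<ge>y - B. x \<le> y + B \<and> ?\<psi> t x = y"
        proof (rule IVT')
          show "?\<psi> t (y - B) \<le> y" "y \<le> ?\<psi> t (y + B)" "y - B \<le> y + B"
            using B[of "y - B"] B[of "y + B"] by linarith+
          show "continuous_on {y - B..y + B} (?\<psi> t)" using cont continuous_on_subset by blast
        qed
        then show "\<exists>x. y = ?\<psi> t x" by blast
      qed
      with inj have bij: "bij (?\<psi> t)" by (simp add: bij_def)
      have "smooth_line (inv_into UNIV (?\<psi> t))"
        by (rule smooth_line_inv_into[OF sl bij]) (use pos in \<open>simp add: less_imp_neq[symmetric]\<close>)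
      with sl bij sb show ?thesis by (simp add: Diff_S_def diffeomorphism_line_def)
    qed
    with smooth schwartz show ?thesis by (simp add: diff_paths_def)
  qed
  with m(1) H(1) show ?thesis by (intro that[of "m / H"]) auto
qed

lemma openin_diff_path_topology_perturbed:
  assumes h: "h \<in> schwartz_strip T" and U: "openin (diff_path_topology T) U" and \<phi>: "\<phi> \<in> U"
  obtains e where "e > 0" "\<And>\<epsilon>. \<bar>\<epsilon>\<bar> < e \<Longrightarrow> (\<lambda>t x. \<phi> t x + \<epsilon> * h t x) \<in> U"
proof -
  obtain e1 where e1: "e1 > 0" "\<And>\<epsilon>. \<bar>\<epsilon>\<bar> < e1 \<Longrightarrow> (\<lambda>t x. \<phi> t x + \<epsilon> * h t x) \<in> diff_paths T"
    using perturbed_path[OF h] by metis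
  obtain V where V: "openin (schwartz_topology T) V" "U = (\<lambda>\<phi> t x. \<phi> t x - x) -` V \<inter> diff_paths T"
    using U unfolding diff_path_topology_def openin_pullback_topology by blast
  \<comment> \<open>The topology on paths is pulled back along the displacement, and the
    displacement of the perturbed path is an affine curve in \<epsilon>.\<close>
  let ?c = "\<lambda>\<epsilon> t x. \<phi> t x - x + \<epsilon> * h t x"
  have "openin euclideanreal {\<epsilon> \<in> topspace euclideanreal. ?c \<epsilon> \<in> V}"
    by (rule openin_continuous_map_preimage[OF continuous_map_affine_schwartz_topology[OF schwartz_path h] V(1)])
  then have op: "open {\<epsilon>. ?c \<epsilon> \<in> V}" by simp
  have eq: "?c \<epsilon> = (\<lambda>t x. \<phi> t x + \<epsilon> * h t x - x)" for \<epsilon> by (intro ext) simp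
  have "0 \<in> {\<epsilon>. ?c \<epsilon> \<in> V}" using \<phi> by (simp add: V(2))
  with op obtain e2 where e2: "e2 > 0" "ball 0 e2 \<subseteq> {\<epsilon>. ?c \<epsilon> \<in> V}"
    using open_contains_ball by blast
  have "(\<lambda>t x. \<phi> t x + \<epsilon> * h t x) \<in> U" if "\<bar>\<epsilon>\<bar> < min e1 e2" for \<epsilon>
  proof -
    have "\<epsilon> \<in> ball 0 e2" using that by (simp add: dist_real_def)
    with e2(2) have "?c \<epsilon> \<in> V" by blast
    then show ?thesis using e1(2)[of \<epsilon>] that unfolding V(2) eq by simp
  qed
  with e1(1) e2(1) show ?thesis by (intro that[of "min e1 e2"]) auto
qed

end

context time_interval
begin

section \<open>Second order expansion of the energies\<close>

text \<open>The multipliers of \<open>decays\<close>. Functions such as \<phi>_x and 1 / \<phi>_x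
  tend to 1 instead of decaying, so each integrand below is estimated as one decaying factor times
  members of this class.\<close>

definition bcont :: "(real \<Rightarrow> real \<Rightarrow> real) \<Rightarrow> bool" where
  "bcont G \<longleftrightarrow> cont_strip G \<and> (\<exists>K. \<forall>t\<in>{0..T}. \<forall>x. \<bar>G t x\<bar> \<le> K)"

lemma bcontI: "cont_strip G \<Longrightarrow> (\<And>t x. t \<in> {0..T} \<Longrightarrow> \<bar>G t x\<bar> \<le> K) \<Longrightarrow> bcont G"
  unfolding bcont_def by blast

lemma bcontE:
  assumes "bcont G"
  obtains K where "\<And>t x. t \<in> {0..T} \<Longrightarrow> \<bar>G t x\<bar> \<le> K"
  using assms unfolding bcont_def by blast

lemma bcont_cont: "bcont G \<Longrightarrow> cont_strip G"
  by (simp add: bcont_def)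

lemma decays_bcont: "decays F \<Longrightarrow> bcont F"
  by (metis bcontI decays_bounded decays_cont)

lemma bcont_const: "bcont (\<lambda>t x. c)"
  by (rule bcontI[where K="\<bar>c\<bar>"]) (auto intro: cont_strip_const)

lemma bcont_add:
  assumes "bcont F" "bcont G" shows "bcont (\<lambda>t x. F t x + G t x)"
proof -
  obtain K where K: "\<And>t x. t \<in> {0..T} \<Longrightarrow> \<bar>F t x\<bar> \<le> K" using assms(1) bcontE by metis
  obtain L where L: "\<And>t x. t \<in> {0..T} \<Longrightarrow> \<bar>G t x\<bar> \<le> L" using assms(2) bcontE by metis
  have "\<bar>F t x + G t x\<bar> \<le> K + L" if "t \<in> {0..T}" for t x
    using K[OF that, of x] L[OF that, of x] by linarith
  with cont_strip_add[OF assms[THEN bcont_cont]] show ?thesis by (rule bcontI)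
qed

lemma bcont_mult:
  assumes "bcont F" "bcont G" shows "bcont (\<lambda>t x. F t x * G t x)"
proof -
  obtain K where K: "\<And>t x. t \<in> {0..T} \<Longrightarrow> \<bar>F t x\<bar> \<le> K" using assms(1) bcontE by metis
  obtain L where L: "\<And>t x. t \<in> {0..T} \<Longrightarrow> \<bar>G t x\<bar> \<le> L" using assms(2) bcontE by metis
  have "\<bar>F t x * G t x\<bar> \<le> K * L" if "t \<in> {0..T}" for t x
    unfolding abs_mult using K[OF that, of x] L[OF that, of x] by (intro mult_mono) auto
  with cont_strip_mult[OF assms[THEN bcont_cont]] show ?thesis by (rule bcontI)
qed

lemma bcont_power: "bcont F \<Longrightarrow> bcont (\<lambda>t x. F t x ^ n)"
  by (induction n) (simp_all add: bcont_const bcont_mult)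

lemma bcont_abs: "bcont F \<Longrightarrow> bcont (\<lambda>t x. \<bar>F t x\<bar>)"
  unfolding bcont_def using cont_strip_abs by auto

lemma decays_mult: "decays F \<Longrightarrow> bcont G \<Longrightarrow> decays (\<lambda>t x. F t x * G t x)"
  using decays_mult_bounded unfolding bcont_def by blast

lemmas bcont_intros = bcont_const bcont_add bcont_mult bcont_power bcont_abs

lemma continuous_bounded_time:
  fixes f :: "real \<Rightarrow> real"
  assumes "continuous_on {0..T} f"
  obtains K where "K \<ge> 0" "\<And>t. t \<in> {0..T} \<Longrightarrow> \<bar>f t\<bar> \<le> K"
proof -
  have "bounded (f ` {0..T})" using assms by (intro compact_imp_bounded compact_continuous_image) auto
  then obtain K where "K > 0" "\<forall>y\<in>f ` {0..T}. \<bar>y\<bar> \<le> K" unfolding bounded_pos by auto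
  then show ?thesis by (intro that[of K]) auto
qed

lemma set_integral_abs_le_const:
  fixes f :: "real \<Rightarrow> real"
  assumes "continuous_on {0..T} f" "\<And>t. t \<in> {0..T} \<Longrightarrow> \<bar>f t\<bar> \<le> K"
  shows "\<bar>LINT t:{0..T}|lborel. f t\<bar> \<le> T * K"
proof -
  have i: "set_integrable lborel {0..T} f" "set_integrable lborel {0..T} (\<lambda>t. K)" "set_integrable lborel {0..T} (\<lambda>t. - K)"
    using assms by (auto intro!: borel_integrable_atLeastAtMost')
  have c: "(LINT t:{0..T}|lborel. c) = T * c" for c :: real
    using T_pos by (simp add: set_lebesgue_integral_def)
  have "(LINT t:{0..T}|lborel. f t) \<le> (LINT t:{0..T}|lborel. K)"
    by (intro set_integral_mono i) (use assms(2) in \<open>auto simp: abs_le_iff\<close>)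
  moreover have "(LINT t:{0..T}|lborel. - K) \<le> (LINT t:{0..T}|lborel. f t)"
    by (intro set_integral_mono i) (use assms(2) in \<open>force simp: abs_le_iff\<close>)
  ultimately show ?thesis unfolding c by (simp add: abs_le_iff)
qed

text \<open>Here \<beta> is the vertical velocity, \<open>f\<close> and \<open>g\<close> are the
  first two coefficients of the inner integral, and \<open>r\<close> is its remainder. The square
  mixes the orders, so what must be checked is that everything beyond order two is bounded by a
  multiple of |\<epsilon>|^3, uniformly in time.\<close>

lemma square_integral_expansion:
  fixes \<beta> f g :: "real \<Rightarrow> real" and r :: "real \<Rightarrow> real \<Rightarrow> real"
  assumes cont: "continuous_on {0..T} \<beta>" "continuous_on {0..T} f" "continuous_on {0..T} g"
    and r: "\<And>\<epsilon>. \<bar>\<epsilon>\<bar> < e \<Longrightarrow> continuous_on {0..T} (r \<epsilon>)"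
    and K: "\<And>\<epsilon> t. \<bar>\<epsilon>\<bar> < e \<Longrightarrow> t \<in> {0..T} \<Longrightarrow> \<bar>r \<epsilon> t\<bar> \<le> K * \<bar>\<epsilon>\<bar> ^ 3"
    and e: "e \<le> 1"
  shows "\<exists>C. \<forall>\<epsilon>. \<bar>\<epsilon>\<bar> < e \<longrightarrow>
    \<bar>(LINT t:{0..T}|lborel. (\<beta> t - \<epsilon> * f t - \<epsilon>\<^sup>2 * g t - r \<epsilon> t)\<^sup>2) -
      ((LINT t:{0..T}|lborel. (\<beta> t)\<^sup>2) + \<epsilon> * (LINT t:{0..T}|lborel. - 2 * \<beta> t * f t) +
       \<epsilon>\<^sup>2 * (LINT t:{0..T}|lborel. (f t)\<^sup>2 - 2 * \<beta> t * g t))\<bar> \<le> C * \<bar>\<epsilon>\<bar> ^ 3"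
    (is "\<exists>C. \<forall>\<epsilon>. _ \<longrightarrow> ?err \<epsilon> \<le> _")
proof -
  obtain B where B: "B \<ge> 0" "\<And>t. t \<in> {0..T} \<Longrightarrow> \<bar>\<beta> t\<bar> \<le> B" using continuous_bounded_time[OF cont(1)] by metis
  obtain F where F: "F \<ge> 0" "\<And>t. t \<in> {0..T} \<Longrightarrow> \<bar>f t\<bar> \<le> F" using continuous_bounded_time[OF cont(2)] by metis
  obtain G where G: "G \<ge> 0" "\<And>t. t \<in> {0..T} \<Longrightarrow> \<bar>g t\<bar> \<le> G" using continuous_bounded_time[OF cont(3)] by metis
  \<comment> \<open>One summand for each of the three groups of \<open>s\<close> below; higher
    powers of \<epsilon> are absorbed by |\<epsilon>| \<le> 1.\<close>
  define M where "M = 2 * F * G + G\<^sup>2 + \<bar>K\<bar> * (2 * B + 2 * F + 2 * G + \<bar>K\<bar>)"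
  show ?thesis
  proof (intro exI[of _ "T * M"] allI impI)
    fix \<epsilon> :: real assume \<epsilon>: "\<bar>\<epsilon>\<bar> < e"
    \<comment> \<open>All terms of order at least three in the expanded square. The last group
      contains every product with the remainder, which is itself of order three.\<close>
    define s where "s t = \<epsilon> ^ 3 * (2 * f t * g t) + \<epsilon> ^ 4 * (g t)\<^sup>2 + r \<epsilon> t * (- 2 * \<beta> t + 2 * \<epsilon> * f t + 2 * \<epsilon>\<^sup>2 * g t + r \<epsilon> t)" for t
    note c = cont r[OF \<epsilon>]
    have scont: "continuous_on {0..T} s" unfolding s_def by (intro continuous_intros c)
    have int: "set_integrable lborel {0..T} (\<lambda>t. (\<beta> t)\<^sup>2)" "set_integrable lborel {0..T} (\<lambda>t. \<epsilon> * (- 2 * \<beta> t * f t))"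
      "set_integrable lborel {0..T} (\<lambda>t. \<epsilon>\<^sup>2 * ((f t)\<^sup>2 - 2 * \<beta> t * g t))" "set_integrable lborel {0..T} s"
      by (intro borel_integrable_atLeastAtMost' continuous_intros c scont)+
    have "(\<lambda>t. (\<beta> t - \<epsilon> * f t - \<epsilon>\<^sup>2 * g t - r \<epsilon> t)\<^sup>2) =
        (\<lambda>t. (\<beta> t)\<^sup>2 + \<epsilon> * (- 2 * \<beta> t * f t) + \<epsilon>\<^sup>2 * ((f t)\<^sup>2 - 2 * \<beta> t * g t) + s t)"
      by (intro ext) (simp add: s_def algebra_simps power2_eq_square power3_eq_cube power4_eq_xxxx)
    then have eq: "(LINT t:{0..T}|lborel. (\<beta> t - \<epsilon> * f t - \<epsilon>\<^sup>2 * g t - r \<epsilon> t)\<^sup>2) =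
        (LINT t:{0..T}|lborel. (\<beta> t)\<^sup>2) + \<epsilon> * (LINT t:{0..T}|lborel. - 2 * \<beta> t * f t) +
        \<epsilon>\<^sup>2 * (LINT t:{0..T}|lborel. (f t)\<^sup>2 - 2 * \<beta> t * g t) + (LINT t:{0..T}|lborel. s t)"
      using int by (simp only: set_integral_add set_integral_mult_right)
    have e1: "\<bar>\<epsilon>\<bar> \<le> 1" using \<epsilon> e by simp
    have "\<bar>s t\<bar> \<le> M * \<bar>\<epsilon>\<bar> ^ 3" if t: "t \<in> {0..T}" for t
    proof -
      let ?z = "\<bar>\<epsilon>\<bar> ^ 3"
      have z: "0 \<le> ?z" "?z \<le> 1" using e1 by (auto simp: power_le_one)
      have t1: "\<bar>\<epsilon> ^ 3 * (2 * f t * g t)\<bar> \<le> ?z * (2 * F * G)"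
        unfolding abs_mult power_abs using F B G t by (intro mult_mono) auto
      have "\<bar>\<epsilon>\<bar> ^ 4 \<le> ?z" using e1 by (intro power_decreasing) auto
      then have t2: "\<bar>\<epsilon> ^ 4 * (g t)\<^sup>2\<bar> \<le> ?z * G\<^sup>2"
        unfolding abs_mult power_abs using G t by (intro mult_mono power_mono) auto
      have "K * ?z \<le> \<bar>K\<bar> * ?z" using z by (intro mult_right_mono) auto
      then have rt: "\<bar>r \<epsilon> t\<bar> \<le> \<bar>K\<bar> * ?z" using K[OF \<epsilon> t] by linarith
      also have "\<dots> \<le> \<bar>K\<bar> * 1" using z by (intro mult_left_mono) auto
      finally have rt1: "\<bar>r \<epsilon> t\<bar> \<le> \<bar>K\<bar>" by simp
      have "\<bar>\<epsilon> * f t\<bar> \<le> 1 * F" unfolding abs_mult using e1 F t by (intro mult_mono) auto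
      moreover have "\<bar>\<epsilon>\<^sup>2 * g t\<bar> \<le> 1 * G"
        unfolding abs_mult power_abs using e1 G t by (intro mult_mono power_le_one) auto
      ultimately have "\<bar>- 2 * \<beta> t + 2 * \<epsilon> * f t + 2 * \<epsilon>\<^sup>2 * g t + r \<epsilon> t\<bar> \<le> 2 * B + 2 * F + 2 * G + \<bar>K\<bar>"
        using B(2)[OF t] rt1 by (simp only: mult.assoc)
      then have t3: "\<bar>r \<epsilon> t * (- 2 * \<beta> t + 2 * \<epsilon> * f t + 2 * \<epsilon>\<^sup>2 * g t + r \<epsilon> t)\<bar> \<le> (\<bar>K\<bar> * ?z) * (2 * B + 2 * F + 2 * G + \<bar>K\<bar>)"
        unfolding abs_mult[of "r \<epsilon> t"] using rt B F G by (intro mult_mono) auto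
      have "\<bar>s t\<bar> \<le> ?z * (2 * F * G) + ?z * G\<^sup>2 + (\<bar>K\<bar> * ?z) * (2 * B + 2 * F + 2 * G + \<bar>K\<bar>)"
        unfolding s_def using t1 t2 t3 by linarith
      also have "\<dots> = M * ?z" by (simp add: M_def algebra_simps)
      finally show ?thesis .
    qed
    then have "\<bar>LINT t:{0..T}|lborel. s t\<bar> \<le> T * (M * \<bar>\<epsilon>\<bar> ^ 3)" by (rule set_integral_abs_le_const[OF scont])
    then show "?err \<epsilon> \<le> T * M * \<bar>\<epsilon>\<bar> ^ 3"
      unfolding eq by (simp add: mult.assoc)
  qed
qed

end

section \<open>From the sign of a quadratic coefficient to the absence of extrema\<close>

lemma quadratic_coefficient_neg:
  fixes E :: "real \<Rightarrow> real"
  assumes exp: "\<And>\<epsilon>. \<bar>\<epsilon>\<bar> < e \<Longrightarrow> \<bar>E \<epsilon> - (E0 + \<epsilon> * A + \<epsilon>\<^sup>2 * Q)\<bar> \<le> C * \<bar>\<epsilon>\<bar> ^ 3"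
    and e: "e > 0" and Q: "Q < 0" and d: "d > 0"
  obtains \<epsilon> where "\<bar>\<epsilon>\<bar> < d" "E \<epsilon> < E0"
proof -
  \<comment> \<open>For z < w the cubic error C z^3 is smaller than - Q z^2. The summand 1 keeps the
    denominator positive.\<close>
  define w where "w = - Q / (\<bar>C\<bar> + 1)"
  define z where "z = min (min e d) w / 2"
  have "w > 0" using Q unfolding w_def by (simp add: divide_neg_pos add_pos_nonneg)
  then have z: "0 < z" "z < e" "z < d" "z < w"
    using e d unfolding z_def by linarith+
  have "\<bar>C\<bar> + 1 > 0" by linarith
  from z(4) have zC: "z * (\<bar>C\<bar> + 1) < - Q" unfolding w_def pos_less_divide_eq[OF \<open>\<bar>C\<bar> + 1 > 0\<close>] .
  \<comment> \<open>The sign is chosen so that the linear term does not increase the value; no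
    information on \<open>A\<close> is needed.\<close>
  define \<epsilon> where "\<epsilon> = (if A \<le> 0 then z else - z)"
  have \<epsilon>: "\<bar>\<epsilon>\<bar> = z" "\<epsilon> * A \<le> 0" "\<epsilon>\<^sup>2 = z\<^sup>2"
    using z by (auto simp: \<epsilon>_def mult_nonneg_nonpos)
  have "C * z \<le> \<bar>C\<bar> * z" using z(1) by (intro mult_right_mono) auto
  also have "\<dots> < - Q" using zC z(1) by (simp add: algebra_simps)
  finally have "z\<^sup>2 * (Q + C * z) < 0" using z(1) by (intro mult_pos_neg) auto
  then have "z\<^sup>2 * Q + C * z ^ 3 < 0" by (simp add: algebra_simps power2_eq_square power3_eq_cube)
  moreover have "\<bar>E \<epsilon> - (E0 + \<epsilon> * A + z\<^sup>2 * Q)\<bar> \<le> C * z ^ 3" using exp[of \<epsilon>] z \<epsilon> by simp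
  ultimately have "E \<epsilon> < E0" using \<epsilon>(2) by linarith
  then show ?thesis using \<epsilon>(1) z(3) by (intro that[of \<epsilon>]) auto
qed

lemma quadratic_coefficient_pos:
  fixes E :: "real \<Rightarrow> real"
  assumes exp: "\<And>\<epsilon>. \<bar>\<epsilon>\<bar> < e \<Longrightarrow> \<bar>E \<epsilon> - (E0 + \<epsilon> * A + \<epsilon>\<^sup>2 * Q)\<bar> \<le> C * \<bar>\<epsilon>\<bar> ^ 3"
    and e: "e > 0" and Q: "Q > 0" and d: "d > 0"
  obtains \<epsilon> where "\<bar>\<epsilon>\<bar> < d" "E0 < E \<epsilon>"
proof -
  have "\<bar>(- E \<epsilon>) - (- E0 + \<epsilon> * (- A) + \<epsilon>\<^sup>2 * (- Q))\<bar> \<le> C * \<bar>\<epsilon>\<bar> ^ 3" if "\<bar>\<epsilon>\<bar> < e" for \<epsilon>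
    using exp[OF that] by (simp add: abs_le_iff)
  from quadratic_coefficient_neg[where E="\<lambda>\<epsilon>. - E \<epsilon>", OF this e _ d] Q that show ?thesis by force
qed

text \<open>Each \<open>w\<close> provides a curve \<open>c w\<close> through \<open>p\<close> that
  enters every neighbourhood and has the expansion with quadratic coefficient \<open>Q w\<close>.
  The range \<open>d\<close> and the constants \<open>A\<close> and \<open>C\<close> may depend on
  the neighbourhood. Both energies are treated by this lemma.\<close>

lemma indefinite_not_local_extremum:
  fixes F :: "'p \<Rightarrow> real" and c :: "'v \<Rightarrow> real \<Rightarrow> 'p" and Q :: "'v \<Rightarrow> real"
  assumes curve: "\<And>w U. w \<in> V \<Longrightarrow> openin X U \<Longrightarrow> p \<in> U \<Longrightarrow>
      \<exists>d A C. d > 0 \<and> (\<forall>\<epsilon>. \<bar>\<epsilon>\<bar> < d \<longrightarrow> c w \<epsilon> \<in> U \<and>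
        \<bar>F (c w \<epsilon>) - (F p + \<epsilon> * A + \<epsilon>\<^sup>2 * Q w)\<bar> \<le> C * \<bar>\<epsilon>\<bar> ^ 3)"
    and neg: "\<exists>w\<in>V. Q w < 0" and pos: "\<exists>w\<in>V. Q w > 0"
  shows "\<not> local_extremum_on X F p"
proof -
  have "\<exists>y\<in>U. F y < F p" if U: "openin X U" "p \<in> U" for U
  proof -
    obtain w where w: "w \<in> V" "Q w < 0" using neg by blast
    obtain d A C where d: "d > 0" and c: "\<forall>\<epsilon>. \<bar>\<epsilon>\<bar> < d \<longrightarrow> c w \<epsilon> \<in> U \<and>
        \<bar>F (c w \<epsilon>) - (F p + \<epsilon> * A + \<epsilon>\<^sup>2 * Q w)\<bar> \<le> C * \<bar>\<epsilon>\<bar> ^ 3"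
      using curve[OF w(1) U] by blast
    obtain \<epsilon> where "\<bar>\<epsilon>\<bar> < d" "F (c w \<epsilon>) < F p"
      using quadratic_coefficient_neg[of d "\<lambda>\<epsilon>. F (c w \<epsilon>)", OF _ d w(2) d] c by metis
    with c show ?thesis by blast
  qed
  moreover have "\<exists>y\<in>U. F p < F y" if U: "openin X U" "p \<in> U" for U
  proof -
    obtain w where w: "w \<in> V" "Q w > 0" using pos by blast
    obtain d A C where d: "d > 0" and c: "\<forall>\<epsilon>. \<bar>\<epsilon>\<bar> < d \<longrightarrow> c w \<epsilon> \<in> U \<and>
        \<bar>F (c w \<epsilon>) - (F p + \<epsilon> * A + \<epsilon>\<^sup>2 * Q w)\<bar> \<le> C * \<bar>\<epsilon>\<bar> ^ 3"
      using curve[OF w(1) U] by blast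
    obtain \<epsilon> where "\<bar>\<epsilon>\<bar> < d" "F p < F (c w \<epsilon>)"
      using quadratic_coefficient_pos[of d "\<lambda>\<epsilon>. F (c w \<epsilon>)", OF _ d w(2) d] c by metis
    with c show ?thesis by blast
  qed
  ultimately show ?thesis
    unfolding local_extremum_on_def local_minimum_on_def local_maximum_on_def by (meson not_less)
qed

section \<open>Expansion of the energies along a variation\<close>

lemma inverse_square_expansion:
  fixes q r \<epsilon> :: real
  assumes "q \<noteq> 0" "q + \<epsilon> * r \<noteq> 0"
  shows "1 / (q + \<epsilon> * r)\<^sup>2 = (1 / q) ^ 2 - 2 * \<epsilon> * r * (1 / q) ^ 3 + 3 * \<epsilon>\<^sup>2 * r\<^sup>2 * (1 / q) ^ 4
    + \<epsilon> ^ 3 * (- (r ^ 3) * (4 * q + 3 * \<epsilon> * r) * (1 / q) ^ 4 * (1 / (q + \<epsilon> * r)) ^ 2)"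
proof -
  let ?w = "q + \<epsilon> * r"
  \<comment> \<open>The second order Taylor polynomial of (1 + y)^(-2) is 1 - 2 y + 3 y^2, and (1 +
    y)^2 (1 - 2 y + 3 y^2) = 1 + 4 y^3 + 3 y^4. With y = \<epsilon> r / q and after multiplication
    by q^4 this is the stated identity, which makes the remainder explicit.\<close>
  have id: "q ^ 4 = ?w\<^sup>2 * (q\<^sup>2 - 2 * \<epsilon> * r * q + 3 * \<epsilon>\<^sup>2 * r\<^sup>2) - \<epsilon> ^ 3 * r ^ 3 * (4 * q + 3 * \<epsilon> * r)"
    by algebra
  have "1 / ?w\<^sup>2 = q ^ 4 * (1 / q) ^ 4 * (1 / ?w) ^ 2" using assms by (simp add: power_divide)
  also have "\<dots> = (?w\<^sup>2 * (1 / ?w)\<^sup>2) * (q\<^sup>2 - 2 * \<epsilon> * r * q + 3 * \<epsilon>\<^sup>2 * r\<^sup>2) * (1 / q) ^ 4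
      - \<epsilon> ^ 3 * r ^ 3 * (4 * q + 3 * \<epsilon> * r) * (1 / q) ^ 4 * (1 / ?w)\<^sup>2"
    unfolding id by (simp add: algebra_simps)
  also have "?w\<^sup>2 * (1 / ?w)\<^sup>2 = 1" using assms by (simp add: power_divide)
  also have "1 * (q\<^sup>2 - 2 * \<epsilon> * r * q + 3 * \<epsilon>\<^sup>2 * r\<^sup>2) * (1 / q) ^ 4 =
      (1 / q) ^ 2 - 2 * \<epsilon> * r * (1 / q) ^ 3 + 3 * \<epsilon>\<^sup>2 * r\<^sup>2 * (1 / q) ^ 4"
    using assms(1) by (simp add: field_simps power2_eq_square power3_eq_cube power4_eq_xxxx)
  finally show ?thesis by simp
qed

context diff_path
begin

lemma bcont_\<phi>_x: "bcont \<phi>_x"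
  by (metis \<phi>_x_bounded bcontI cont_path(2))

lemma bcont_inverse_\<phi>_x: "bcont (\<lambda>t x. 1 / \<phi>_x t x)"
proof -
  obtain m where m: "m > 0" "\<And>t x. t \<in> {0..T} \<Longrightarrow> m \<le> \<phi>_x t x" using \<phi>_x_lower_bound by metis
  have "\<bar>1 / \<phi>_x t x\<bar> \<le> 1 / m" if "t \<in> {0..T}" for t x
    using m(1) m(2)[OF that, of x] by (simp add: frac_le)
  moreover have "cont_strip (\<lambda>t x. 1 / \<phi>_x t x)"
    by (intro cont_intros) (metis \<phi>_x_pos less_irrefl)
  ultimately show ?thesis by (intro bcontI)
qed

lemma decays_kinetic: "decays (\<lambda>t x. (\<phi>_t t x)\<^sup>2 * \<phi>_x t x)"
  using decays_mult[OF decays_\<phi>_t bcont_mult[OF decays_bcont[OF decays_\<phi>_t] bcont_\<phi>_x]]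
  by (simp add: power2_eq_square mult.assoc)

lemma diff_energy_eq: "diff_energy T \<phi> = strip_integral (\<lambda>t x. (\<phi>_t t x)\<^sup>2 * \<phi>_x t x)"
  by (simp add: diff_energy_def strip_integral_def)

text \<open>The \<open>drift\<close> is the inner integral in the energy on the Virasoro-Bott group; \<open>drift1\<close> and \<open>drift2\<close>
  below are the integrands of its first and second order coefficients.\<close>

definition drift :: "real \<Rightarrow> real" where
  "drift t = (LINT x|lborel. \<phi>_tx t x * \<phi>_xx t x / (\<phi>_x t x)\<^sup>2)"

lemma decays_drift: "decays (\<lambda>t x. \<phi>_tx t x * \<phi>_xx t x / (\<phi>_x t x)\<^sup>2)"
  using decays_mult[OF decays_\<phi>_tx bcont_mult[OF decays_bcont[OF decays_\<phi>_xx] bcont_power[OF bcont_inverse_\<phi>_x, of 2]]]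
  by (simp add: power_divide)

lemma continuous_drift: "continuous_on {0..T} drift"
  unfolding drift_def by (rule decays_continuous_integral[OF decays_drift])

lemma vb_energy_eq:
  "vb_energy T (\<phi>, \<alpha>) = diff_energy T \<phi> + (LINT t:{0..T}|lborel. (deriv_I T \<alpha> t - drift t)\<^sup>2)"
  by (simp add: vb_energy_def diff_energy_def drift_def)

end

locale variation = diff_path +
  fixes h :: "real \<Rightarrow> real \<Rightarrow> real"
  assumes variation: "h \<in> schwartz_strip T"
begin

abbreviation "h_t \<equiv> D_t T h"
abbreviation "h_x \<equiv> D_x h"
abbreviation "h_tx \<equiv> D_x (D_t T h)"
abbreviation "h_xx \<equiv> D_x (D_x h)"

lemma decays_variation: "decays h_t" "decays h_x" "decays h_tx" "decays h_xx"
  using schwartz_strip_decays[OF variation, of 0 1] schwartz_strip_decays[OF variation, of 1 0]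
    schwartz_strip_decays[OF variation, of 1 1] schwartz_strip_decays[OF variation, of 2 0]
  by (simp_all add: numeral_2_eq_2)

lemmas bcont_all = bcont_\<phi>_x bcont_inverse_\<phi>_x decays_bcont[OF decays_\<phi>_t] decays_bcont[OF decays_\<phi>_tx]
  decays_bcont[OF decays_\<phi>_xx] decays_variation[THEN decays_bcont] bcont_intros

definition perturbed :: "real \<Rightarrow> real \<Rightarrow> real \<Rightarrow> real" where
  "perturbed \<epsilon> = (\<lambda>t x. \<phi> t x + \<epsilon> * h t x)"

lemma smooth_variation: "smooth_strip T h"
  by (rule schwartz_strip_smooth[OF variation])

lemma
  assumes t: "t \<in> {0..T}"
  shows D_t_perturbed: "D_t T (perturbed \<epsilon>) t x = \<phi>_t t x + \<epsilon> * h_t t x"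
    and D_x_perturbed: "D_x (perturbed \<epsilon>) t x = \<phi>_x t x + \<epsilon> * h_x t x"
    and D_tx_perturbed: "D_x (D_t T (perturbed \<epsilon>)) t x = \<phi>_tx t x + \<epsilon> * h_tx t x"
    and D_xx_perturbed: "D_x (D_x (perturbed \<epsilon>)) t x = \<phi>_xx t x + \<epsilon> * h_xx t x"
proof -
  note lin = funpow_D_lin[OF smooth_path smooth_variation t]
  show "D_t T (perturbed \<epsilon>) t x = \<phi>_t t x + \<epsilon> * h_t t x"
    "D_x (perturbed \<epsilon>) t x = \<phi>_x t x + \<epsilon> * h_x t x"
    "D_x (D_t T (perturbed \<epsilon>)) t x = \<phi>_tx t x + \<epsilon> * h_tx t x"
    "D_x (D_x (perturbed \<epsilon>)) t x = \<phi>_xx t x + \<epsilon> * h_xx t x"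
    unfolding perturbed_def using lin[of 0 1 \<epsilon>] lin[of 1 0 \<epsilon>] lin[of 1 1 \<epsilon>] lin[of 2 0 \<epsilon>]
    by (simp_all add: numeral_2_eq_2)
qed

text \<open>The summands are arranged, as in \<open>drift1\<close> and \<open>drift2\<close> below,
  with a decaying derivative of \<open>h\<close> in front of a bounded factor, the pattern of
  \<open>decays_mult\<close>.\<close>

definition kinetic_form :: "real \<Rightarrow> real \<Rightarrow> real" where
  "kinetic_form t x = h_t t x * (\<phi>_x t x * h_t t x + 2 * \<phi>_t t x * h_x t x)"

text \<open>The integrand is a cubic polynomial in \<epsilon>, so the expansion is exact. The first
  order coefficient is not examined further, because the choice of the sign of \<epsilon> takes care
  of it.\<close>

lemma diff_energy_expansion:
  assumes "perturbed \<epsilon> \<in> diff_paths T"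
  shows "diff_energy T (perturbed \<epsilon>) = diff_energy T \<phi>
    + \<epsilon> * strip_integral (\<lambda>t x. h_t t x * (2 * \<phi>_t t x * \<phi>_x t x) + h_x t x * (\<phi>_t t x)\<^sup>2)
    + \<epsilon>\<^sup>2 * strip_integral kinetic_form + \<epsilon> ^ 3 * strip_integral (\<lambda>t x. h_t t x * (h_t t x * h_x t x))"
proof -
  interpret pert: diff_path T "perturbed \<epsilon>" by unfold_locales (rule assms)
  define K where "K = (\<lambda>t x. (\<phi>_t t x)\<^sup>2 * \<phi>_x t x)"
  define A where "A = (\<lambda>t x. h_t t x * (2 * \<phi>_t t x * \<phi>_x t x) + h_x t x * (\<phi>_t t x)\<^sup>2)"
  define C where "C = (\<lambda>t x. h_t t x * (h_t t x * h_x t x))"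
  have dec: "decays K" "decays A" "decays kinetic_form" "decays C"
    unfolding K_def A_def C_def kinetic_form_def
    by (intro decays_kinetic decays_add decays_mult decays_variation bcont_all)+
  have "diff_energy T (perturbed \<epsilon>) =
      strip_integral (\<lambda>t x. K t x + \<epsilon> * A t x + \<epsilon>\<^sup>2 * kinetic_form t x + \<epsilon> ^ 3 * C t x)"
    unfolding pert.diff_energy_eq
    by (rule strip_integral_cong)
      (simp add: D_t_perturbed D_x_perturbed K_def A_def kinetic_form_def C_def, algebra)
  also have "\<dots> = strip_integral K + \<epsilon> * strip_integral A + \<epsilon>\<^sup>2 * strip_integral kinetic_form + \<epsilon> ^ 3 * strip_integral C"
    by (simp add: strip_integral_add strip_integral_cmult decays_add decays_cmult dec)
  finally show ?thesis by (simp add: diff_energy_eq K_def A_def C_def)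
qed

definition drift1 :: "real \<Rightarrow> real \<Rightarrow> real" where
  "drift1 t x = h_tx t x * (\<phi>_xx t x * (1 / \<phi>_x t x)\<^sup>2) + h_xx t x * (\<phi>_tx t x * (1 / \<phi>_x t x)\<^sup>2)
    + h_x t x * (- 2 * \<phi>_tx t x * \<phi>_xx t x * (1 / \<phi>_x t x) ^ 3)"

definition drift2 :: "real \<Rightarrow> real \<Rightarrow> real" where
  "drift2 t x = h_tx t x * (h_xx t x * (1 / \<phi>_x t x)\<^sup>2)
    + h_x t x * (- 2 * (h_tx t x * \<phi>_xx t x + \<phi>_tx t x * h_xx t x) * (1 / \<phi>_x t x) ^ 3)
    + h_x t x * (3 * \<phi>_tx t x * \<phi>_xx t x * h_x t x * (1 / \<phi>_x t x) ^ 4)"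

lemma decays_drift12: "decays drift1" "decays drift2"
  unfolding drift1_def drift2_def
  by (intro decays_add decays_mult decays_variation bcont_all)+

text \<open>The letters stand for values at one point: \<open>a\<close>, \<open>b\<close>,
  \<open>q\<close> for \<phi>_tx, \<phi>_xx, \<phi>_x, and \<open>a1\<close>, \<open>b1\<close>,
  \<open>r\<close> for the same derivatives of the variation.\<close>

lemma drift_expansion_pointwise:
  fixes q r a b a1 b1 \<epsilon> :: real
  assumes q: "q \<noteq> 0" "q + \<epsilon> * r \<noteq> 0"
  defines "v \<equiv> 1 / q"
  defines "\<rho> \<equiv> - (r ^ 3) * (4 * q + 3 * \<epsilon> * r) * v ^ 4 * (1 / (q + \<epsilon> * r)) ^ 2"
  shows "(a + \<epsilon> * a1) * (b + \<epsilon> * b1) / (q + \<epsilon> * r)\<^sup>2 =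
    a * b / q\<^sup>2 + \<epsilon> * (a1 * (b * v\<^sup>2) + b1 * (a * v\<^sup>2) + r * (- 2 * a * b * v ^ 3))
    + \<epsilon>\<^sup>2 * (a1 * (b1 * v\<^sup>2) + r * (- 2 * (a1 * b + a * b1) * v ^ 3) + r * (3 * a * b * r * v ^ 4))
    + \<epsilon> ^ 3 * (a * b * \<rho> + (a1 * b + a * b1) * (3 * r\<^sup>2 * v ^ 4 + \<epsilon> * \<rho>)
        + a1 * b1 * (- 2 * r * v ^ 3 + 3 * \<epsilon> * r\<^sup>2 * v ^ 4 + \<epsilon>\<^sup>2 * \<rho>))"
proof -
  have "(a + \<epsilon> * a1) * (b + \<epsilon> * b1) / (q + \<epsilon> * r)\<^sup>2 = (a + \<epsilon> * a1) * (b + \<epsilon> * b1) * (1 / (q + \<epsilon> * r)\<^sup>2)" by simp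
  also have "1 / (q + \<epsilon> * r)\<^sup>2 = v\<^sup>2 - 2 * \<epsilon> * r * v ^ 3 + 3 * \<epsilon>\<^sup>2 * r\<^sup>2 * v ^ 4 + \<epsilon> ^ 3 * \<rho>"
    unfolding v_def \<rho>_def by (rule inverse_square_expansion[OF q])
  finally have "(a + \<epsilon> * a1) * (b + \<epsilon> * b1) / (q + \<epsilon> * r)\<^sup>2 =
    (a + \<epsilon> * a1) * (b + \<epsilon> * b1) * (v\<^sup>2 - 2 * \<epsilon> * r * v ^ 3 + 3 * \<epsilon>\<^sup>2 * r\<^sup>2 * v ^ 4 + \<epsilon> ^ 3 * \<rho>)" .
  moreover have "a * b / q\<^sup>2 = a * b * v\<^sup>2" by (simp add: v_def power_divide)
  ultimately show ?thesis by algebra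
qed

text \<open>A majorant, uniform for small \<open>\<epsilon>\<close>, of the coefficient of \<open>\<epsilon>\<^sup>3\<close> in the expansion above.\<close>

definition drift_remainder :: "real \<Rightarrow> real \<Rightarrow> real \<Rightarrow> real" where
  "drift_remainder m t x =
    (let v = 1 / \<phi>_x t x; R = (\<bar>h_x t x\<bar> ^ 3 * (4 * \<bar>\<phi>_x t x\<bar> + 3 * \<bar>h_x t x\<bar>)) * \<bar>v\<bar> ^ 4 * (2 / m)\<^sup>2 in
      \<bar>\<phi>_tx t x\<bar> * (\<bar>\<phi>_xx t x\<bar> * R)
      + \<bar>h_tx t x\<bar> * (\<bar>\<phi>_xx t x\<bar> * (3 * \<bar>h_x t x\<bar>\<^sup>2 * \<bar>v\<bar> ^ 4 + R))
      + \<bar>h_xx t x\<bar> * (\<bar>\<phi>_tx t x\<bar> * (3 * \<bar>h_x t x\<bar>\<^sup>2 * \<bar>v\<bar> ^ 4 + R))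
      + \<bar>h_tx t x\<bar> * (\<bar>h_xx t x\<bar> * (2 * \<bar>h_x t x\<bar> * \<bar>v\<bar> ^ 3 + 3 * \<bar>h_x t x\<bar>\<^sup>2 * \<bar>v\<bar> ^ 4 + R)))"

lemma decays_drift_remainder: "decays (drift_remainder m)"
  unfolding drift_remainder_def Let_def
  by (intro decays_add decays_mult[OF decays_abs] decays_variation decays_\<phi>_tx bcont_all)

text \<open>The letters are those of \<open>drift_expansion_pointwise\<close>, with \<open>w\<close>
  standing for 1 / (q + \<epsilon> r). That is the only place where \<epsilon> enters a denominator,
  hence the separate bound \<open>W\<close>; elsewhere |\<epsilon>| \<le> 1 suffices.\<close>

lemma drift_remainder_bound:
  fixes q r a b a1 b1 \<epsilon> v W R :: real
  assumes \<epsilon>: "\<bar>\<epsilon>\<bar> \<le> 1" and w: "\<bar>w\<bar> \<le> W"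
  defines "\<rho> \<equiv> - (r ^ 3) * (4 * q + 3 * \<epsilon> * r) * v ^ 4 * w ^ 2"
    and "R \<equiv> (\<bar>r\<bar> ^ 3 * (4 * \<bar>q\<bar> + 3 * \<bar>r\<bar>)) * \<bar>v\<bar> ^ 4 * W\<^sup>2"
  shows "\<bar>a * b * \<rho> + (a1 * b + a * b1) * (3 * r\<^sup>2 * v ^ 4 + \<epsilon> * \<rho>)
        + a1 * b1 * (- 2 * r * v ^ 3 + 3 * \<epsilon> * r\<^sup>2 * v ^ 4 + \<epsilon>\<^sup>2 * \<rho>)\<bar>
    \<le> \<bar>a\<bar> * (\<bar>b\<bar> * R) + \<bar>a1\<bar> * (\<bar>b\<bar> * (3 * \<bar>r\<bar>\<^sup>2 * \<bar>v\<bar> ^ 4 + R)) + \<bar>b1\<bar> * (\<bar>a\<bar> * (3 * \<bar>r\<bar>\<^sup>2 * \<bar>v\<bar> ^ 4 + R))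
      + \<bar>a1\<bar> * (\<bar>b1\<bar> * (2 * \<bar>r\<bar> * \<bar>v\<bar> ^ 3 + 3 * \<bar>r\<bar>\<^sup>2 * \<bar>v\<bar> ^ 4 + R))"
proof -
  have small: "\<bar>c * y\<bar> \<le> \<bar>y\<bar>" if "\<bar>c\<bar> \<le> 1" for c y :: real
    using mult_right_mono[OF that, of "\<bar>y\<bar>"] by (simp add: abs_mult)
  have \<epsilon>2: "\<bar>\<epsilon>\<^sup>2\<bar> \<le> 1" using \<epsilon> by (simp add: abs_square_le_1)
  have "\<bar>4 * q + 3 * \<epsilon> * r\<bar> \<le> 4 * \<bar>q\<bar> + 3 * \<bar>r\<bar>"
    using small[OF \<epsilon>, of r] by (simp only: mult.assoc)
  moreover have "\<bar>w\<bar> \<le> \<bar>W\<bar>" using w by linarith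
  then have "w\<^sup>2 \<le> W\<^sup>2" by (simp only: abs_le_square_iff)
  ultimately have \<rho>: "\<bar>\<rho>\<bar> \<le> R"
    unfolding \<rho>_def R_def abs_mult power_abs abs_minus_cancel
    by (intro mult_mono) (auto intro!: mult_nonneg_nonneg)
  let ?s = "3 * \<bar>r\<bar>\<^sup>2 * \<bar>v\<bar> ^ 4"
  have s: "\<bar>3 * r\<^sup>2 * v ^ 4\<bar> = ?s" by (simp add: abs_mult power_abs)
  have u: "\<bar>2 * r * v ^ 3\<bar> = 2 * \<bar>r\<bar> * \<bar>v\<bar> ^ 3" by (simp add: abs_mult power_abs)
  have b1: "\<bar>3 * r\<^sup>2 * v ^ 4 + \<epsilon> * \<rho>\<bar> \<le> ?s + R"
    using s small[OF \<epsilon>, of \<rho>] \<rho> by linarith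
  have b2: "\<bar>- 2 * r * v ^ 3 + 3 * \<epsilon> * r\<^sup>2 * v ^ 4 + \<epsilon>\<^sup>2 * \<rho>\<bar> \<le> 2 * \<bar>r\<bar> * \<bar>v\<bar> ^ 3 + ?s + R"
  proof -
    have "- 2 * r * v ^ 3 + 3 * \<epsilon> * r\<^sup>2 * v ^ 4 + \<epsilon>\<^sup>2 * \<rho> = - (2 * r * v ^ 3) + \<epsilon> * (3 * r\<^sup>2 * v ^ 4) + \<epsilon>\<^sup>2 * \<rho>"
      by (simp add: algebra_simps)
    then show ?thesis
      using s u small[OF \<epsilon>, of "3 * r\<^sup>2 * v ^ 4"] small[OF \<epsilon>2, of \<rho>] \<rho> by linarith
  qed
  have s1: "\<bar>a * b * \<rho>\<bar> \<le> \<bar>a\<bar> * (\<bar>b\<bar> * R)"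
    unfolding abs_mult mult.assoc by (intro mult_left_mono \<rho>) auto
  have s2: "\<bar>(a1 * b) * (3 * r\<^sup>2 * v ^ 4 + \<epsilon> * \<rho>)\<bar> \<le> \<bar>a1\<bar> * (\<bar>b\<bar> * (?s + R))"
    unfolding abs_mult[of "a1 * b"] abs_mult[of a1 b] mult.assoc[of "\<bar>a1\<bar>"] by (intro mult_left_mono b1) auto
  have s3: "\<bar>(b1 * a) * (3 * r\<^sup>2 * v ^ 4 + \<epsilon> * \<rho>)\<bar> \<le> \<bar>b1\<bar> * (\<bar>a\<bar> * (?s + R))"
    unfolding abs_mult[of "b1 * a"] abs_mult[of b1 a] mult.assoc[of "\<bar>b1\<bar>"] by (intro mult_left_mono b1) auto
  have s4: "\<bar>(a1 * b1) * (- 2 * r * v ^ 3 + 3 * \<epsilon> * r\<^sup>2 * v ^ 4 + \<epsilon>\<^sup>2 * \<rho>)\<bar>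
      \<le> \<bar>a1\<bar> * (\<bar>b1\<bar> * (2 * \<bar>r\<bar> * \<bar>v\<bar> ^ 3 + ?s + R))"
    unfolding abs_mult[of "a1 * b1"] abs_mult[of a1 b1] mult.assoc[of "\<bar>a1\<bar>"] by (intro mult_left_mono b2) auto
  have abs_sum_le: "\<bar>x + u + w\<bar> \<le> X + Y + Z + W"
    if "\<bar>x\<bar> \<le> X" "\<bar>y\<bar> \<le> Y" "\<bar>z\<bar> \<le> Z" "\<bar>w\<bar> \<le> W" "u = y + z" for x y z u w X Y Z W :: real
    using that by linarith
  have s5: "(a1 * b + a * b1) * (3 * r\<^sup>2 * v ^ 4 + \<epsilon> * \<rho>) =
      (a1 * b) * (3 * r\<^sup>2 * v ^ 4 + \<epsilon> * \<rho>) + (b1 * a) * (3 * r\<^sup>2 * v ^ 4 + \<epsilon> * \<rho>)" by (simp add: algebra_simps)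
  show ?thesis by (rule abs_sum_le[OF s1 s2 s3 s4 s5])
qed

text \<open>The error must be uniform in time, since it is later squared and integrated over [0,T].
  It is, because the space integral of the majorant \<open>drift_remainder\<close> is continuous in
  time and therefore bounded.\<close>

lemma drift_expansion:
  obtains e K where "0 < e" "e \<le> 1"
    "\<And>\<epsilon>. \<bar>\<epsilon>\<bar> < e \<Longrightarrow> perturbed \<epsilon> \<in> diff_paths T"
    "\<And>\<epsilon> t. \<bar>\<epsilon>\<bar> < e \<Longrightarrow> t \<in> {0..T} \<Longrightarrow>
      \<bar>diff_path.drift T (perturbed \<epsilon>) t -
        (drift t + \<epsilon> * (LINT x|lborel. drift1 t x) + \<epsilon>\<^sup>2 * (LINT x|lborel. drift2 t x))\<bar> \<le> K * \<bar>\<epsilon>\<bar> ^ 3"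
proof -
  obtain e1 where e1: "e1 > 0" "\<And>\<epsilon>. \<bar>\<epsilon>\<bar> < e1 \<Longrightarrow> perturbed \<epsilon> \<in> diff_paths T"
    unfolding perturbed_def using perturbed_path[OF variation] by metis
  obtain m where m: "m > 0" "\<And>t x. t \<in> {0..T} \<Longrightarrow> m \<le> \<phi>_x t x" using \<phi>_x_lower_bound by metis
  obtain H where H: "H > 0" "\<And>t x. t \<in> {0..T} \<Longrightarrow> \<bar>h_x t x\<bar> \<le> H"
    using decays_bounded[OF decays_variation(2)] by metis
  \<comment> \<open>With |\<epsilon>| < m / (2 H) the perturbed derivative stays above m / 2; this
    is the source of the factor 2 / m in \<open>drift_remainder\<close>.\<close>
  define e where "e = min (min e1 1) (m / (2 * H))"
  have "m / (2 * H) > 0" using m(1) H(1) by simp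
  then have e: "0 < e" "e \<le> 1" "e \<le> e1" "e \<le> m / (2 * H)" using e1(1) unfolding e_def by simp_all
  let ?G = "drift_remainder m"
  obtain K where K: "K \<ge> 0" "\<And>t. t \<in> {0..T} \<Longrightarrow> \<bar>LINT x|lborel. ?G t x\<bar> \<le> K"
    using continuous_bounded_time[OF decays_continuous_integral[OF decays_drift_remainder]] by metis
  have "\<bar>diff_path.drift T (perturbed \<epsilon>) t -
        (drift t + \<epsilon> * (LINT x|lborel. drift1 t x) + \<epsilon>\<^sup>2 * (LINT x|lborel. drift2 t x))\<bar> \<le> K * \<bar>\<epsilon>\<bar> ^ 3"
    if \<epsilon>: "\<bar>\<epsilon>\<bar> < e" and t: "t \<in> {0..T}" for \<epsilon> t
  proof -
    interpret pert: diff_path T "perturbed \<epsilon>" by unfold_locales (use e1(2) \<epsilon> e(3) in simp)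
    let ?P = "\<lambda>t x. D_x (D_t T (perturbed \<epsilon>)) t x * D_x (D_x (perturbed \<epsilon>)) t x / (D_x (perturbed \<epsilon>) t x)\<^sup>2"
    let ?X = "\<lambda>t x. \<phi>_tx t x * \<phi>_xx t x / (\<phi>_x t x)\<^sup>2"
    have int: "integrable lborel (?P t)" "integrable lborel (?X t)" "integrable lborel (drift1 t)"
      "integrable lborel (drift2 t)" "integrable lborel (?G t)"
      by (intro decays_integrable[OF _ t] pert.decays_drift decays_drift decays_drift12 decays_drift_remainder)+
    let ?Z = "\<lambda>x. ?P t x - (?X t x + \<epsilon> * drift1 t x + \<epsilon>\<^sup>2 * drift2 t x)"
    have "\<bar>?Z x\<bar> \<le> \<bar>\<epsilon>\<bar> ^ 3 * ?G t x" for x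
    proof -
      have "\<bar>\<epsilon>\<bar> * \<bar>h_x t x\<bar> \<le> (m / (2 * H)) * H"
        using \<epsilon> e(4) H(1) H(2)[OF t, of x] by (intro mult_mono) auto
      then have "\<bar>\<epsilon> * h_x t x\<bar> \<le> m / 2" using H(1) by (simp add: abs_mult)
      then have low: "m / 2 \<le> \<phi>_x t x + \<epsilon> * h_x t x" using m(2)[OF t, of x] by linarith
      then have nz: "\<phi>_x t x \<noteq> 0" "\<phi>_x t x + \<epsilon> * h_x t x \<noteq> 0" using m(1) \<phi>_x_pos[OF t, of x] by auto
      have "1 / (\<phi>_x t x + \<epsilon> * h_x t x) \<le> 1 / (m / 2)" using low m(1) by (intro divide_left_mono) auto
      then have w: "\<bar>1 / (\<phi>_x t x + \<epsilon> * h_x t x)\<bar> \<le> 2 / m" using low m(1) by simp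
      have \<epsilon>1: "\<bar>\<epsilon>\<bar> \<le> 1" using \<epsilon> e(2) by simp
      define \<rho> where "\<rho> = - (h_x t x ^ 3) * (4 * \<phi>_x t x + 3 * \<epsilon> * h_x t x) * (1 / \<phi>_x t x) ^ 4 * (1 / (\<phi>_x t x + \<epsilon> * h_x t x)) ^ 2"
      define y where "y = \<phi>_tx t x * \<phi>_xx t x * \<rho>
        + (h_tx t x * \<phi>_xx t x + \<phi>_tx t x * h_xx t x) * (3 * (h_x t x)\<^sup>2 * (1 / \<phi>_x t x) ^ 4 + \<epsilon> * \<rho>)
        + h_tx t x * h_xx t x * (- 2 * h_x t x * (1 / \<phi>_x t x) ^ 3 + 3 * \<epsilon> * (h_x t x)\<^sup>2 * (1 / \<phi>_x t x) ^ 4 + \<epsilon>\<^sup>2 * \<rho>)"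
      have "?Z x = \<epsilon> ^ 3 * y"
        unfolding D_tx_perturbed[OF t] D_xx_perturbed[OF t] D_x_perturbed[OF t]
          drift_expansion_pointwise[OF nz] drift1_def drift2_def y_def \<rho>_def by simp
      moreover have "\<bar>y\<bar> \<le> ?G t x"
        unfolding y_def \<rho>_def drift_remainder_def Let_def by (rule drift_remainder_bound[OF \<epsilon>1 w])
      ultimately show ?thesis by (simp add: abs_mult power_abs mult_left_mono)
    qed
    note Z = this
    have eq: "(LINT x|lborel. ?Z x) = pert.drift t - (drift t + \<epsilon> * (LINT x|lborel. drift1 t x) + \<epsilon>\<^sup>2 * (LINT x|lborel. drift2 t x))"
      using int by (simp add: drift_def pert.drift_def)
    have "\<bar>LINT x|lborel. ?Z x\<bar> \<le> (LINT x|lborel. \<bar>?Z x\<bar>)" by (rule integral_abs_bound)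
    also have "\<dots> \<le> (LINT x|lborel. \<bar>\<epsilon>\<bar> ^ 3 * ?G t x)"
      by (rule integral_mono) (use int Z in auto)
    also have "\<dots> \<le> \<bar>\<epsilon>\<bar> ^ 3 * K"
      using K(2)[OF t] by (simp add: mult_left_mono)
    finally show ?thesis unfolding eq by (simp add: mult.commute)
  qed
  with e e1(2) show ?thesis by (intro that[of e K]) auto
qed

text \<open>The coefficient of \<epsilon>^2, without a factor 2, when \<phi> moves in the direction
  \<open>h\<close> and \<alpha> is kept.\<close>

definition second_variation :: "(real \<Rightarrow> real) \<Rightarrow> real" where
  "second_variation \<alpha> = strip_integral kinetic_form +
    (LINT t:{0..T}|lborel. (LINT x|lborel. drift1 t x)\<^sup>2
      - 2 * (deriv_I T \<alpha> t - drift t) * (LINT x|lborel. drift2 t x))"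

lemma diff_energy_cubic:
  shows "\<exists>A C. \<forall>\<epsilon>. perturbed \<epsilon> \<in> diff_paths T \<longrightarrow>
    \<bar>diff_energy T (perturbed \<epsilon>) - (diff_energy T \<phi> + \<epsilon> * A + \<epsilon>\<^sup>2 * strip_integral kinetic_form)\<bar> \<le> C * \<bar>\<epsilon>\<bar> ^ 3"
proof (intro exI allI impI)
  fix \<epsilon> assume p: "perturbed \<epsilon> \<in> diff_paths T"
  show "\<bar>diff_energy T (perturbed \<epsilon>) - (diff_energy T \<phi>
      + \<epsilon> * strip_integral (\<lambda>t x. h_t t x * (2 * \<phi>_t t x * \<phi>_x t x) + h_x t x * (\<phi>_t t x)\<^sup>2)
      + \<epsilon>\<^sup>2 * strip_integral kinetic_form)\<bar>
    \<le> \<bar>strip_integral (\<lambda>t x. h_t t x * (h_t t x * h_x t x))\<bar> * \<bar>\<epsilon>\<bar> ^ 3"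
    unfolding diff_energy_expansion[OF p] by (simp add: abs_mult power_abs)
qed

lemma vb_energy_cubic:
  assumes \<alpha>: "continuous_on {0..T} (deriv_I T \<alpha>)"
  obtains e A C where "0 < e" "\<And>\<epsilon>. \<bar>\<epsilon>\<bar> < e \<Longrightarrow>
    \<bar>vb_energy T (perturbed \<epsilon>, \<alpha>) - (vb_energy T (\<phi>, \<alpha>) + \<epsilon> * A + \<epsilon>\<^sup>2 * second_variation \<alpha>)\<bar> \<le> C * \<bar>\<epsilon>\<bar> ^ 3"
proof -
  obtain e K where e: "0 < e" "e \<le> 1" "\<And>\<epsilon>. \<bar>\<epsilon>\<bar> < e \<Longrightarrow> perturbed \<epsilon> \<in> diff_paths T"
    and K: "\<And>\<epsilon> t. \<bar>\<epsilon>\<bar> < e \<Longrightarrow> t \<in> {0..T} \<Longrightarrow>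
      \<bar>diff_path.drift T (perturbed \<epsilon>) t -
        (drift t + \<epsilon> * (LINT x|lborel. drift1 t x) + \<epsilon>\<^sup>2 * (LINT x|lborel. drift2 t x))\<bar> \<le> K * \<bar>\<epsilon>\<bar> ^ 3"
    using drift_expansion by blast
  define \<beta> where "\<beta> t = deriv_I T \<alpha> t - drift t" for t
  define f where "f t = (LINT x|lborel. drift1 t x)" for t
  define g where "g t = (LINT x|lborel. drift2 t x)" for t
  define r where "r \<epsilon> t = diff_path.drift T (perturbed \<epsilon>) t - (drift t + \<epsilon> * f t + \<epsilon>\<^sup>2 * g t)" for \<epsilon> t
  have c: "continuous_on {0..T} \<beta>" "continuous_on {0..T} f" "continuous_on {0..T} g"
    unfolding \<beta>_def f_def g_def
    by (intro continuous_on_diff \<alpha> continuous_drift decays_continuous_integral decays_drift12)+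
  have rc: "continuous_on {0..T} (r \<epsilon>)" if "\<bar>\<epsilon>\<bar> < e" for \<epsilon>
  proof -
    interpret pert: diff_path T "perturbed \<epsilon>" by unfold_locales (rule e(3)[OF that])
    show ?thesis unfolding r_def
      by (intro continuous_intros pert.continuous_drift continuous_drift c)
  qed
  have rK: "\<bar>r \<epsilon> t\<bar> \<le> K * \<bar>\<epsilon>\<bar> ^ 3" if "\<bar>\<epsilon>\<bar> < e" "t \<in> {0..T}" for \<epsilon> t
    unfolding r_def f_def g_def by (rule K[OF that])
  from square_integral_expansion[OF c rc rK e(2)]
  obtain C1 where C1: "\<forall>\<epsilon>. \<bar>\<epsilon>\<bar> < e \<longrightarrow>
    \<bar>(LINT t:{0..T}|lborel. (\<beta> t - \<epsilon> * f t - \<epsilon>\<^sup>2 * g t - r \<epsilon> t)\<^sup>2) -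
      ((LINT t:{0..T}|lborel. (\<beta> t)\<^sup>2) + \<epsilon> * (LINT t:{0..T}|lborel. - 2 * \<beta> t * f t) +
       \<epsilon>\<^sup>2 * (LINT t:{0..T}|lborel. (f t)\<^sup>2 - 2 * \<beta> t * g t))\<bar> \<le> C1 * \<bar>\<epsilon>\<bar> ^ 3" ..
  obtain A2 C2 where C2: "\<forall>\<epsilon>. perturbed \<epsilon> \<in> diff_paths T \<longrightarrow>
    \<bar>diff_energy T (perturbed \<epsilon>) - (diff_energy T \<phi> + \<epsilon> * A2 + \<epsilon>\<^sup>2 * strip_integral kinetic_form)\<bar> \<le> C2 * \<bar>\<epsilon>\<bar> ^ 3"
    using diff_energy_cubic by blast
  let ?A = "A2 + (LINT t:{0..T}|lborel. - 2 * \<beta> t * f t)"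
  have "\<bar>vb_energy T (perturbed \<epsilon>, \<alpha>) - (vb_energy T (\<phi>, \<alpha>) + \<epsilon> * ?A + \<epsilon>\<^sup>2 * second_variation \<alpha>)\<bar> \<le> (C1 + C2) * \<bar>\<epsilon>\<bar> ^ 3"
    if \<epsilon>: "\<bar>\<epsilon>\<bar> < e" for \<epsilon>
  proof -
    interpret pert: diff_path T "perturbed \<epsilon>" by unfold_locales (rule e(3)[OF \<epsilon>])
    have "deriv_I T \<alpha> t - pert.drift t = \<beta> t - \<epsilon> * f t - \<epsilon>\<^sup>2 * g t - r \<epsilon> t" for t
      by (simp add: \<beta>_def r_def)
    then have "vb_energy T (perturbed \<epsilon>, \<alpha>) = diff_energy T (perturbed \<epsilon>) + (LINT t:{0..T}|lborel. (\<beta> t - \<epsilon> * f t - \<epsilon>\<^sup>2 * g t - r \<epsilon> t)\<^sup>2)"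
      by (simp add: pert.vb_energy_eq)
    moreover have "vb_energy T (\<phi>, \<alpha>) = diff_energy T \<phi> + (LINT t:{0..T}|lborel. (\<beta> t)\<^sup>2)"
      by (simp add: vb_energy_eq \<beta>_def)
    moreover have "second_variation \<alpha> = strip_integral kinetic_form + (LINT t:{0..T}|lborel. (f t)\<^sup>2 - 2 * \<beta> t * g t)"
      by (simp add: second_variation_def f_def g_def \<beta>_def)
    moreover have "(C1 + C2) * \<bar>\<epsilon>\<bar> ^ 3 = C1 * \<bar>\<epsilon>\<bar> ^ 3 + C2 * \<bar>\<epsilon>\<bar> ^ 3" by (rule distrib_right)
    ultimately show ?thesis
      using C1[rule_format, OF \<epsilon>] C2[rule_format, OF e(3)[OF \<epsilon>]] by (simp only: distrib_left) linarith
  qed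
  with e(1) show ?thesis by (rule that)
qed

end

section \<open>Variations concentrating at a point\<close>

lemma deriv_eq_0_outside:
  fixes f :: "real \<Rightarrow> real"
  assumes "\<And>y. 1 / 2 < \<bar>y\<bar> \<Longrightarrow> f y = 0" "1 / 2 < \<bar>y\<bar>"
  shows "deriv f y = 0"
proof -
  have "((\<lambda>_. 0) has_real_derivative 0) (at y)" by simp
  then have "(f has_real_derivative 0) (at y)"
    by (rule has_field_derivative_transform_within_open[where S="{y. 1 / 2 < \<bar>y\<bar>}"])
      (use assms in \<open>auto intro!: open_Collect_less continuous_intros\<close>)
  then show ?thesis by (rule DERIV_imp_deriv)
qed

abbreviation "bump' \<equiv> deriv bump"
abbreviation "bump'' \<equiv> deriv (deriv bump)"

lemma smooth_line_bump': "smooth_line bump'" "smooth_line bump''"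
  by (intro smooth_line_deriv smooth_line_bump)+

lemma continuous_bump: "continuous_on UNIV bump" "continuous_on UNIV bump'" "continuous_on UNIV bump''"
  by (auto intro!: continuous_at_imp_continuous_on smooth_line_isCont smooth_line_bump smooth_line_bump')

lemma profile_bump: "profile bump" "profile bump'" "profile bump''"
proof -
  have 0: "bump y = 0" if "1 / 2 < \<bar>y\<bar>" for y using that by (rule bump_eq_0)
  have 1: "bump' y = 0" if "1 / 2 < \<bar>y\<bar>" for y using 0 that by (rule deriv_eq_0_outside)
  have 2: "bump'' y = 0" if "1 / 2 < \<bar>y\<bar>" for y using 1 that by (rule deriv_eq_0_outside)
  show "profile bump" "profile bump'" "profile bump''"
    using 0 1 2 continuous_bump unfolding profile_def by auto
qed

lemma DERIV_bump: "(bump has_real_derivative bump' y) (at y)" "(bump' has_real_derivative bump'' y) (at y)"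
  by (intro smooth_line_DERIV smooth_line_bump smooth_line_bump')+

lemma profile_integrable:
  assumes "profile f" shows "integrable lborel f"
proof -
  have "integrable lborel (\<lambda>x. indicator {-1..1} x *\<^sub>R f x)"
    using assms by (intro borel_integrable_compact) (auto simp: profile_def intro: continuous_on_subset)
  also have "(\<lambda>x. indicator {-1..1} x *\<^sub>R f x) = f"
  proof
    show "indicator {-1..1} x *\<^sub>R f x = f x" for x
      using assms by (cases "x \<in> {-1..1}") (auto simp: profile_def)
  qed
  finally show ?thesis .
qed

text \<open>By continuity the square stays above half of its value at \<open>y\<close> on a whole
  interval, which bounds the integral from below.\<close>

lemma profile_integral_square_pos:
  assumes f: "profile f" and y: "f y \<noteq> 0"
  shows "(LINT x|lborel. f x * f x) > 0"
proof -
  have int: "integrable lborel (\<lambda>x. f x * f x)"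
    using f by (intro profile_integrable profile_mult) (auto simp: profile_def)
  have "isCont (\<lambda>x. f x * f x) y"
    using f by (auto simp: profile_def continuous_on_eq_continuous_at intro!: continuous_intros)
  then have "\<forall>\<^sub>F x in at y. f y * f y / 2 < f x * f x"
    using y by (intro order_tendstoD(1)[of _ "f y * f y"]) (auto simp: isCont_def mult_neg_neg zero_less_mult_iff)
  then obtain d where d: "d > 0" "\<And>x. x \<noteq> y \<Longrightarrow> dist x y < d \<Longrightarrow> f y * f y / 2 < f x * f x"
    unfolding eventually_at by auto
  have c: "0 < f y * f y / 2" using y by (auto simp: zero_less_mult_iff)
  have le: "f y * f y / 2 \<le> f x * f x" if "\<bar>x - y\<bar> < d" for x
    using d(2)[of x] that c by (cases "x = y") (auto simp: dist_real_def)
  have "0 < f y * f y / 2 * d" using c d(1) by (rule mult_pos_pos)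
  also have "\<dots> = (LINT x|lborel. f y * f y / 2 * indicator {y - d / 2..y + d / 2} x)" using d(1) by simp
  also have "\<dots> \<le> (LINT x|lborel. f x * f x)"
  proof (rule integral_mono[OF _ int])
    show "integrable lborel (\<lambda>x. f y * f y / 2 * indicator {y - d / 2..y + d / 2} x)"
      by (intro integrable_mult_right integrable_real_indicator) (auto simp: emeasure_lborel_Icc_eq)
    show "f y * f y / 2 * indicator {y - d / 2..y + d / 2} x \<le> f x * f x" for x
    proof (cases "x \<in> {y - d / 2..y + d / 2}")
      case True
      then have "\<bar>x - y\<bar> < d" using d(1) by auto
      with le True show ?thesis by simp
    qed simp
  qed
  finally show ?thesis .
qed

lemma profile_deriv_nonzero:
  assumes f: "profile f" and y: "f y \<noteq> 0" and der: "\<And>x. (f has_real_derivative f' x) (at x)"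
  obtains z where "f' z \<noteq> 0"
proof -
  have "\<exists>z. f' z \<noteq> 0"
  proof (rule ccontr)
    assume "\<not> (\<exists>z. f' z \<noteq> 0)"
    then have "f y = f 2" using der by (intro DERIV_isconst_all) metis
    with f y show False by (simp add: profile_def)
  qed
  with that show ?thesis by blast
qed

definition mass :: "(real \<Rightarrow> real) \<Rightarrow> real" where
  "mass f = (LINT y|lborel. f y * f y)"

lemma mass_bump_pos: "mass bump > 0" "mass bump' > 0" "mass bump'' > 0"
proof -
  have 0: "bump 0 \<noteq> 0" using bump_0_pos by simp
  obtain y where y: "bump' y \<noteq> 0" using profile_deriv_nonzero[OF profile_bump(1) 0 DERIV_bump(1)] by blast
  obtain z where z: "bump'' z \<noteq> 0" using profile_deriv_nonzero[OF profile_bump(2) y DERIV_bump(2)] by blast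
  show "mass bump > 0" "mass bump' > 0" "mass bump'' > 0"
    unfolding mass_def using profile_integral_square_pos profile_bump 0 y z by blast+
qed

text \<open>The integrand is half the derivative of \<open>bump\<close> squared. This cancellation
  leaves only integrals of squares, whose signs are known, in the limits below.\<close>

lemma integral_bump_bump': "(LINT y|lborel. bump y * bump' y) = 0"
proof -
  have "(LINT y|lborel. bump y * bump' y + bump' y * bump y) = 0"
    by (rule integral_by_parts_compact_support[where R=1])
      (use DERIV_bump continuous_bump profile_bump in \<open>auto simp: profile_def\<close>)
  moreover have "integrable lborel (\<lambda>y. bump y * bump' y)"
    by (intro profile_integrable profile_mult profile_bump continuous_bump)
  ultimately show ?thesis by (simp add: mult.commute)
qed

context concentration
begin

lemma smooth_strip_bubble:
  assumes "smooth_line f" "smooth_line g"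
  shows "smooth_strip T (bubble f g \<delta>)"
proof -
  have "bubble f g \<delta> = (\<lambda>t x. f (1 / \<delta> * t + 0 * x + (- t0 / \<delta>)) *
      g ((- \<mu> * \<kappa> / \<delta>) * t + (\<mu> / \<delta>) * x + (\<mu> * (\<kappa> * t0 - x0) / \<delta>)))"
    by (intro ext) (simp add: bubble_def diff_divide_distrib add_divide_distrib algebra_simps)
  then show ?thesis
    unfolding smooth_strip_def by (simp only:) (intro allI Ck_strip_mult Ck_strip_affine assms)
qed

lemma bubble_DERIV_x:
  assumes "smooth_line g" "\<delta> > 0"
  shows "(bubble f g \<delta> t has_real_derivative \<mu> / \<delta> * bubble f (deriv g) \<delta> t x) (at x)"
proof -
  have "((\<lambda>x. \<mu> * (x - x0 - \<kappa> * (t - t0)) / \<delta>) has_real_derivative \<mu> / \<delta>) (at x)"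
    using assms by (auto intro!: derivative_eq_intros)
  from DERIV_cmult[OF DERIV_chain2[OF smooth_line_DERIV[OF assms(1)] this], of "f ((t - t0) / \<delta>)"]
  show ?thesis by (simp add: bubble_def[abs_def] mult_ac)
qed

lemma bubble_DERIV_t:
  assumes "smooth_line f" "smooth_line g" "\<delta> > 0"
  shows "((\<lambda>t. bubble f g \<delta> t x) has_real_derivative
    1 / \<delta> * (bubble (deriv f) g \<delta> t x - \<kappa> * \<mu> * bubble f (deriv g) \<delta> t x)) (at t within S)"
proof -
  have "((\<lambda>t. (t - t0) / \<delta>) has_real_derivative 1 / \<delta>) (at t)"
    using assms by (auto intro!: derivative_eq_intros)
  note f = DERIV_chain2[OF smooth_line_DERIV[OF assms(1)] this]
  have "((\<lambda>t. \<mu> * (x - x0 - \<kappa> * (t - t0)) / \<delta>) has_real_derivative - (\<mu> * \<kappa> / \<delta>)) (at t)"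
    using assms by (auto intro!: derivative_eq_intros)
  note g = DERIV_chain2[OF smooth_line_DERIV[OF assms(2)] this]
  have "((\<lambda>t. bubble f g \<delta> t x) has_real_derivative
    1 / \<delta> * (bubble (deriv f) g \<delta> t x - \<kappa> * \<mu> * bubble f (deriv g) \<delta> t x)) (at t)"
    using DERIV_mult[OF f g] by (simp add: bubble_def[abs_def] algebra_simps)
  then show ?thesis by (rule has_field_derivative_at_within)
qed

text \<open>The factor \<open>\<delta>\<close> keeps the first derivatives bounded as \<open>\<delta>\<close> tends to 0.\<close>

definition spike :: "real \<Rightarrow> real \<Rightarrow> real \<Rightarrow> real" where
  "spike \<delta> = (\<lambda>t x. \<delta> * bubble bump bump \<delta> t x)"

lemma smooth_strip_cmult: "smooth_strip T F \<Longrightarrow> smooth_strip T (\<lambda>t x. c * F t x)"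
  unfolding smooth_strip_def by (intro allI Ck_strip_mult Ck_strip_const) auto

lemma spike_schwartz:
  assumes "\<delta> > 0"
  shows "spike \<delta> \<in> schwartz_strip T"
proof (rule compact_support_schwartz_strip)
  show "smooth_strip T (spike \<delta>)"
    unfolding spike_def by (intro smooth_strip_cmult smooth_strip_bubble smooth_line_bump)
  fix t x assume "\<bar>x0\<bar> + (1 + \<bar>\<kappa>\<bar> + 1 / \<mu>) * \<delta> < \<bar>x\<bar>"
  then have "(1 + \<bar>\<kappa>\<bar> + 1 / \<mu>) * \<delta> \<le> max \<bar>t - t0\<bar> \<bar>x - x0\<bar>" by linarith
  then show "spike \<delta> t x = 0"
    using bubble_eq_0_far[OF profile_bump(1) profile_bump(1) assms] by (simp add: spike_def)
qed

lemma spike_ends: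
  assumes "\<delta> > 0" "\<delta> \<le> t0" "\<delta> \<le> T - t0"
  shows "spike \<delta> 0 x = 0" "spike \<delta> T x = 0"
  using bubble_eq_0_time[OF profile_bump(1) assms(1), of 0] bubble_eq_0_time[OF profile_bump(1) assms(1), of T] assms
  by (simp_all add: spike_def)

text \<open>Each differentiation costs 1 / \<delta>: a spike of height \<delta> has first
  derivatives of size one and second derivatives of size 1 / \<delta>. The second term in the time
  derivative is - \<kappa> times the space derivative and comes from the moving centre; the first
  comes from the cutoff in time.\<close>

lemma
  assumes \<delta>: "\<delta> > 0" and t: "t \<in> {0..T}"
  shows D_t_spike: "D_t T (spike \<delta>) t x = bubble bump' bump \<delta> t x - \<kappa> * \<mu> * bubble bump bump' \<delta> t x"
    and D_x_spike: "D_x (spike \<delta>) t x = \<mu> * bubble bump bump' \<delta> t x"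
    and D_tx_spike: "D_x (D_t T (spike \<delta>)) t x =
      \<mu> / \<delta> * (bubble bump' bump' \<delta> t x - \<kappa> * \<mu> * bubble bump bump'' \<delta> t x)"
    and D_xx_spike: "D_x (D_x (spike \<delta>)) t x = \<mu>\<^sup>2 / \<delta> * bubble bump bump'' \<delta> t x"
proof -
  note sm = smooth_line_bump smooth_line_bump'
  have Dt: "D_t T (spike \<delta>) t = (\<lambda>x. bubble bump' bump \<delta> t x - \<kappa> * \<mu> * bubble bump bump' \<delta> t x)"
  proof
    fix x
    show "D_t T (spike \<delta>) t x = bubble bump' bump \<delta> t x - \<kappa> * \<mu> * bubble bump bump' \<delta> t x"
      unfolding D_t_def spike_def
      using DERIV_cmult[OF bubble_DERIV_t[OF sm(1) sm(1) \<delta>], of \<delta> x t "{0..T}"] \<delta>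
      by (intro deriv_I_eq[OF t]) simp
  qed
  then show "D_t T (spike \<delta>) t x = bubble bump' bump \<delta> t x - \<kappa> * \<mu> * bubble bump bump' \<delta> t x" by simp
  have Dx: "D_x (spike \<delta>) t = (\<lambda>x. \<mu> * bubble bump bump' \<delta> t x)"
  proof
    fix x
    show "D_x (spike \<delta>) t x = \<mu> * bubble bump bump' \<delta> t x"
      unfolding D_x_def spike_def
      using DERIV_cmult[OF bubble_DERIV_x[OF sm(1) \<delta>], of \<delta> bump t x] \<delta>
      by (intro DERIV_imp_deriv) simp
  qed
  then show "D_x (spike \<delta>) t x = \<mu> * bubble bump bump' \<delta> t x" by simp
  have "D_x (D_t T (spike \<delta>)) t x = deriv (\<lambda>x. bubble bump' bump \<delta> t x - \<kappa> * \<mu> * bubble bump bump' \<delta> t x) x"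
    by (simp only: D_x_def[of "D_t T (spike \<delta>)"] Dt)
  also have "\<dots> = \<mu> / \<delta> * bubble bump' bump' \<delta> t x - \<kappa> * \<mu> * (\<mu> / \<delta> * bubble bump bump'' \<delta> t x)"
    by (intro DERIV_imp_deriv DERIV_diff DERIV_cmult bubble_DERIV_x sm \<delta>)
  finally show "D_x (D_t T (spike \<delta>)) t x =
      \<mu> / \<delta> * (bubble bump' bump' \<delta> t x - \<kappa> * \<mu> * bubble bump bump'' \<delta> t x)"
    by (simp add: algebra_simps)
  have "D_x (D_x (spike \<delta>)) t x = deriv (\<lambda>x. \<mu> * bubble bump bump' \<delta> t x) x"
    by (simp only: D_x_def[of "D_x (spike \<delta>)"] Dx)
  also have "\<dots> = \<mu> * (\<mu> / \<delta> * bubble bump bump'' \<delta> t x)"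
    by (intro DERIV_imp_deriv DERIV_cmult bubble_DERIV_x sm \<delta>)
  finally show "D_x (D_x (spike \<delta>)) t x = \<mu>\<^sup>2 / \<delta> * bubble bump bump'' \<delta> t x"
    by (simp add: power2_eq_square)
qed

end

lemma integrable_continuous_compact_support:
  fixes f :: "real \<Rightarrow> real"
  assumes "continuous_on UNIV f" "\<And>x. R < \<bar>x\<bar> \<Longrightarrow> f x = 0"
  shows "integrable lborel f"
proof -
  have "integrable lborel (\<lambda>x. indicator {-R..R} x *\<^sub>R f x)"
    using assms(1) by (intro borel_integrable_compact) (auto intro: continuous_on_subset)
  also have "(\<lambda>x. indicator {-R..R} x *\<^sub>R f x) = f"
  proof
    show "indicator {-R..R} x *\<^sub>R f x = f x" for x
      using assms(2)[of x] by (cases "x \<in> {-R..R}") auto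
  qed
  finally show ?thesis .
qed

section \<open>Limits of the quadratic form along spikes\<close>

locale concentrated_path = diff_path T \<phi> + concentration T t0 x0 \<kappa> \<mu>
  for T \<phi> t0 x0 \<kappa> \<mu>
begin

lemma variation_spike: "\<delta> > 0 \<Longrightarrow> variation T \<phi> (spike \<delta>)"
  by unfold_locales (rule spike_schwartz)

lemma profile_products:
  "profile (\<lambda>y. bump y * bump y)" "profile (\<lambda>y. bump y * bump' y)" "profile (\<lambda>y. bump' y * bump' y)"
  "profile (\<lambda>y. bump' y * bump'' y)" "profile (\<lambda>y. bump'' y * bump'' y)"
  by (intro profile_mult profile_bump continuous_bump)+

abbreviation "B00 \<equiv> \<lambda>y. bump y * bump y"
abbreviation "B01 \<equiv> \<lambda>y. bump y * bump' y"
abbreviation "B11 \<equiv> \<lambda>y. bump' y * bump' y"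
abbreviation "B12 \<equiv> \<lambda>y. bump' y * bump'' y"
abbreviation "B22 \<equiv> \<lambda>y. bump'' y * bump'' y"

abbreviation "kinetic \<delta> \<equiv> strip_integral (variation.kinetic_form T \<phi> (spike \<delta>))"
abbreviation "drift1_square \<delta> \<equiv>
  (LINT t:{0..T}|lborel. (LINT x|lborel. variation.drift1 T \<phi> (spike \<delta>) t x)\<^sup>2)"
abbreviation "drift2_against \<beta> \<delta> \<equiv>
  (LINT t:{0..T}|lborel. \<beta> t * (LINT x|lborel. variation.drift2 T \<phi> (spike \<delta>) t x))"

lemma eventually_small: "\<forall>\<^sub>F \<delta> in at_right 0. 0 < \<delta> \<and> \<delta> \<le> 1 \<and> \<delta> \<le> t0 \<and> \<delta> \<le> T - t0"
  unfolding eventually_at_right_field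
  by (rule exI[of _ "min 1 (min t0 (T - t0))"]) (use t0 in auto)

text \<open>Only first derivatives enter, and these are bounded, so the area of the support gives
  the order \<delta>^2. The product of the cutoff part of h_t with h_x drops out by
  \<open>integral_bump_bump'\<close>, which leaves the form evaluated on the two parts
  separately.\<close>

lemma kinetic_form_tendsto:
  "((\<lambda>\<delta>. kinetic \<delta> / \<delta>\<^sup>2) \<longlongrightarrow>
    mass bump * mass bump' / \<mu> * (\<phi>_x t0 x0 * (1 + \<kappa>\<^sup>2 * \<mu>\<^sup>2) - 2 * \<kappa> * \<mu>\<^sup>2 * \<phi>_t t0 x0)) (at_right 0)"
proof -
  \<comment> \<open>With a = \<open>bubble bump' bump\<close> and b =
    \<open>bubble bump bump'\<close>, one has h_t = a - \<kappa> \<mu> b and h_x = \<mu> b. Then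
    \<open>F2\<close> is the coefficient of a b and \<open>F3\<close> that of b^2; the coefficient
    of a^2 is \<phi>_x.\<close>
  define F2 where "F2 = (\<lambda>t x. (- 2 * \<kappa> * \<mu>) * \<phi>_x t x + (2 * \<mu>) * \<phi>_t t x)"
  define F3 where "F3 = (\<lambda>t x. (\<kappa>\<^sup>2 * \<mu>\<^sup>2) * \<phi>_x t x + (- 2 * \<kappa> * \<mu>\<^sup>2) * \<phi>_t t x)"
  have F: "cont_strip F2" "cont_strip F3" unfolding F2_def F3_def by (intro cont_intros)+
  let ?S = "\<lambda>\<delta>. strip_integral (\<lambda>t x. \<phi>_x t x * bubble B11 B00 \<delta> t x) / \<delta>\<^sup>2
      + strip_integral (\<lambda>t x. F2 t x * bubble B01 B01 \<delta> t x) / \<delta>\<^sup>2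
      + strip_integral (\<lambda>t x. F3 t x * bubble B00 B11 \<delta> t x) / \<delta>\<^sup>2"
  let ?L = "\<phi>_x t0 x0 / \<mu> * (mass bump' * mass bump) + F2 t0 x0 / \<mu> * (0 * 0) + F3 t0 x0 / \<mu> * (mass bump * mass bump')"
  let ?Z = "\<lambda>\<delta> t x. \<phi>_x t x * bubble B11 B00 \<delta> t x + F2 t x * bubble B01 B01 \<delta> t x + F3 t x * bubble B00 B11 \<delta> t x"
  have lim: "((\<lambda>\<delta>. ?S \<delta>) \<longlongrightarrow>
      ?L) (at_right 0)"
    using strip_integral_bubble_tendsto[OF cont_path(2) profile_products(3,1)]
      strip_integral_bubble_tendsto[OF F(1) profile_products(2,2)]
      strip_integral_bubble_tendsto[OF F(2) profile_products(1,3)]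
    unfolding mass_def integral_bump_bump' by (intro tendsto_add)
  have eq: "kinetic \<delta> / \<delta>\<^sup>2 =
      ?S \<delta>" if \<delta>: "0 < \<delta>" for \<delta>
  proof -
    interpret V: variation T \<phi> "spike \<delta>" by (rule variation_spike[OF \<delta>])
    have "strip_integral V.kinetic_form = strip_integral (?Z \<delta>)"
    proof (rule strip_integral_cong)
      fix t x assume t: "t \<in> {0..T}"
      show "V.kinetic_form t x = ?Z \<delta> t x"
        unfolding V.kinetic_form_def D_t_spike[OF \<delta> t] D_x_spike[OF \<delta> t] F2_def F3_def
        by (simp add: bubble_def algebra_simps power2_eq_square)
    qed
    also have "\<dots> = strip_integral (\<lambda>t x. \<phi>_x t x * bubble B11 B00 \<delta> t x)
      + strip_integral (\<lambda>t x. F2 t x * bubble B01 B01 \<delta> t x)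
      + strip_integral (\<lambda>t x. F3 t x * bubble B00 B11 \<delta> t x)"
      by (simp only: strip_integral_add decays_add decays_mult_bubble cont_path F profile_products \<delta>)
    finally show ?thesis by (simp add: add_divide_distrib)
  qed
  have "((\<lambda>\<delta>. kinetic \<delta> / \<delta>\<^sup>2) \<longlongrightarrow>
      ?L) (at_right 0)"
    by (rule Lim_transform_eventually[OF lim]) (use eventually_small in \<open>eventually_elim, simp add: eq\<close>)
  also have "?L =
      mass bump * mass bump' / \<mu> * (\<phi>_x t0 x0 * (1 + \<kappa>\<^sup>2 * \<mu>\<^sup>2) - 2 * \<kappa> * \<mu>\<^sup>2 * \<phi>_t t0 x0)"
    by (simp add: F3_def algebra_simps add_divide_distrib diff_divide_distrib)
  finally show ?thesis .
qed

lemma cont_strip_inverse_\<phi>_x [cont_intros]: "cont_strip (\<lambda>t x. 1 / \<phi>_x t x)"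
  by (rule bcont_cont[OF bcont_inverse_\<phi>_x])

text \<open>The product h_tx h_xx has size 1 / \<delta>^2, which the area of the support cancels. Of
  its two parts, the one from the cutoff in time has a vanishing integral, and the other carries the
  factor - \<kappa>; so the limit is odd in \<kappa>.\<close>

lemma drift2_tendsto:
  assumes \<beta>: "continuous_on {0..T} \<beta>"
  shows "((\<lambda>\<delta>. drift2_against \<beta> \<delta>) \<longlongrightarrow>
    - \<kappa> * \<mu> ^ 3 * mass bump * mass bump'' * \<beta> t0 / (\<phi>_x t0 x0)\<^sup>2) (at_right 0)"
proof -
  let ?v = "\<lambda>t x. 1 / \<phi>_x t x"
  have \<beta>': "cont_strip (\<lambda>t x. \<beta> t)" by (rule cont_strip_time[OF \<beta>])
  \<comment> \<open>The coefficients of h_tx h_xx, h_x h_tx, h_x h_xx and h_x^2, in this order, in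
    \<beta> times \<open>drift2\<close>.\<close>
  define G0 where "G0 = (\<lambda>t x. \<beta> t * (?v t x)\<^sup>2)"
  define G1 where "G1 = (\<lambda>t x. - 2 * \<beta> t * \<phi>_xx t x * (?v t x) ^ 3)"
  define G2 where "G2 = (\<lambda>t x. - 2 * \<beta> t * \<phi>_tx t x * (?v t x) ^ 3)"
  define G3 where "G3 = (\<lambda>t x. 3 * \<beta> t * \<phi>_tx t x * \<phi>_xx t x * (?v t x) ^ 4)"
  have G: "cont_strip G0" "cont_strip G1" "cont_strip G2" "cont_strip G3"
    unfolding G0_def G1_def G2_def G3_def by (intro cont_intros \<beta>')+
  define I where "I F f g \<delta> = strip_integral (\<lambda>t x. F t x * bubble f g \<delta> t x)" for F f g \<delta>
  let ?L = "\<lambda>F f g. F t0 x0 / \<mu> * ((LINT y|lborel. f y) * (LINT y|lborel. g y))"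
  have I: "((\<lambda>\<delta>. I F f g \<delta> / \<delta>\<^sup>2) \<longlongrightarrow> ?L F f g) (at_right 0)" if "cont_strip F" "profile f" "profile g" for F f g
    unfolding I_def by (rule strip_integral_bubble_tendsto[OF that])
  \<comment> \<open>The terms are sorted by how many factors are second derivatives: two in
    \<open>?S0\<close>, one in \<open>?S1\<close>, none in \<open>?S2\<close>. Each missing one
    gains a factor \<delta>.\<close>
  let ?S0 = "\<lambda>\<delta>. \<mu> ^ 3 * (I G0 B01 B12 \<delta> / \<delta>\<^sup>2) + (- \<kappa> * \<mu> ^ 4) * (I G0 B00 B22 \<delta> / \<delta>\<^sup>2)"
  let ?S1 = "\<lambda>\<delta>. \<mu>\<^sup>2 * (I G1 B01 B11 \<delta> / \<delta>\<^sup>2) + (- \<kappa> * \<mu> ^ 3) * (I G1 B00 B12 \<delta> / \<delta>\<^sup>2)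
      + \<mu> ^ 3 * (I G2 B00 B12 \<delta> / \<delta>\<^sup>2)"
  let ?S2 = "\<lambda>\<delta>. \<mu>\<^sup>2 * (I G3 B00 B11 \<delta> / \<delta>\<^sup>2)"
  let ?lim = "(\<mu> ^ 3 * ?L G0 B01 B12 + (- \<kappa> * \<mu> ^ 4) * ?L G0 B00 B22)
      + 0 * (\<mu>\<^sup>2 * ?L G1 B01 B11 + (- \<kappa> * \<mu> ^ 3) * ?L G1 B00 B12 + \<mu> ^ 3 * ?L G2 B00 B12)
      + 0\<^sup>2 * (\<mu>\<^sup>2 * ?L G3 B00 B11)"
  note pp = profile_products
  have lim: "((\<lambda>\<delta>. ?S0 \<delta> + \<delta> * ?S1 \<delta> + \<delta>\<^sup>2 * ?S2 \<delta>) \<longlongrightarrow>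
      ?lim) (at_right 0)"
    by (intro tendsto_add tendsto_mult tendsto_const tendsto_power tendsto_ident_at I G pp)
  have eq: "drift2_against \<beta> \<delta> =
      ?S0 \<delta> + \<delta> * ?S1 \<delta> + \<delta>\<^sup>2 * ?S2 \<delta>" if \<delta>: "0 < \<delta>" for \<delta>
  proof -
    interpret V: variation T \<phi> "spike \<delta>" by (rule variation_spike[OF \<delta>])
    let ?Y = "\<lambda>t x. (\<mu> ^ 3 / \<delta>\<^sup>2) * (G0 t x * bubble B01 B12 \<delta> t x) + (- \<kappa> * \<mu> ^ 4 / \<delta>\<^sup>2) * (G0 t x * bubble B00 B22 \<delta> t x)
        + (\<mu>\<^sup>2 / \<delta>) * (G1 t x * bubble B01 B11 \<delta> t x) + (- \<kappa> * \<mu> ^ 3 / \<delta>) * (G1 t x * bubble B00 B12 \<delta> t x)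
        + (\<mu> ^ 3 / \<delta>) * (G2 t x * bubble B00 B12 \<delta> t x) + \<mu>\<^sup>2 * (G3 t x * bubble B00 B11 \<delta> t x)"
    have "(LINT t:{0..T}|lborel. \<beta> t * (LINT x|lborel. V.drift2 t x)) = strip_integral (\<lambda>t x. \<beta> t * V.drift2 t x)"
      by (simp add: strip_integral_def)
    also have "\<dots> = strip_integral ?Y"
    proof (rule strip_integral_cong)
      fix t x assume t: "t \<in> {0..T}"
      define v where "v = 1 / \<phi>_x t x"
      define d where "d = 1 / \<delta>"
      have div: "c / \<delta> = c * d" "c / \<delta>\<^sup>2 = c * d\<^sup>2" for c by (simp_all add: d_def power_divide)
      show "\<beta> t * V.drift2 t x = ?Y t x"
        unfolding V.drift2_def D_tx_spike[OF \<delta> t] D_xx_spike[OF \<delta> t] D_x_spike[OF \<delta> t]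
          G0_def G1_def G2_def G3_def v_def[symmetric] bubble_def div by algebra
    qed
    also have "\<dots> = (\<mu> ^ 3 / \<delta>\<^sup>2) * I G0 B01 B12 \<delta> + (- \<kappa> * \<mu> ^ 4 / \<delta>\<^sup>2) * I G0 B00 B22 \<delta>
        + (\<mu>\<^sup>2 / \<delta>) * I G1 B01 B11 \<delta> + (- \<kappa> * \<mu> ^ 3 / \<delta>) * I G1 B00 B12 \<delta>
        + (\<mu> ^ 3 / \<delta>) * I G2 B00 B12 \<delta> + \<mu>\<^sup>2 * I G3 B00 B11 \<delta>"
      unfolding I_def
      by (simp only: strip_integral_add strip_integral_cmult decays_add decays_cmult decays_mult_bubble G pp \<delta>)
    also have "\<dots> = ?S0 \<delta> + \<delta> * ?S1 \<delta> + \<delta>\<^sup>2 * ?S2 \<delta>"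
      using \<delta> by (simp add: field_simps power2_eq_square)
    finally show ?thesis .
  qed
  have "((\<lambda>\<delta>. drift2_against \<beta> \<delta>) \<longlongrightarrow>
      ?lim) (at_right 0)"
    by (rule Lim_transform_eventually[OF lim]) (use eventually_small in \<open>eventually_elim, simp only: eq\<close>)
  moreover have "?lim =
      - \<kappa> * \<mu> ^ 3 * mass bump * mass bump'' * \<beta> t0 / (\<phi>_x t0 x0)\<^sup>2"
    using \<mu>_pos by (simp add: G0_def integral_bump_bump' mass_def[symmetric] power_divide power4_eq_xxxx power3_eq_cube)
  ultimately show ?thesis by simp
qed

text \<open>Integration by parts moves the second derivatives off the variation, whose first derivatives are
  bounded independently of \<open>\<delta>\<close>.\<close>

lemma drift1_integral:
  assumes \<delta>: "\<delta> > 0" and t: "t \<in> {0..T}"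
  defines "w \<equiv> spike \<delta>"
  defines "A \<equiv> \<lambda>x. D_x \<phi>_xx t x * (1 / \<phi>_x t x)\<^sup>2 - 2 * (\<phi>_xx t x)\<^sup>2 * (1 / \<phi>_x t x) ^ 3"
  shows "(LINT x|lborel. variation.drift1 T \<phi> w t x) =
    (LINT x|lborel. - A x * D_t T w t x - D_x \<phi>_tx t x * (1 / \<phi>_x t x)\<^sup>2 * D_x w t x)"
proof -
  interpret V: variation T \<phi> w unfolding w_def by (rule variation_spike[OF \<delta>])
  let ?v = "\<lambda>x. 1 / \<phi>_x t x"
  let ?R = "\<bar>x0\<bar> + (1 + \<bar>\<kappa>\<bar> + 1 / \<mu>) * \<delta>"
  have far: "bubble f g \<delta> t x = 0" if "?R < \<bar>x\<bar>" "profile f" "profile g" for f g x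
  proof -
    have "(1 + \<bar>\<kappa>\<bar> + 1 / \<mu>) * \<delta> \<le> max \<bar>t - t0\<bar> \<bar>x - x0\<bar>" using that(1) by linarith
    then show ?thesis by (rule bubble_eq_0_far[OF that(2,3) \<delta>])
  qed
  have far': "D_t T w t x = 0" "D_x w t x = 0" "D_x (D_t T w) t x = 0" "D_x (D_x w) t x = 0" if "?R < \<bar>x\<bar>" for x
    unfolding w_def D_t_spike[OF \<delta> t] D_x_spike[OF \<delta> t] D_tx_spike[OF \<delta> t] D_xx_spike[OF \<delta> t]
    by (simp_all add: far[OF that] profile_bump)
  have sm: "smooth_strip T \<phi>_x" "smooth_strip T \<phi>_xx" "smooth_strip T \<phi>_tx" "smooth_strip T (D_t T w)" "smooth_strip T (D_x w)"
    by (intro smooth_strip_D_x smooth_strip_D_t smooth_path V.smooth_variation)+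
  note D = smooth_strip_DERIV_x[OF _ t]
  have v: "(?v has_real_derivative - \<phi>_xx t x * (?v x)\<^sup>2) (at x)" for x
    using DERIV_inverse'[OF D[OF sm(1)], of x] \<phi>_x_pos[OF t, of x]
    by (simp add: inverse_eq_divide power2_eq_square mult_ac)
  have v2: "((\<lambda>x. (?v x)\<^sup>2) has_real_derivative - 2 * \<phi>_xx t x * (?v x) ^ 3) (at x)" for x
    using DERIV_mult[OF v v, of x] by (simp add: power2_eq_square power3_eq_cube algebra_simps)
  let ?a = "\<lambda>x. \<phi>_xx t x * (?v x)\<^sup>2" and ?b = "\<lambda>x. \<phi>_tx t x * (?v x)\<^sup>2"
  let ?b' = "\<lambda>x. D_x \<phi>_tx t x * (?v x)\<^sup>2 - 2 * \<phi>_tx t x * \<phi>_xx t x * (?v x) ^ 3"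
  have a: "(?a has_real_derivative A x) (at x)" for x
    using DERIV_mult[OF D[OF sm(2)] v2, of x] by (simp add: A_def power2_eq_square algebra_simps)
  have b: "(?b has_real_derivative ?b' x) (at x)" for x
    using DERIV_mult[OF D[OF sm(3)] v2, of x] by (simp add: algebra_simps)
  have cA: "cont_strip (\<lambda>t x. D_x \<phi>_xx t x * (1 / \<phi>_x t x)\<^sup>2 - 2 * (\<phi>_xx t x)\<^sup>2 * (1 / \<phi>_x t x) ^ 3)"
    "cont_strip (\<lambda>t x. D_x \<phi>_tx t x * (1 / \<phi>_x t x)\<^sup>2 - 2 * \<phi>_tx t x * \<phi>_xx t x * (1 / \<phi>_x t x) ^ 3)"
    by (intro cont_intros)+
  have c: "continuous_on UNIV A" "continuous_on UNIV ?b'"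
    using cA[THEN cont_strip_slice[OF _ t]] by (simp_all add: A_def)
  have cw: "continuous_on UNIV (D_x (D_t T w) t)" "continuous_on UNIV (D_x (D_x w) t)"
    by (intro cont_strip_slice[OF _ t] smooth_strip_cont smooth_strip_D_x sm)+
  have 1: "(LINT x|lborel. ?a x * D_x (D_t T w) t x + A x * D_t T w t x) = 0"
    by (rule integral_by_parts_compact_support[OF a D[OF sm(4)] c(1) cw(1)]) (fact far')+
  have 2: "(LINT x|lborel. ?b x * D_x (D_x w) t x + ?b' x * D_x w t x) = 0"
    by (rule integral_by_parts_compact_support[OF b D[OF sm(5)] c(2) cw(2)]) (fact far')+
  have cw': "continuous_on UNIV (D_t T w t)" "continuous_on UNIV (D_x w t)"
    by (intro cont_strip_slice[OF _ t] smooth_strip_cont sm)+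
  have cab: "continuous_on UNIV ?a" "continuous_on UNIV ?b"
    using a b by (auto intro!: continuous_at_imp_continuous_on DERIV_isCont)
  have iA: "integrable lborel (\<lambda>x. ?a x * D_x (D_t T w) t x + A x * D_t T w t x)"
    by (rule integrable_continuous_compact_support[where R="?R"])
      (auto intro!: continuous_on_add continuous_on_mult c cw cw' cab simp: far')
  have iB: "integrable lborel (\<lambda>x. ?b x * D_x (D_x w) t x + ?b' x * D_x w t x)"
    by (rule integrable_continuous_compact_support[where R="?R"])
      (intro continuous_on_add continuous_on_mult c cw cw' cab | simp add: far')+
  have i1: "integrable lborel (V.drift1 t)" by (rule decays_integrable[OF V.decays_drift12(1) t])
  \<comment> \<open>What is subtracted are the integrals of the derivatives of \<open>?a\<close> h_t
    and \<open>?b\<close> h_x, which are zero. The second derivatives of \<open>w\<close> cancel,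
    and so does the h_x term of \<open>drift1\<close>, against the part of \<open>?b'\<close> that
    comes from differentiating 1 / \<phi>_x^2.\<close>
  have "(LINT x|lborel. V.drift1 t x) = (LINT x|lborel. V.drift1 t x)
      - (LINT x|lborel. ?a x * D_x (D_t T w) t x + A x * D_t T w t x)
      - (LINT x|lborel. ?b x * D_x (D_x w) t x + ?b' x * D_x w t x)"
    unfolding 1 2 by simp
  also have "\<dots> = (LINT x|lborel. V.drift1 t x - (?a x * D_x (D_t T w) t x + A x * D_t T w t x)
      - (?b x * D_x (D_x w) t x + ?b' x * D_x w t x))"
    using i1 iA iB by simp
  also have "(\<lambda>x. V.drift1 t x - (?a x * D_x (D_t T w) t x + A x * D_t T w t x)
      - (?b x * D_x (D_x w) t x + ?b' x * D_x w t x)) =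
      (\<lambda>x. - A x * D_t T w t x - D_x \<phi>_tx t x * (1 / \<phi>_x t x)\<^sup>2 * D_x w t x)"
    by (intro ext) (simp add: V.drift1_def algebra_simps)
  finally show ?thesis .
qed

text \<open>After \<open>drift1_integral\<close> the integrand is bounded independently of \<delta>.
  At each time it lives on an interval of length 2 \<delta> / \<mu>, so the inner integral is
  O(\<delta>); its square lives on a time interval of length 2 \<delta>. The total O(\<delta>^3) is
  negligible against \<delta>^2, whatever \<phi> is.\<close>

lemma drift1_square_tendsto:
  "((\<lambda>\<delta>. drift1_square \<delta> / \<delta>\<^sup>2) \<longlongrightarrow> 0)
    (at_right 0)"
proof -
  define A where "A = (\<lambda>t x. D_x \<phi>_xx t x * (1 / \<phi>_x t x)\<^sup>2 - 2 * (\<phi>_xx t x)\<^sup>2 * (1 / \<phi>_x t x) ^ 3)"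
  define C where "C = (\<lambda>t x. D_x \<phi>_tx t x * (1 / \<phi>_x t x)\<^sup>2)"
  \<comment> \<open>For \<delta> \<le> 1 all supports lie within this distance of the origin, so the
    bounds \<open>KA\<close> and \<open>KC\<close> can be chosen before \<delta>.\<close>
  let ?R = "\<bar>x0\<bar> + (1 + \<bar>\<kappa>\<bar> + 1 / \<mu>)"
  have cAC: "cont_strip A" "cont_strip C" unfolding A_def C_def by (intro cont_intros)+
  obtain KA where KA: "KA > 0" "\<And>t x. t \<in> {0..T} \<Longrightarrow> \<bar>x\<bar> \<le> ?R \<Longrightarrow> \<bar>A t x\<bar> \<le> KA"
    using cont_strip_bounded_box[OF cAC(1), of ?R] by metis
  obtain KC where KC: "KC > 0" "\<And>t x. t \<in> {0..T} \<Longrightarrow> \<bar>x\<bar> \<le> ?R \<Longrightarrow> \<bar>C t x\<bar> \<le> KC"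
    using cont_strip_bounded_box[OF cAC(2), of ?R] by metis
  obtain b0 where b0: "b0 > 0" "\<And>y. \<bar>bump y\<bar> \<le> b0" using profile_bounded[OF profile_bump(1)] by metis
  obtain b1 where b1: "b1 > 0" "\<And>y. \<bar>bump' y\<bar> \<le> b1" using profile_bounded[OF profile_bump(2)] by metis
  \<comment> \<open>The brackets bound the time and the space derivative of the spike, term by term
    as in \<open>D_t_spike\<close> and \<open>D_x_spike\<close>.\<close>
  define M where "M = KA * (b1 * b0 + \<bar>\<kappa> * \<mu>\<bar> * (b0 * b1)) + KC * (\<mu> * (b0 * b1))"
  define K where "K = (M * (2 / \<mu>))\<^sup>2"
  have main: "\<bar>drift1_square \<delta> / \<delta>\<^sup>2\<bar> \<le> K * (2 * \<delta>)"
    if \<delta>: "0 < \<delta>" "\<delta> \<le> 1" for \<delta>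
  proof -
    interpret V: variation T \<phi> "spike \<delta>" by (rule variation_spike[OF \<delta>(1)])
    let ?w = "spike \<delta>"
    let ?f = "\<lambda>t. LINT x|lborel. V.drift1 t x"
    have f: "?f t = (LINT x|lborel. - A t x * D_t T ?w t x - C t x * D_x ?w t x)" if "t \<in> {0..T}" for t
      unfolding A_def C_def by (rule drift1_integral[OF \<delta>(1) that])
    have outside: "?f t = 0" if t: "t \<in> {0..T}" "\<delta> < \<bar>t - t0\<bar>" for t
    proof -
      have "D_t T ?w t x = 0" "D_x ?w t x = 0" for x
        unfolding D_t_spike[OF \<delta>(1) t(1)] D_x_spike[OF \<delta>(1) t(1)]
        using bubble_eq_0_time[OF profile_bump(1) \<delta>(1), of t] bubble_eq_0_time[OF profile_bump(2) \<delta>(1), of t] t(2)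
        by simp_all
      then show ?thesis unfolding f[OF t(1)] by simp
    qed
    have bound: "\<bar>?f t\<bar> \<le> M * (2 * (\<delta> / \<mu>))" if t: "t \<in> {0..T}" for t
    proof -
      let ?W = "\<lambda>x. - A t x * D_t T ?w t x - C t x * D_x ?w t x"
      note Dw = D_t_spike[OF \<delta>(1) t] D_x_spike[OF \<delta>(1) t]
      have far: "?W x = 0" if "(1 + \<bar>\<kappa>\<bar> + 1 / \<mu>) * \<delta> \<le> max \<bar>t - t0\<bar> \<bar>x - x0\<bar>" for x
        unfolding Dw using bubble_eq_0_far[OF _ _ \<delta>(1) that] by (simp add: profile_bump)
      have r: "0 < 1 + \<bar>\<kappa>\<bar> + 1 / \<mu>" using \<mu>_pos by (simp add: add_pos_pos add_pos_nonneg)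
      have "(1 + \<bar>\<kappa>\<bar> + 1 / \<mu>) * \<delta> \<le> 1 + \<bar>\<kappa>\<bar> + 1 / \<mu>"
        using mult_left_mono[OF \<delta>(2), of "1 + \<bar>\<kappa>\<bar> + 1 / \<mu>"] r by simp
      moreover have "y \<le> max a \<bar>x - x0\<bar>" if "y \<le> r" "\<bar>x0\<bar> + r < \<bar>x\<bar>" for y a r x :: real
        using that by linarith
      ultimately have far': "?W x = 0" if "?R < \<bar>x\<bar>" for x using that by (blast intro: far)
      have cA: "continuous_on UNIV (A t)" "continuous_on UNIV (C t)"
        by (intro cont_strip_slice[OF _ t] cAC)+
      have cw: "continuous_on UNIV (D_t T ?w t)" "continuous_on UNIV (D_x ?w t)"
        by (intro cont_strip_slice[OF _ t] decays_cont V.decays_variation)+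
      have int: "integrable lborel ?W"
        by (rule integrable_continuous_compact_support[OF _ far']) (intro continuous_on_diff continuous_on_mult continuous_on_minus cA cw)
      have Wb: "\<bar>?W x\<bar> \<le> M" for x
      proof (cases "\<bar>x\<bar> \<le> ?R")
        case True
        have bb: "\<bar>bubble bump' bump \<delta> t x\<bar> \<le> b1 * b0" "\<bar>bubble bump bump' \<delta> t x\<bar> \<le> b0 * b1"
          unfolding bubble_def abs_mult using b0 b1 by (auto intro!: mult_mono)
        have "\<bar>\<kappa> * \<mu> * bubble bump bump' \<delta> t x\<bar> \<le> \<bar>\<kappa> * \<mu>\<bar> * (b0 * b1)"
          unfolding abs_mult[of "\<kappa> * \<mu>"] by (intro mult_left_mono bb) auto
        then have wt: "\<bar>D_t T ?w t x\<bar> \<le> b1 * b0 + \<bar>\<kappa> * \<mu>\<bar> * (b0 * b1)" unfolding Dw using bb(1) by linarith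
        have wx: "\<bar>D_x ?w t x\<bar> \<le> \<mu> * (b0 * b1)"
          unfolding Dw abs_mult using \<mu>_pos bb(2) by (intro mult_mono) auto
        have "\<bar>A t x\<bar> * \<bar>D_t T ?w t x\<bar> \<le> KA * (b1 * b0 + \<bar>\<kappa> * \<mu>\<bar> * (b0 * b1))"
          using KA wt t True by (intro mult_mono) auto
        moreover have "\<bar>C t x\<bar> * \<bar>D_x ?w t x\<bar> \<le> KC * (\<mu> * (b0 * b1))"
          using KC wx t True by (intro mult_mono) auto
        moreover have "\<bar>?W x\<bar> \<le> \<bar>A t x\<bar> * \<bar>D_t T ?w t x\<bar> + \<bar>C t x\<bar> * \<bar>D_x ?w t x\<bar>"
          unfolding abs_mult[symmetric] by linarith
        ultimately show ?thesis unfolding M_def by linarith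
      next
        case False
        have "M \<ge> 0" unfolding M_def using KA(1) KC(1) b0(1) b1(1) \<mu>_pos by simp
        then show ?thesis using far'[of x] False by simp
      qed
      have Ws: "?W x = 0" if "\<delta> / \<mu> < \<bar>x - (x0 + \<kappa> * (t - t0))\<bar>" for x
      proof -
        have "\<delta> / \<mu> \<le> \<bar>x - x0 - \<kappa> * (t - t0)\<bar>" using that by (simp add: diff_diff_eq)
        then show ?thesis unfolding Dw using bubble_eq_0_space[OF _ \<delta>(1)] by (simp add: profile_bump)
      qed
      show ?thesis unfolding f[OF t]
        by (rule abs_integral_le_support[OF int Wb Ws]) (use \<delta>(1) \<mu>_pos in auto)
    qed
    have sq: "(?f t)\<^sup>2 \<le> K * \<delta>\<^sup>2 * indicator {t0 - \<delta>..t0 + \<delta>} t" if t: "t \<in> {0..T}" for t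
    proof (cases "t \<in> {t0 - \<delta>..t0 + \<delta>}")
      case True
      have "(?f t)\<^sup>2 \<le> (M * (2 * (\<delta> / \<mu>)))\<^sup>2" using power_mono[OF bound[OF t], of 2] by simp
      also have "\<dots> = K * \<delta>\<^sup>2" by (simp add: K_def power_mult_distrib power_divide)
      finally show ?thesis using True by simp
    next
      case False
      then have "\<delta> < \<bar>t - t0\<bar>" by auto
      then show ?thesis using outside[OF t] False by simp
    qed
    have "continuous_on {0..T} ?f" by (rule decays_continuous_integral[OF V.decays_drift12(1)])
    then have i: "set_integrable lborel {0..T} (\<lambda>t. (?f t)\<^sup>2)"
      by (intro borel_integrable_atLeastAtMost' continuous_on_power)
    have "(LINT t:{0..T}|lborel. (?f t)\<^sup>2) \<le> (LINT t|lborel. K * \<delta>\<^sup>2 * indicator {t0 - \<delta>..t0 + \<delta>} t)"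
      unfolding set_lebesgue_integral_def
    proof (rule integral_mono)
      show "integrable lborel (\<lambda>t. indicator {0..T} t *\<^sub>R (?f t)\<^sup>2)" using i by (simp add: set_integrable_def)
      show "integrable lborel (\<lambda>t. K * \<delta>\<^sup>2 * indicator {t0 - \<delta>..t0 + \<delta>} t)"
        by (intro integrable_mult_right integrable_real_indicator) (auto simp: emeasure_lborel_Icc_eq)
      have "0 \<le> K" by (simp add: K_def)
      then show "indicator {0..T} t *\<^sub>R (?f t)\<^sup>2 \<le> K * \<delta>\<^sup>2 * indicator {t0 - \<delta>..t0 + \<delta>} t" for t
        using sq[of t] by (cases "t \<in> {0..T}") (auto simp: indicator_def)
    qed
    also have "\<dots> = K * (2 * \<delta>) * \<delta>\<^sup>2" using \<delta>(1) by simp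
    finally have le: "(LINT t:{0..T}|lborel. (?f t)\<^sup>2) / \<delta>\<^sup>2 \<le> K * (2 * \<delta>)" using \<delta>(1) by (simp add: pos_divide_le_eq)
    have "0 \<le> (LINT t:{0..T}|lborel. (?f t)\<^sup>2)" by (simp add: set_lebesgue_integral_def integral_nonneg_AE)
    with le show ?thesis by simp
  qed
  have "((\<lambda>\<delta>. K * (2 * \<delta>)) \<longlongrightarrow> K * (2 * 0)) (at_right 0)" by (intro tendsto_intros)
  then have "((\<lambda>\<delta>. K * (2 * \<delta>)) \<longlongrightarrow> 0) (at_right 0)" by simp
  then show ?thesis
    by (rule Lim_null_comparison[rotated]) (use eventually_small in \<open>eventually_elim, simp only: real_norm_def main\<close>)
qed

lemma spike_mem: "0 < \<delta> \<Longrightarrow> \<delta> \<le> t0 \<Longrightarrow> \<delta> \<le> T - t0 \<Longrightarrow> spike \<delta> \<in> diff_variations T"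
  using spike_schwartz spike_ends by (simp add: diff_variations_def)

text \<open>Strict signs are open conditions, so a limit of the desired sign passes it on to some
  \<delta> that also keeps the spike away from both ends of [0,T].\<close>

lemma exists_small:
  fixes F :: "real \<Rightarrow> real"
  assumes lim: "(F \<longlongrightarrow> L) (at_right 0)" and L: "P L" and P: "open {y. P y}"
  shows "\<exists>\<delta>. 0 < \<delta> \<and> \<delta> \<le> t0 \<and> \<delta> \<le> T - t0 \<and> P (F \<delta>)"
proof -
  have "\<forall>\<^sub>F \<delta> in at_right 0. F \<delta> \<in> {y. P y}"
    using topological_tendstoD[OF lim P] L by simp
  with eventually_small have "\<forall>\<^sub>F \<delta> in at_right 0. 0 < \<delta> \<and> \<delta> \<le> t0 \<and> \<delta> \<le> T - t0 \<and> P (F \<delta>)"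
    by eventually_elim simp
  then show ?thesis
    using eventually_happens[of _ "at_right (0::real)"] by (auto simp: trivial_limit_at_right_real)
qed

lemma scaled_tendsto_0:
  fixes f :: "real \<Rightarrow> real"
  assumes "((\<lambda>\<delta>. f \<delta> / \<delta>\<^sup>2) \<longlongrightarrow> L) (at_right 0)"
  shows "(f \<longlongrightarrow> 0) (at_right 0)"
proof -
  have "((\<lambda>\<delta>. \<delta>\<^sup>2 * (f \<delta> / \<delta>\<^sup>2)) \<longlongrightarrow> 0\<^sup>2 * L) (at_right 0)"
    by (intro tendsto_mult tendsto_power tendsto_ident_at assms)
  then have "((\<lambda>\<delta>. \<delta>\<^sup>2 * (f \<delta> / \<delta>\<^sup>2)) \<longlongrightarrow> 0) (at_right 0)" by simp
  then show ?thesis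
    by (rule Lim_transform_eventually) (use eventually_small in \<open>eventually_elim, simp\<close>)
qed

lemma second_variation_spike:
  assumes \<alpha>: "continuous_on {0..T} (deriv_I T \<alpha>)" and \<delta>: "\<delta> > 0"
  shows "variation.second_variation T \<phi> (spike \<delta>) \<alpha> =
    kinetic \<delta>
    + drift1_square \<delta>
    - 2 * drift2_against (\<lambda>t. deriv_I T \<alpha> t - drift t) \<delta>"
proof -
  interpret V: variation T \<phi> "spike \<delta>" by (rule variation_spike[OF \<delta>])
  note c = decays_continuous_integral[OF V.decays_drift12(1)] decays_continuous_integral[OF V.decays_drift12(2)]
    continuous_on_diff[OF \<alpha> continuous_drift]
  have "set_integrable lborel {0..T} (\<lambda>t. (LINT x|lborel. V.drift1 t x)\<^sup>2)"
    "set_integrable lborel {0..T} (\<lambda>t. 2 * ((deriv_I T \<alpha> t - drift t) * (LINT x|lborel. V.drift2 t x)))"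
    by (intro borel_integrable_atLeastAtMost' continuous_on_power continuous_on_mult continuous_on_const c)+
  from set_integral_diff(2)[OF this] show ?thesis
    unfolding V.second_variation_def set_integral_mult_right by (simp only: mult.assoc diff_conv_add_uminus add.assoc)
qed

text \<open>The kinetic and the squared term tend to 0, so only the contribution of
  \<open>drift2\<close> survives. The other factors being positive, the limit has the sign of
  \<kappa> times the vertical velocity at t0.\<close>

lemma second_variation_tendsto:
  assumes \<alpha>: "continuous_on {0..T} (deriv_I T \<alpha>)"
  shows "((\<lambda>\<delta>. variation.second_variation T \<phi> (spike \<delta>) \<alpha>) \<longlongrightarrow>
    2 * \<kappa> * \<mu> ^ 3 * mass bump * mass bump'' * (deriv_I T \<alpha> t0 - drift t0) / (\<phi>_x t0 x0)\<^sup>2) (at_right 0)"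
proof -
  have "((\<lambda>\<delta>. kinetic \<delta>
    + drift1_square \<delta>
    - 2 * drift2_against (\<lambda>t. deriv_I T \<alpha> t - drift t) \<delta>)
    \<longlongrightarrow> 0 + 0 - 2 * (- \<kappa> * \<mu> ^ 3 * mass bump * mass bump'' * (deriv_I T \<alpha> t0 - drift t0) / (\<phi>_x t0 x0)\<^sup>2)) (at_right 0)"
    by (intro tendsto_diff tendsto_add tendsto_mult tendsto_const drift2_tendsto continuous_on_diff \<alpha> continuous_drift
        scaled_tendsto_0[OF kinetic_form_tendsto] scaled_tendsto_0[OF drift1_square_tendsto])
  then have "((\<lambda>\<delta>. variation.second_variation T \<phi> (spike \<delta>) \<alpha>) \<longlongrightarrow>
      0 + 0 - 2 * (- \<kappa> * \<mu> ^ 3 * mass bump * mass bump'' * (deriv_I T \<alpha> t0 - drift t0) / (\<phi>_x t0 x0)\<^sup>2)) (at_right 0)"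
    by (rule Lim_transform_eventually) (use eventually_small in \<open>eventually_elim, simp only: second_variation_spike[OF \<alpha>]\<close>)
  then show ?thesis by (simp add: mult.assoc)
qed

text \<open>A path with vanishing \<beta> is horizontal: its velocity has no component along the
  centre. Then \<open>drift2\<close> is multiplied by 0, and at order \<delta>^2 the second
  variation agrees with that of the kinetic energy alone.\<close>

lemma second_variation_tendsto_horizontal:
  assumes \<alpha>: "continuous_on {0..T} (deriv_I T \<alpha>)" and hor: "\<And>t. t \<in> {0..T} \<Longrightarrow> deriv_I T \<alpha> t = drift t"
  shows "((\<lambda>\<delta>. variation.second_variation T \<phi> (spike \<delta>) \<alpha> / \<delta>\<^sup>2) \<longlongrightarrow>
    mass bump * mass bump' / \<mu> * (\<phi>_x t0 x0 * (1 + \<kappa>\<^sup>2 * \<mu>\<^sup>2) - 2 * \<kappa> * \<mu>\<^sup>2 * \<phi>_t t0 x0)) (at_right 0)"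
proof -
  have zero: "(LINT t:{0..T}|lborel. (deriv_I T \<alpha> t - drift t) * g t) = 0" for g :: "real \<Rightarrow> real"
  proof -
    have "(LINT t:{0..T}|lborel. (deriv_I T \<alpha> t - drift t) * g t) = (LINT t:{0..T}|lborel. 0)"
      by (rule set_lebesgue_integral_cong) (simp_all add: hor)
    then show ?thesis by simp
  qed
  from tendsto_add[OF kinetic_form_tendsto drift1_square_tendsto]
  have "((\<lambda>\<delta>. kinetic \<delta> / \<delta>\<^sup>2
    + drift1_square \<delta> / \<delta>\<^sup>2) \<longlongrightarrow>
    mass bump * mass bump' / \<mu> * (\<phi>_x t0 x0 * (1 + \<kappa>\<^sup>2 * \<mu>\<^sup>2) - 2 * \<kappa> * \<mu>\<^sup>2 * \<phi>_t t0 x0)) (at_right 0)" by simp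
  then show ?thesis
    by (rule Lim_transform_eventually)
      (use eventually_small in \<open>eventually_elim, simp add: second_variation_spike[OF \<alpha>] zero add_divide_distrib\<close>)
qed

end

section \<open>Variations of both signs\<close>

context diff_path
begin

text \<open>The direction \<open>\<kappa>\<close> is the one in which the form \<open>\<phi>_x h_t\<^sup>2 + 2 \<phi>_t h_t h_x\<close> with \<open>h_t = - \<kappa> h_x\<close> is most
  negative; a large \<open>\<mu>\<close> makes the variation thin across it.\<close>

lemma kinetic_sign_neg:
  assumes "0 < t0" "t0 < T" and p: "\<phi>_t t0 x0 \<noteq> 0"
  defines "\<kappa> \<equiv> \<phi>_t t0 x0 / \<phi>_x t0 x0" and "\<mu> \<equiv> 2 * \<phi>_x t0 x0 / \<bar>\<phi>_t t0 x0\<bar>"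
  shows "concentrated_path T \<phi> t0 \<mu>"
    "mass bump * mass bump' / \<mu> * (\<phi>_x t0 x0 * (1 + \<kappa>\<^sup>2 * \<mu>\<^sup>2) - 2 * \<kappa> * \<mu>\<^sup>2 * \<phi>_t t0 x0) < 0"
proof -
  have q: "\<phi>_x t0 x0 > 0" using \<phi>_x_pos[of t0 x0] assms(1,2) by simp
  have \<mu>: "\<mu> > 0" using q p by (simp add: \<mu>_def)
  show "concentrated_path T \<phi> t0 \<mu>" by unfold_locales (use assms(1,2) \<mu> in auto)
  have k: "\<kappa> * \<mu>\<^sup>2 * \<phi>_t t0 x0 = 4 * \<phi>_x t0 x0" "\<kappa>\<^sup>2 * \<mu>\<^sup>2 = 4"
    using q p by (simp_all add: \<kappa>_def \<mu>_def power2_eq_square field_simps)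
  \<comment> \<open>With \<kappa> = \<phi>_t / \<phi>_x the expression equals \<phi>_x - \<mu>^2
    \<phi>_t^2 / \<phi>_x, which is negative once \<mu> exceeds \<phi>_x / |\<phi>_t|. The chosen
    \<mu> is twice that threshold.\<close>
  have "\<phi>_x t0 x0 * (1 + \<kappa>\<^sup>2 * \<mu>\<^sup>2) - 2 * \<kappa> * \<mu>\<^sup>2 * \<phi>_t t0 x0 = - 3 * \<phi>_x t0 x0"
    using k by (simp add: mult.assoc)
  moreover have "mass bump * mass bump' / \<mu> > 0" using mass_bump_pos \<mu> by simp
  ultimately show "mass bump * mass bump' / \<mu> * (\<phi>_x t0 x0 * (1 + \<kappa>\<^sup>2 * \<mu>\<^sup>2) - 2 * \<kappa> * \<mu>\<^sup>2 * \<phi>_t t0 x0) < 0"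
    using q by (intro mult_pos_neg) auto
qed

text \<open>For a spike at rest, h_t is only the cutoff part, whose product with h_x averages out;
  what remains is \<phi>_x h_t^2.\<close>

lemma kinetic_sign_pos:
  assumes "0 < t0" "t0 < T"
  shows "concentrated_path T \<phi> t0 1"
    "mass bump * mass bump' / 1 * (\<phi>_x t0 x0 * (1 + 0\<^sup>2 * 1\<^sup>2) - 2 * 0 * 1\<^sup>2 * \<phi>_t t0 x0) > 0"
  using assms \<phi>_x_pos[of t0 x0] mass_bump_pos by (unfold_locales, auto)

lemma open_signs: "open {y::real. y < 0}" "open {y::real. y > 0}"
  by (auto simp flip: lessThan_def greaterThan_def)

text \<open>The functional \<open>F\<close> is either the kinetic form or the second variation along
  a horizontal path, which share their limit. The hypothesis ranges over all \<kappa> and \<mu>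
  because the two signs use different spikes.\<close>

lemma exists_variation_kinetic_limit:
  fixes F :: "(real \<Rightarrow> real \<Rightarrow> real) \<Rightarrow> real"
  assumes t0: "0 < t0" "t0 < T" and p: "\<phi>_t t0 x0 \<noteq> 0"
    and lim: "\<And>\<kappa> \<mu>. concentrated_path T \<phi> t0 \<mu> \<Longrightarrow>
      ((\<lambda>\<delta>. F (concentration.spike t0 x0 \<kappa> \<mu> \<delta>) / \<delta>\<^sup>2) \<longlongrightarrow>
        mass bump * mass bump' / \<mu> * (\<phi>_x t0 x0 * (1 + \<kappa>\<^sup>2 * \<mu>\<^sup>2) - 2 * \<kappa> * \<mu>\<^sup>2 * \<phi>_t t0 x0)) (at_right 0)"
  shows "\<exists>w\<in>diff_variations T. F w < 0" "\<exists>w\<in>diff_variations T. F w > 0"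
proof -
  let ?\<kappa> = "\<phi>_t t0 x0 / \<phi>_x t0 x0" and ?\<mu> = "2 * \<phi>_x t0 x0 / \<bar>\<phi>_t t0 x0\<bar>"
  interpret N: concentrated_path T \<phi> t0 x0 ?\<kappa> ?\<mu> by (rule kinetic_sign_neg(1)[OF t0 p])
  obtain \<delta> where \<delta>: "0 < \<delta>" "\<delta> \<le> t0" "\<delta> \<le> T - t0" and neg: "F (N.spike \<delta>) / \<delta>\<^sup>2 < 0"
    using N.exists_small[OF lim[OF kinetic_sign_neg(1)[OF t0 p]] kinetic_sign_neg(2)[OF t0 p] open_signs(1)] by blast
  from neg \<delta>(1) have "F (N.spike \<delta>) < 0" by (simp add: divide_less_0_iff)
  with N.spike_mem[OF \<delta>] show "\<exists>w\<in>diff_variations T. F w < 0" by blast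
  interpret P: concentrated_path T \<phi> t0 x0 0 1 by (rule kinetic_sign_pos(1)[OF t0])
  obtain \<delta>' where \<delta>': "0 < \<delta>'" "\<delta>' \<le> t0" "\<delta>' \<le> T - t0" and pos: "F (P.spike \<delta>') / \<delta>'\<^sup>2 > 0"
    using P.exists_small[OF lim[OF kinetic_sign_pos(1)[OF t0]] kinetic_sign_pos(2)[OF t0] open_signs(2)] by blast
  from pos \<delta>'(1) have "F (P.spike \<delta>') > 0" by (simp add: zero_less_divide_iff)
  with P.spike_mem[OF \<delta>'] show "\<exists>w\<in>diff_variations T. F w > 0" by blast
qed

lemma exists_variation_kinetic:
  assumes "0 < t0" "t0 < T" "\<phi>_t t0 x0 \<noteq> 0"
  shows "\<exists>w\<in>diff_variations T. strip_integral (variation.kinetic_form T \<phi> w) < 0"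
    "\<exists>w\<in>diff_variations T. strip_integral (variation.kinetic_form T \<phi> w) > 0"
  using exists_variation_kinetic_limit[OF assms concentrated_path.kinetic_form_tendsto] by blast+

lemma exists_variation_horizontal:
  assumes "0 < t0" "t0 < T" "\<phi>_t t0 x0 \<noteq> 0"
    and "continuous_on {0..T} (deriv_I T \<alpha>)" "\<And>t. t \<in> {0..T} \<Longrightarrow> deriv_I T \<alpha> t = drift t"
  shows "\<exists>w\<in>diff_variations T. variation.second_variation T \<phi> w \<alpha> < 0"
    "\<exists>w\<in>diff_variations T. variation.second_variation T \<phi> w \<alpha> > 0"
  using exists_variation_kinetic_limit[OF assms(1-3)
      concentrated_path.second_variation_tendsto_horizontal[OF _ assms(4,5)]] by blast+

lemma exists_variation_vertical:
  assumes t0: "0 < t0" "t0 < T"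
    and \<alpha>: "continuous_on {0..T} (deriv_I T \<alpha>)" and ver: "deriv_I T \<alpha> t0 \<noteq> drift t0"
  shows "\<exists>w\<in>diff_variations T. variation.second_variation T \<phi> w \<alpha> < 0"
    "\<exists>w\<in>diff_variations T. variation.second_variation T \<phi> w \<alpha> > 0"
proof -
  let ?\<beta> = "deriv_I T \<alpha> t0 - drift t0"
  let ?m = "2 * 1 ^ 3 * mass bump * mass bump'' / (\<phi>_x t0 0)\<^sup>2"
  have m: "?m > 0" using mass_bump_pos \<phi>_x_pos[of t0 0] t0 by simp
  have var: "\<exists>w\<in>diff_variations T. P (variation.second_variation T \<phi> w \<alpha>)"
    if P: "P (\<kappa> * ?m * ?\<beta>)" and op: "open {y. P y}" for P \<kappa>
  proof -
    \<comment> \<open>Any point x0 and any positive \<mu> would do here; the sign is steered by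
      \<kappa> alone.\<close>
    interpret C: concentrated_path T \<phi> t0 0 \<kappa> 1 by (rule kinetic_sign_pos(1)[OF t0])
    have "2 * \<kappa> * 1 ^ 3 * mass bump * mass bump'' * ?\<beta> / (\<phi>_x t0 0)\<^sup>2 = \<kappa> * ?m * ?\<beta>" by simp
    then obtain \<delta> where \<delta>: "0 < \<delta>" "\<delta> \<le> t0" "\<delta> \<le> T - t0"
      and P: "P (variation.second_variation T \<phi> (C.spike \<delta>) \<alpha>)"
      using C.exists_small[OF C.second_variation_tendsto[OF \<alpha>] _ op] P by metis
    with C.spike_mem[OF \<delta>] show ?thesis by blast
  qed
  have \<beta>: "?\<beta> * ?\<beta> > 0" using ver not_real_square_gt_zero[of ?\<beta>] by (metis right_minus_eq)
  \<comment> \<open>The choices \<kappa> = - \<beta> and \<kappa> = \<beta> turn the limit into - m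
    \<beta>^2 and m \<beta>^2, without a case distinction on the sign of \<beta>.\<close>
  have "(- b) * m * b < 0" "b * m * b > 0" if "m > 0" "b * b > 0" for m b :: real
    using mult_pos_pos[OF that] by (simp_all add: mult_ac)
  from this[OF m \<beta>] show "\<exists>w\<in>diff_variations T. variation.second_variation T \<phi> w \<alpha> < 0"
    "\<exists>w\<in>diff_variations T. variation.second_variation T \<phi> w \<alpha> > 0"
    using var[of "\<lambda>y. y < 0" "- ?\<beta>", OF _ open_signs(1)] var[of "\<lambda>y. y > 0" "?\<beta>", OF _ open_signs(2)] by blast+
qed

section \<open>Paths are not local extrema\<close>

lemma moving_point:
  assumes "\<phi> 0 \<noteq> \<phi> T"
  obtains t0 x0 where "0 < t0" "t0 < T" "\<phi>_t t0 x0 \<noteq> 0"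
proof -
  have "\<exists>t0 x0. 0 < t0 \<and> t0 < T \<and> \<phi>_t t0 x0 \<noteq> 0"
  proof (rule ccontr)
    assume none: "\<not> ?thesis"
    have "\<phi> T x = \<phi> 0 x" for x
      by (rule constant_of_zero_derivative[OF smooth_strip_DERIV_t[OF smooth_path]]) (use none in auto)
    with assms show False by (metis ext)
  qed
  with that show ?thesis by blast
qed

lemma exists_variation_second:
  assumes \<alpha>: "\<alpha> \<in> smooth_I T" and ends: "(\<phi> 0, \<alpha> 0) \<noteq> (\<phi> T, \<alpha> T)"
  shows "\<exists>w\<in>diff_variations T. variation.second_variation T \<phi> w \<alpha> < 0"
    "\<exists>w\<in>diff_variations T. variation.second_variation T \<phi> w \<alpha> > 0"
proof -
  note \<alpha>' = smooth_I_derivative(1)[OF \<alpha>]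
  have "(\<exists>w\<in>diff_variations T. variation.second_variation T \<phi> w \<alpha> < 0) \<and>
    (\<exists>w\<in>diff_variations T. variation.second_variation T \<phi> w \<alpha> > 0)"
  proof (cases "\<exists>t0. 0 < t0 \<and> t0 < T \<and> deriv_I T \<alpha> t0 \<noteq> drift t0")
    case True
    then show ?thesis using exists_variation_vertical[OF _ _ \<alpha>'] by blast
  next
    case False
    \<comment> \<open>Points of concentration must be interior, so the case distinction only speaks
      of the open interval. Continuity of both sides extends the equality to the end points.\<close>
    have hor: "deriv_I T \<alpha> t = drift t" if "t \<in> {0..T}" for t
    proof -
      have cl: "closure {0<..<T} = {0..T}" using T_pos by simp
      have "deriv_I T \<alpha> t - drift t = 0"
        by (rule continuous_constant_on_closure[where S="{0<..<T}" and f="\<lambda>t. deriv_I T \<alpha> t - drift t"])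
          (use False that \<alpha>' continuous_drift in \<open>auto simp only: cl intro!: continuous_on_diff\<close>, auto)
      then show ?thesis by simp
    qed
    show ?thesis
    proof (cases "\<phi> 0 = \<phi> T")
      case False
      then obtain t0 x0 where "0 < t0" "t0 < T" "\<phi>_t t0 x0 \<noteq> 0" using moving_point by metis
      then show ?thesis using exists_variation_horizontal[OF _ _ _ \<alpha>' hor] by blast
    next
      case True
      \<comment> \<open>Here \<phi> is a loop and only \<alpha> tells the end points apart. If
        \<phi> stood still, its drift would vanish, and as the path is horizontal \<alpha> would be
        constant.\<close>
      have "\<exists>t0 x0. 0 < t0 \<and> t0 < T \<and> \<phi>_t t0 x0 \<noteq> 0"
      proof (rule ccontr)
        assume none: "\<not> ?thesis"
        have "deriv_I T \<alpha> t = 0" if t: "0 < t" "t < T" for t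
        proof -
          have "\<phi>_t t = (\<lambda>x. 0)" using none t by auto
          then have "\<phi>_tx t x = 0" for x by (simp add: D_x_def[of \<phi>_t])
          then have "drift t = 0" by (simp add: drift_def)
          then show ?thesis using hor[of t] t by simp
        qed
        from constant_of_zero_derivative[OF smooth_I_derivative(2)[OF \<alpha>] this]
        have "\<alpha> T = \<alpha> 0" by simp
        with ends True show False by simp
      qed
      then show ?thesis using exists_variation_horizontal[OF _ _ _ \<alpha>' hor] by blast
    qed
  qed
  then show "\<exists>w\<in>diff_variations T. variation.second_variation T \<phi> w \<alpha> < 0"
    "\<exists>w\<in>diff_variations T. variation.second_variation T \<phi> w \<alpha> > 0" by auto
qed

lemma variation_diff_variations: "w \<in> diff_variations T \<Longrightarrow> variation T \<phi> w"
  by unfold_locales (simp add: diff_variations_def)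

lemma diff_neighbourhood:
  assumes w: "w \<in> diff_variations T" and U: "openin (diff_fixed_ends T (\<phi> 0) (\<phi> T)) U" "\<phi> \<in> U"
  obtains d where "d > 0" "\<And>\<epsilon>. \<bar>\<epsilon>\<bar> < d \<Longrightarrow> variation.perturbed \<phi> w \<epsilon> \<in> U \<inter> diff_paths T"
proof -
  interpret V: variation T \<phi> w by (rule variation_diff_variations[OF w])
  obtain W where W: "openin (diff_path_topology T) W" "U = W \<inter> diff_paths_between T (\<phi> 0) (\<phi> T)"
    using U(1) by (auto simp: diff_fixed_ends_def openin_subtopology)
  obtain e where e: "e > 0" "\<And>\<epsilon>. \<bar>\<epsilon>\<bar> < e \<Longrightarrow> V.perturbed \<epsilon> \<in> W"
    using openin_diff_path_topology_perturbed[OF V.variation W(1)] U(2) W(2) unfolding V.perturbed_def by blast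
  obtain e' where e': "e' > 0" "\<And>\<epsilon>. \<bar>\<epsilon>\<bar> < e' \<Longrightarrow> V.perturbed \<epsilon> \<in> diff_paths T"
    using perturbed_path[OF V.variation] unfolding V.perturbed_def by metis
  have "V.perturbed \<epsilon> 0 = \<phi> 0" "V.perturbed \<epsilon> T = \<phi> T" for \<epsilon>
    using w by (auto simp: V.perturbed_def diff_variations_def)
  then have "V.perturbed \<epsilon> \<in> U \<inter> diff_paths T" if "\<bar>\<epsilon>\<bar> < min e e'" for \<epsilon>
    using e(2)[of \<epsilon>] e'(2)[of \<epsilon>] that by (simp add: W(2) diff_paths_between_def)
  with e(1) e'(1) show ?thesis by (intro that[of "min e e'"]) auto
qed

lemma not_local_extremum_diff:
  assumes "\<phi> 0 \<noteq> \<phi> T"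
  shows "\<not> local_extremum_on (diff_fixed_ends T (\<phi> 0) (\<phi> T)) (diff_energy T) \<phi>"
proof -
  obtain t0 x0 where t0: "0 < t0" "t0 < T" "\<phi>_t t0 x0 \<noteq> 0" using moving_point[OF assms] .
  show ?thesis
  proof (rule indefinite_not_local_extremum[OF _ exists_variation_kinetic[OF t0]])
    fix w U assume w: "w \<in> diff_variations T" and U: "openin (diff_fixed_ends T (\<phi> 0) (\<phi> T)) U" "\<phi> \<in> U"
    interpret V: variation T \<phi> w by (rule variation_diff_variations[OF w])
    obtain d where "d > 0" "\<And>\<epsilon>. \<bar>\<epsilon>\<bar> < d \<Longrightarrow> V.perturbed \<epsilon> \<in> U \<inter> diff_paths T"
      using diff_neighbourhood[OF w U] by blast
    with V.diff_energy_cubic show "\<exists>d A C. d > 0 \<and> (\<forall>\<epsilon>. \<bar>\<epsilon>\<bar> < d \<longrightarrow> V.perturbed \<epsilon> \<in> U \<and>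
        \<bar>diff_energy T (V.perturbed \<epsilon>) - (diff_energy T \<phi> + \<epsilon> * A + \<epsilon>\<^sup>2 * strip_integral V.kinetic_form)\<bar> \<le> C * \<bar>\<epsilon>\<bar> ^ 3)"
      by blast
  qed
qed

lemma vb_neighbourhood:
  assumes w: "w \<in> diff_variations T" and \<alpha>: "\<alpha> \<in> smooth_I T"
    and U: "openin (vb_fixed_ends T (\<phi> 0, \<alpha> 0) (\<phi> T, \<alpha> T)) U" "(\<phi>, \<alpha>) \<in> U"
  obtains d where "d > 0" "\<And>\<epsilon>. \<bar>\<epsilon>\<bar> < d \<Longrightarrow> (variation.perturbed \<phi> w \<epsilon>, \<alpha>) \<in> U"
proof -
  interpret V: variation T \<phi> w by (rule variation_diff_variations[OF w])
  obtain W where W: "openin (vb_path_topology T) W" "U = W \<inter> vb_paths_between T (\<phi> 0, \<alpha> 0) (\<phi> T, \<alpha> T)"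
    using U(1) by (auto simp: vb_fixed_ends_def openin_subtopology)
  \<comment> \<open>A product neighbourhood suffices, because the curve moves only in the first
    factor and keeps \<alpha> fixed.\<close>
  then obtain W1 W2 where W12: "openin (diff_path_topology T) W1" "\<phi> \<in> W1" "\<alpha> \<in> W2" "W1 \<times> W2 \<subseteq> W"
    using U(2) unfolding vb_path_topology_def openin_prod_topology_alt by blast
  obtain e where e: "e > 0" "\<And>\<epsilon>. \<bar>\<epsilon>\<bar> < e \<Longrightarrow> V.perturbed \<epsilon> \<in> W1"
    using openin_diff_path_topology_perturbed[OF V.variation W12(1,2)] unfolding V.perturbed_def by blast
  obtain e' where e': "e' > 0" "\<And>\<epsilon>. \<bar>\<epsilon>\<bar> < e' \<Longrightarrow> V.perturbed \<epsilon> \<in> diff_paths T"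
    using perturbed_path[OF V.variation] unfolding V.perturbed_def by metis
  have "V.perturbed \<epsilon> 0 = \<phi> 0" "V.perturbed \<epsilon> T = \<phi> T" for \<epsilon>
    using w by (auto simp: V.perturbed_def diff_variations_def)
  then have "(V.perturbed \<epsilon>, \<alpha>) \<in> U" if "\<bar>\<epsilon>\<bar> < min e e'" for \<epsilon>
    using e(2)[of \<epsilon>] e'(2)[of \<epsilon>] that W12(3,4) \<alpha> by (auto simp: W(2) vb_paths_between_def vb_paths_def)
  with e(1) e'(1) show ?thesis by (intro that[of "min e e'"]) auto
qed

lemma not_local_extremum_vb:
  assumes \<alpha>: "\<alpha> \<in> smooth_I T" and ends: "(\<phi> 0, \<alpha> 0) \<noteq> (\<phi> T, \<alpha> T)"
  shows "\<not> local_extremum_on (vb_fixed_ends T (\<phi> 0, \<alpha> 0) (\<phi> T, \<alpha> T)) (vb_energy T) (\<phi>, \<alpha>)"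
proof (rule indefinite_not_local_extremum[OF _ exists_variation_second[OF assms]])
  fix w U assume w: "w \<in> diff_variations T"
    and U: "openin (vb_fixed_ends T (\<phi> 0, \<alpha> 0) (\<phi> T, \<alpha> T)) U" "(\<phi>, \<alpha>) \<in> U"
  interpret V: variation T \<phi> w by (rule variation_diff_variations[OF w])
  obtain d where d: "d > 0" "\<And>\<epsilon>. \<bar>\<epsilon>\<bar> < d \<Longrightarrow> (V.perturbed \<epsilon>, \<alpha>) \<in> U"
    using vb_neighbourhood[OF w \<alpha> U] by blast
  obtain e A C where e: "e > 0" "\<And>\<epsilon>. \<bar>\<epsilon>\<bar> < e \<Longrightarrow>
    \<bar>vb_energy T (V.perturbed \<epsilon>, \<alpha>) - (vb_energy T (\<phi>, \<alpha>) + \<epsilon> * A + \<epsilon>\<^sup>2 * V.second_variation \<alpha>)\<bar> \<le> C * \<bar>\<epsilon>\<bar> ^ 3"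
    using V.vb_energy_cubic[OF smooth_I_derivative(1)[OF \<alpha>]] by blast
  show "\<exists>d A C. d > 0 \<and> (\<forall>\<epsilon>. \<bar>\<epsilon>\<bar> < d \<longrightarrow> (V.perturbed \<epsilon>, \<alpha>) \<in> U \<and>
      \<bar>vb_energy T (V.perturbed \<epsilon>, \<alpha>) - (vb_energy T (\<phi>, \<alpha>) + \<epsilon> * A + \<epsilon>\<^sup>2 * V.second_variation \<alpha>)\<bar> \<le> C * \<bar>\<epsilon>\<bar> ^ 3)"
    by (intro exI[of _ "min d e"] exI[of _ A] exI[of _ C]) (use d e in auto)
qed

end

theorem corollary3p3:
  fixes T :: real
  assumes "T > 0"
  shows
    "(\<forall>g0\<in>carrier Diff_S. \<forall>g1\<in>carrier Diff_S. g0 \<noteq> g1 \<longrightarrow>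
        (\<forall>\<phi>\<in>diff_paths_between T g0 g1.
           \<not> local_minimum_on (diff_fixed_ends T g0 g1) (diff_energy T) \<phi>) \<and>
        (\<forall>\<phi>. diff_stationary T g0 g1 \<phi> \<longrightarrow> diff_saddle T g0 g1 \<phi>)) \<and>
     (\<forall>g0\<in>carrier Virasoro_Bott. \<forall>g1\<in>carrier Virasoro_Bott. g0 \<noteq> g1 \<longrightarrow>
        (\<forall>p\<in>vb_paths_between T g0 g1.
           \<not> local_minimum_on (vb_fixed_ends T g0 g1) (vb_energy T) p) \<and>
        (\<forall>p. vb_stationary T g0 g1 p \<longrightarrow> vb_saddle T g0 g1 p))"
proof -
  \<comment> \<open>The stronger statement, that no path with distinct end points is a local
    extremum, yields both the absence of minima and the saddle property.\<close>
  have diff: "\<not> local_extremum_on (diff_fixed_ends T g0 g1) (diff_energy T) \<phi>"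
    if "\<phi> \<in> diff_paths_between T g0 g1" "g0 \<noteq> g1" for g0 g1 \<phi>
  proof -
    have ends: "g0 = \<phi> 0" "g1 = \<phi> T" and path: "\<phi> \<in> diff_paths T"
      using that(1) by (auto simp: diff_paths_between_def)
    interpret diff_path T \<phi> by unfold_locales (fact assms path)+
    show ?thesis using not_local_extremum_diff that(2) by (simp add: ends)
  qed
  have vb: "\<not> local_extremum_on (vb_fixed_ends T g0 g1) (vb_energy T) p"
    if "p \<in> vb_paths_between T g0 g1" "g0 \<noteq> g1" for g0 g1 p
  proof -
    obtain \<phi> \<alpha> where p: "p = (\<phi>, \<alpha>)" by (cases p)
    have ends: "g0 = (\<phi> 0, \<alpha> 0)" "g1 = (\<phi> T, \<alpha> T)"
      and path: "\<phi> \<in> diff_paths T" and \<alpha>: "\<alpha> \<in> smooth_I T"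
      using that(1) by (auto simp: p vb_paths_between_def vb_paths_def)
    interpret diff_path T \<phi> by unfold_locales (fact assms path)+
    show ?thesis using not_local_extremum_vb[OF \<alpha>] that(2) by (simp add: p ends)
  qed
  have diff_min: "\<not> local_minimum_on (diff_fixed_ends T g0 g1) (diff_energy T) \<phi>"
    if "\<phi> \<in> diff_paths_between T g0 g1" "g0 \<noteq> g1" for g0 g1 \<phi>
    using diff[OF that] by (simp add: local_extremum_on_def)
  have vb_min: "\<not> local_minimum_on (vb_fixed_ends T g0 g1) (vb_energy T) p"
    if "p \<in> vb_paths_between T g0 g1" "g0 \<noteq> g1" for g0 g1 p
    using vb[OF that] by (simp add: local_extremum_on_def)
  have diff_saddle: "diff_saddle T g0 g1 \<phi>" if "diff_stationary T g0 g1 \<phi>" "g0 \<noteq> g1" for g0 g1 \<phi>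
    using that diff[of \<phi> g0 g1] by (simp add: diff_saddle_def diff_stationary_def)
  have vb_saddle: "vb_saddle T g0 g1 p" if st: "vb_stationary T g0 g1 p" and ne: "g0 \<noteq> g1" for g0 g1 p
  proof -
    have "p \<in> vb_paths_between T g0 g1" using st by (auto simp: vb_stationary_def)
    from vb[OF this ne] st show ?thesis by (simp add: vb_saddle_def)
  qed
  show ?thesis
    by (intro conjI ballI allI impI; rule diff_min vb_min diff_saddle vb_saddle; assumption)
qed

end
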